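(* Let $n\geq 3$ and let $\omega_1,\omega_2,\omega_3$ be independent germs of integrable holomorphic $1$-forms at $(\mathbb{C}^n,0)$ with singular sets of codimension at least two. Suppose that there exists a non-zero germ of holomorphic $2$-form $\eta$ at $(\mathbb{C}^n,0)$, locally decomposable outside its singular set, that is tangent to each $\omega_i$, i.e. $\eta\wedge\omega_i=0$ for $i=1,2,3$. Then $\omega_1,\omega_2$ and $\omega_3$ define foliations that are in a pencil, that is, there is an integrable pencil $\mathcal{P}$ of $1$-forms at $(\mathbb{C}^n,0)$ such that the foliations defined by $\omega_1,\omega_2,\omega_3$ are all foliations in $\mathcal{P}$. Furthermore, $\eta$ is integrable, defining the axis foliation of this pencil.
   Context: A $1$-form $\omega$ is integrable if $\omega\wedge d\omega=0$. Singular sets are zero sets. Independent means $\omega_i\wedge\omega_j\neq 0$ (not identically zero) for all $i\neq j$. $\eta$ is locally decomposable outside its singular set if near each point where $\eta\neq 0$ it can be written as a wedge product of two holomorphic $1$-forms; it then defines a distribution of codimension two there, and $\eta$ is integrable if this distribution is integrable, in which case $\eta$ defines (after cancelling codimension one components of its zero set) a singular holomorphic foliation of codimension two. The pencil generated by independent germs of holomorphic $1$-forms $\eta_1,\eta_2$ is $\mathcal{P}=\{a\eta_1+b\eta_2:a,b\in\mathbb{C}\}$; it is an integrable pencil if the zero sets of $\eta_1,\eta_2$ have no common component of codimension one and every element of $\mathcal{P}$ is integrable. The foliations in $\mathcal{P}$ are the codimension one foliations defined by its non-zero elements after cancelling codimension one components of their singular sets. The axis foliation of $\mathcal{P}$ is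 the codimension two foliation defined by $\eta_1\wedge\eta_2$ after cancelling singular components of codimension one. *)

theory Defs
  imports "HOL-Analysis.Analysis"
begin

text \<open>
  Germs at the origin are handled through representatives: functions on all of \<open>complex^'n\<close> of which
  only the values near \<open>0\<close> matter.  Every predicate below that is meant for germs is invariant under
  changing a representative away from a neighbourhood of \<open>0\<close>; equality of germs is
  \<open>\<forall>\<^sub>F z in nhds 0. f z = g z\<close>.

  Forms are written in the standard coordinates.  A 1-form is its coefficient vector, with values in
  \<open>complex^'n\<close>; a 2-form is its alternating coefficient matrix, with values in \<open>complex^('n \<times> 'n)\<close>,
  so that \<open>\<eta> = (\<Sum>i<j. \<eta>\<^sub>i\<^sub>j dz\<^sub>i \<and> dz\<^sub>j)\<close>; similarly for 3-forms.  Notions that make sense for forms of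
  any degree are stated for an arbitrary index type \<open>'i\<close>.
\<close>

subsection \<open>Holomorphic functions of several variables\<close>

definition holo_fun_on :: "(complex^'n \<Rightarrow> complex) \<Rightarrow> (complex^'n) set \<Rightarrow> bool" where
  "holo_fun_on f U \<longleftrightarrow> open U \<and>
     (\<forall>z\<in>U. \<exists>f'. (f has_derivative f') (at z) \<and> (\<forall>c v. f' (c *s v) = c * f' v))"

definition holo_on :: "(complex^'n \<Rightarrow> complex^'i) \<Rightarrow> (complex^'n) set \<Rightarrow> bool" where
  "holo_on F U \<longleftrightarrow> (\<forall>i. holo_fun_on (\<lambda>z. F z $ i) U)"

definition holo_fun_germ :: "(complex^'n \<Rightarrow> complex) \<Rightarrow> bool" where
  "holo_fun_germ f \<longleftrightarrow> (\<exists>U. 0 \<in> U \<and> holo_fun_on f U)"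

definition holo_germ :: "(complex^'n \<Rightarrow> complex^'i) \<Rightarrow> bool" where
  "holo_germ F \<longleftrightarrow> (\<exists>U. 0 \<in> U \<and> holo_on F U)"

definition zero_germ :: "(complex^'n \<Rightarrow> 'b::zero) \<Rightarrow> bool" where
  "zero_germ f \<longleftrightarrow> (\<forall>\<^sub>F z in nhds 0. f z = 0)"

definition cpartial :: "'n \<Rightarrow> (complex^'n \<Rightarrow> complex) \<Rightarrow> complex^'n \<Rightarrow> complex" where
  "cpartial i f z = deriv (\<lambda>t. f (z + axis i t)) 0"

subsection \<open>Exterior calculus\<close>

definition alternating_germ :: "(complex^'n \<Rightarrow> complex^('n \<times> 'n)) \<Rightarrow> bool" where
  "alternating_germ \<eta> \<longleftrightarrow> (\<forall>\<^sub>F z in nhds 0. \<forall>i j. \<eta> z $ (i, j) = - \<eta> z $ (j, i))"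

definition holo_1form_germ :: "(complex^'n \<Rightarrow> complex^'n) \<Rightarrow> bool" where
  "holo_1form_germ \<omega> \<longleftrightarrow> holo_germ \<omega>"

definition holo_2form_germ :: "(complex^'n \<Rightarrow> complex^('n \<times> 'n)) \<Rightarrow> bool" where
  "holo_2form_germ \<eta> \<longleftrightarrow> holo_germ \<eta> \<and> alternating_germ \<eta>"

definition wedge11 ::
    "(complex^'n \<Rightarrow> complex^'n) \<Rightarrow> (complex^'n \<Rightarrow> complex^'n) \<Rightarrow> complex^'n \<Rightarrow> complex^('n \<times> 'n)" where
  "wedge11 \<alpha> \<beta> z = (vec_lambda (\<lambda>(i, j). \<alpha> z $ i * \<beta> z $ j - \<alpha> z $ j * \<beta> z $ i))"

definition wedge12 ::
    "(complex^'n \<Rightarrow> complex^'n) \<Rightarrow> (complex^'n \<Rightarrow> complex^('n \<times> 'n)) \<Rightarrow> complex^'n \<Rightarrow> complex^('n \<times> 'n \<times> 'n)" where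
  "wedge12 \<alpha> \<eta> z = (vec_lambda (\<lambda>(i, j, k).
     \<alpha> z $ i * \<eta> z $ (j, k) + \<alpha> z $ j * \<eta> z $ (k, i) + \<alpha> z $ k * \<eta> z $ (i, j)))"

definition wedge21 ::
    "(complex^'n \<Rightarrow> complex^('n \<times> 'n)) \<Rightarrow> (complex^'n \<Rightarrow> complex^'n) \<Rightarrow> complex^'n \<Rightarrow> complex^('n \<times> 'n \<times> 'n)" where
  "wedge21 \<eta> \<alpha> z = (vec_lambda (\<lambda>(i, j, k).
     \<eta> z $ (i, j) * \<alpha> z $ k + \<eta> z $ (j, k) * \<alpha> z $ i + \<eta> z $ (k, i) * \<alpha> z $ j))"

definition ext_deriv :: "(complex^'n \<Rightarrow> complex^'n) \<Rightarrow> complex^'n \<Rightarrow> complex^('n \<times> 'n)" where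
  "ext_deriv \<omega> z = (vec_lambda (\<lambda>(i, j). cpartial i (\<lambda>w. \<omega> w $ j) z - cpartial j (\<lambda>w. \<omega> w $ i) z))"

definition integrable_1form :: "(complex^'n \<Rightarrow> complex^'n) \<Rightarrow> bool" where
  "integrable_1form \<omega> \<longleftrightarrow> zero_germ (wedge12 \<omega> (ext_deriv \<omega>))"

definition independent_1forms :: "(complex^'n \<Rightarrow> complex^'n) \<Rightarrow> (complex^'n \<Rightarrow> complex^'n) \<Rightarrow> bool" where
  "independent_1forms \<alpha> \<beta> \<longleftrightarrow> \<not> zero_germ (wedge11 \<alpha> \<beta>)"

subsection \<open>Analytic set germs, codimension, components\<close>

definition zero_set :: "(complex^'n \<Rightarrow> complex^'i) \<Rightarrow> (complex^'n) set" where
  "zero_set F = {z. F z = 0}"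

definition complex_submanifold :: "nat \<Rightarrow> (complex^'n) set \<Rightarrow> bool" \<comment> \<open>of codimension \<open>k\<close>\<close> where
  "complex_submanifold k M \<longleftrightarrow>
     (\<forall>p\<in>M. \<exists>V (g :: nat \<Rightarrow> complex^'n \<Rightarrow> complex).
        p \<in> V \<and> (\<forall>j<k. holo_fun_on (g j) V) \<and> open V \<and>
        M \<inter> V = {z\<in>V. \<forall>j<k. g j z = 0} \<and>
        (\<forall>c :: nat \<Rightarrow> complex. (\<forall>i. (\<Sum>j<k. c j * cpartial i (g j) p) = 0) \<longrightarrow> (\<forall>j<k. c j = 0)))"

text \<open>
  The dimension of an analytic germ is the largest dimension of complex submanifolds contained in it
  arbitrarily close to \<open>0\<close>; the empty germ has codimension \<open>\<ge> k\<close> for every \<open>k\<close>.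
\<close>
definition codim_ge :: "nat \<Rightarrow> (complex^'n) set \<Rightarrow> bool" where
  "codim_ge k A \<longleftrightarrow> (\<exists>U. open U \<and> 0 \<in> U \<and>
     (\<forall>j M. complex_submanifold j M \<and> M \<noteq> {} \<and> M \<subseteq> A \<inter> U \<longrightarrow> j \<ge> k))"

definition analytic_germ :: "(complex^'n) set \<Rightarrow> bool" where
  "analytic_germ A \<longleftrightarrow> (\<exists>U (G :: (complex^'n \<Rightarrow> complex) set). open U \<and> 0 \<in> U \<and> finite G \<and>
     (\<forall>g\<in>G. holo_fun_on g U) \<and> A \<inter> U = {z\<in>U. \<forall>g\<in>G. g z = 0})"

definition subgerm :: "(complex^'n) set \<Rightarrow> (complex^'n) set \<Rightarrow> bool" where
  "subgerm A B \<longleftrightarrow> (\<forall>\<^sub>F z in nhds 0. z \<in> A \<longrightarrow> z \<in> B)"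

definition irreducible_germ :: "(complex^'n) set \<Rightarrow> bool" where
  "irreducible_germ C \<longleftrightarrow> analytic_germ C \<and> \<not> subgerm C {} \<and>
     (\<forall>A B. analytic_germ A \<and> analytic_germ B \<and> subgerm C (A \<union> B) \<longrightarrow> subgerm C A \<or> subgerm C B)"

definition component_germ :: "(complex^'n) set \<Rightarrow> (complex^'n) set \<Rightarrow> bool" where
  "component_germ C A \<longleftrightarrow> irreducible_germ C \<and> subgerm C A \<and>
     (\<forall>C'. irreducible_germ C' \<and> subgerm C' A \<and> subgerm C C' \<longrightarrow> subgerm C' C)"

definition common_codim1_component :: "(complex^'n) set \<Rightarrow> (complex^'n) set \<Rightarrow> bool" where
  "common_codim1_component A B \<longleftrightarrow>
     (\<exists>C. component_germ C A \<and> component_germ C B \<and> codim_ge 1 C \<and> \<not> codim_ge 2 C)"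

subsection \<open>Foliations defined by forms\<close>

text \<open>
  \<open>\<gamma>\<close> arises from \<open>\<alpha>\<close> by cancelling the codimension one components of its zero set.  When \<open>\<alpha>\<close> is a
  2-form, \<open>\<gamma>\<close> is automatically alternating near \<open>0\<close>, because \<open>h\<close> is non-zero on a dense set.
\<close>
definition saturation :: "(complex^'n \<Rightarrow> complex^'i) \<Rightarrow> (complex^'n \<Rightarrow> complex^'i) \<Rightarrow> bool" where
  "saturation \<alpha> \<gamma> \<longleftrightarrow> holo_germ \<gamma> \<and> codim_ge 2 (zero_set \<gamma>) \<and>
     (\<exists>h. holo_fun_germ h \<and> \<not> zero_germ h \<and> (\<forall>\<^sub>F z in nhds 0. \<alpha> z = h z *s \<gamma> z))"

text \<open>
  The foliation defined by a form is the one given by its saturation, which is unique up to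
  multiplication by a unit.
\<close>
definition same_foliation :: "(complex^'n \<Rightarrow> complex^'i) \<Rightarrow> (complex^'n \<Rightarrow> complex^'i) \<Rightarrow> bool" where
  "same_foliation \<alpha> \<beta> \<longleftrightarrow> (\<exists>\<gamma>. saturation \<alpha> \<gamma> \<and> saturation \<beta> \<gamma>)"

definition locally_decomposable :: "(complex^'n \<Rightarrow> complex^('n \<times> 'n)) \<Rightarrow> bool" where
  "locally_decomposable \<eta> \<longleftrightarrow> (\<exists>U. open U \<and> 0 \<in> U \<and>
     (\<forall>p\<in>U. \<eta> p \<noteq> 0 \<longrightarrow>
        (\<exists>V \<alpha> \<beta>. open V \<and> p \<in> V \<and> holo_on \<alpha> V \<and> holo_on \<beta> V \<and> (\<forall>z\<in>V. \<eta> z = wedge11 \<alpha> \<beta> z))))"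

text \<open>The vectors whose contraction with the 2-form vanishes.\<close>
definition form_kernel :: "(complex^'n \<Rightarrow> complex^('n \<times> 'n)) \<Rightarrow> complex^'n \<Rightarrow> (complex^'n) set" where
  "form_kernel \<eta> p = {v. \<forall>j. (\<Sum>i\<in>UNIV. v $ i * \<eta> p $ (i, j)) = 0}"

definition lie_bracket ::
    "(complex^'n \<Rightarrow> complex^'n) \<Rightarrow> (complex^'n \<Rightarrow> complex^'n) \<Rightarrow> complex^'n \<Rightarrow> complex^'n" where
  "lie_bracket X Y z = (\<chi> j. \<Sum>i\<in>UNIV.
     X z $ i * cpartial i (\<lambda>w. Y w $ j) z - Y z $ i * cpartial i (\<lambda>w. X w $ j) z)"

text \<open>
  Integrability of the codimension two distribution is involutivity: its local holomorphic sections
  are closed under the Lie bracket.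
\<close>
definition integrable_2form :: "(complex^'n \<Rightarrow> complex^('n \<times> 'n)) \<Rightarrow> bool" where
  "integrable_2form \<eta> \<longleftrightarrow> locally_decomposable \<eta> \<and>
     (\<exists>U. open U \<and> 0 \<in> U \<and>
        (\<forall>V X Y. open V \<and> V \<subseteq> U \<and> (\<forall>z\<in>V. \<eta> z \<noteq> 0) \<and> holo_on X V \<and> holo_on Y V \<and>
             (\<forall>z\<in>V. X z \<in> form_kernel \<eta> z \<and> Y z \<in> form_kernel \<eta> z) \<longrightarrow>
           (\<forall>z\<in>V. lie_bracket X Y z \<in> form_kernel \<eta> z)))"

subsection \<open>Pencils\<close>

definition pencil ::
    "(complex^'n \<Rightarrow> complex^'n) \<Rightarrow> (complex^'n \<Rightarrow> complex^'n) \<Rightarrow> (complex^'n \<Rightarrow> complex^'n) set" where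
  "pencil \<eta>\<^sub>1 \<eta>\<^sub>2 = {\<lambda>z. a *s \<eta>\<^sub>1 z + b *s \<eta>\<^sub>2 z | a b. True}"

definition integrable_pencil :: "(complex^'n \<Rightarrow> complex^'n) \<Rightarrow> (complex^'n \<Rightarrow> complex^'n) \<Rightarrow> bool" where
  "integrable_pencil \<eta>\<^sub>1 \<eta>\<^sub>2 \<longleftrightarrow>
     holo_1form_germ \<eta>\<^sub>1 \<and> holo_1form_germ \<eta>\<^sub>2 \<and> independent_1forms \<eta>\<^sub>1 \<eta>\<^sub>2 \<and>
     \<not> common_codim1_component (zero_set \<eta>\<^sub>1) (zero_set \<eta>\<^sub>2) \<and>
     (\<forall>\<alpha>\<in>pencil \<eta>\<^sub>1 \<eta>\<^sub>2. integrable_1form \<alpha>)"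

definition foliation_in_pencil ::
    "(complex^'n \<Rightarrow> complex^'n) \<Rightarrow> (complex^'n \<Rightarrow> complex^'n) \<Rightarrow> (complex^'n \<Rightarrow> complex^'n) \<Rightarrow> bool" where
  "foliation_in_pencil \<omega> \<eta>\<^sub>1 \<eta>\<^sub>2 \<longleftrightarrow>
     (\<exists>\<alpha>\<in>pencil \<eta>\<^sub>1 \<eta>\<^sub>2. \<not> zero_germ \<alpha> \<and> same_foliation \<omega> \<alpha>)"

definition defines_axis_foliation ::
    "(complex^'n \<Rightarrow> complex^('n \<times> 'n)) \<Rightarrow> (complex^'n \<Rightarrow> complex^'n) \<Rightarrow> (complex^'n \<Rightarrow> complex^'n) \<Rightarrow> bool" where
  "defines_axis_foliation \<eta> \<eta>\<^sub>1 \<eta>\<^sub>2 \<longleftrightarrow> same_foliation \<eta> (wedge11 \<eta>\<^sub>1 \<eta>\<^sub>2)"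

end

theory Submission
  imports Defs "HOL-Complex_Analysis.Complex_Analysis"
    "HOL-Computational_Algebra.Fundamental_Theorem_Algebra"
begin

text \<open>
  At a point where \<open>\<eta> = a \<and> b\<close> does not vanish, a form tangent to \<open>\<eta>\<close> is a combination of \<open>a\<close>
  and \<open>b\<close>.  The three forms therefore span only a plane over the meromorphic germs, and Cramer's
  rule gives a relation \<open>f\<^sub>1\<omega>\<^sub>1 + f\<^sub>2\<omega>\<^sub>2 + f\<^sub>3\<omega>\<^sub>3 = 0\<close> whose coefficients are components of the
  wedge products \<open>\<omega>\<^sub>i \<and> \<omega>\<^sub>j\<close>.  Cancel the common factors of the \<open>f\<^sub>i\<close>.  Then already two of them
  are coprime: along a piece of hypersurface on which \<open>f\<^sub>1\<close> and \<open>f\<^sub>2\<close> vanish, \<open>f\<^sub>3\<omega>\<^sub>3\<close> vanishes, and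
  \<open>\<omega>\<^sub>3\<close> vanishes in codimension two only, so that \<open>f\<^sub>3\<close> vanishes too (\<open>coprime_relation\<close>).  The
  pencil is generated by \<open>\<eta>\<^sub>1 = f\<^sub>1\<omega>\<^sub>1\<close> and \<open>\<eta>\<^sub>2 = f\<^sub>2\<omega>\<^sub>2\<close>.  The expression \<open>\<omega> \<and> d\<omega>\<close> is quadratic
  in \<open>\<omega>\<close>; as it vanishes on \<open>\<eta>\<^sub>1\<close>, on \<open>\<eta>\<^sub>2\<close> and on \<open>\<eta>\<^sub>1 + \<eta>\<^sub>2 = -f\<^sub>3\<omega>\<^sub>3\<close>, it vanishes on the whole
  pencil (\<open>integrable_pencil_members\<close>).  Vector fields in the kernel of \<open>\<eta>\<close> are annihilated by the
  integrable forms \<open>\<omega>\<^sub>1\<close> and \<open>\<omega>\<^sub>2\<close>, hence so is their bracket, which is in the kernel of \<open>\<eta>\<close> first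
  where \<open>\<omega>\<^sub>1 \<and> \<omega>\<^sub>2 \<noteq> 0\<close> and then everywhere by continuity.  Finally \<open>\<eta>\<close> and \<open>\<eta>\<^sub>1 \<and> \<eta>\<^sub>2\<close> are
  proportional, so they have the same saturation (\<open>saturationI_proportional\<close>).

  Most of the work goes into the local algebra of germs behind the word ``cancel''.  Two facts are
  needed.  A germ that vanishes at \<open>0\<close> vanishes on smooth hypersurfaces arbitrarily close to \<open>0\<close>
  (\<open>zero_not_codim_ge_2\<close>).  Conversely, if the components of a vector of germs vanish together on
  such hypersurfaces, then they have a common factor that vanishes at \<open>0\<close> (\<open>common_factor\<close>).
  Factors are then split off until the zero set has codimension two; this ends because the order of
  vanishing along a fixed line drops each time (\<open>saturation_exists\<close>).

  The common factor is found as follows.  In a direction \<open>v\<close> that is transverse to the given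
  hypersurfaces, the zeros of one component \<open>f\<close> on the line through \<open>z\<close> are the roots of a
  Weierstrass polynomial in \<open>t\<close>, where \<open>t\<close> stands for the point \<open>z + tv\<close>.  Among the polynomials in
  \<open>t\<close> with coefficients holomorphic in \<open>z\<close> that vanish at the common zeros, take one of least degree.
  Its roots are roots of the Weierstrass polynomial, so its coefficients divided by the leading one
  are bounded and extend holomorphically: it may be taken monic (\<open>minimal_polynomial\<close>).  Dividing
  the given functions by it leaves remainders of smaller degree that vanish at the common zeros
  (\<open>cauchy_division\<close>), so these remainders are zero.  Here \<open>z\<close> runs through an open subset of the
  whole space and not of a hyperplane complementary to \<open>v\<close>, so the factorization sought can be read
  off at \<open>t = 0\<close>.
\<close>

text \<open>The infix \<open>$\<close> stands for the components of vectors only.\<close>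
no_notation fps_nth (infixl \<open>$\<close> 75)

section \<open>Holomorphic functions of several variables\<close>

lemma norm_vector_scalar_mult: "norm (c *s v) = norm c * norm v" for v :: "complex^'n"
  by (simp add: norm_vec_def vector_scalar_mult_def L2_set_def norm_mult power_mult_distrib
      flip: sum_distrib_left) (simp add: real_sqrt_mult)

lemma bounded_bilinear_vector_scalar_mult:
  "bounded_bilinear ((*s) :: complex \<Rightarrow> complex^'n \<Rightarrow> complex^'n)"
proof
  show "\<exists>K. \<forall>a (b :: complex^'n). norm (a *s b) \<le> norm a * norm b * K"
    by (rule exI[of _ 1]) (simp add: norm_vector_scalar_mult)
qed (simp_all add: vec_eq_iff algebra_simps)

lemmas continuous_on_vector_scalar_mult [continuous_intros] =
  bounded_bilinear.continuous_on[OF bounded_bilinear_vector_scalar_mult]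

lemmas tendsto_vector_scalar_mult [tendsto_intros] =
  bounded_bilinear.tendsto[OF bounded_bilinear_vector_scalar_mult]

lemma axis_eq_scale: "axis i t = t *s axis i (1::complex)"
  by (simp add: vec_eq_iff axis_def)

definition dir_deriv :: "complex^'n \<Rightarrow> (complex^'n \<Rightarrow> complex) \<Rightarrow> complex^'n \<Rightarrow> complex" where
  "dir_deriv v f z = deriv (\<lambda>t. f (z + t *s v)) 0"

lemma cpartial_eq_dir_deriv: "cpartial i f = dir_deriv (axis i 1) f"
  by (simp only: fun_eq_iff cpartial_def dir_deriv_def axis_eq_scale[symmetric] simp_thms)

lemma holo_fun_on_open: "holo_fun_on f U \<Longrightarrow> open U"
  by (simp add: holo_fun_on_def)

lemma holo_fun_on_subset: "holo_fun_on f U \<Longrightarrow> open V \<Longrightarrow> V \<subseteq> U \<Longrightarrow> holo_fun_on f V"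
  by (auto simp: holo_fun_on_def)

lemma holo_fun_on_cong:
  assumes "\<And>z. z \<in> U \<Longrightarrow> f z = g z"
  shows "holo_fun_on f U \<longleftrightarrow> holo_fun_on g U"
proof -
  have "(f has_derivative f') (at z) \<longleftrightarrow> (g has_derivative f') (at z)"
    if "open U" "z \<in> U" for z f'
    using has_derivative_transform_within_open[OF _ that, of f f' UNIV g]
      has_derivative_transform_within_open[OF _ that, of g f' UNIV f] assms by auto
  then show ?thesis unfolding holo_fun_on_def by blast
qed

lemma holo_fun_on_locally:
  assumes "open U" "\<And>p. p \<in> U \<Longrightarrow> \<exists>V. p \<in> V \<and> holo_fun_on f V"
  shows "holo_fun_on f U"
  using assms unfolding holo_fun_on_def by metis

lemma holo_fun_on_const [intro]: "open U \<Longrightarrow> holo_fun_on (\<lambda>z. c) U"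
  unfolding holo_fun_on_def by (auto intro!: exI[of _ "\<lambda>v. 0"])

lemma holo_fun_on_add:
  assumes "holo_fun_on f U" "holo_fun_on g U"
  shows "holo_fun_on (\<lambda>z. f z + g z) U"
  unfolding holo_fun_on_def
proof (intro conjI ballI)
  fix z assume "z \<in> U"
  then obtain f' g' where "(f has_derivative f') (at z)" "(g has_derivative g') (at z)"
    "\<forall>c v. f' (c *s v) = c * f' v" "\<forall>c v. g' (c *s v) = c * g' v"
    using assms unfolding holo_fun_on_def by metis
  then show "\<exists>h'. ((\<lambda>z. f z + g z) has_derivative h') (at z) \<and> (\<forall>c v. h' (c *s v) = c * h' v)"
    by (intro exI[of _ "\<lambda>v. f' v + g' v"]) (auto intro: has_derivative_add simp: algebra_simps)
qed (use assms in \<open>simp add: holo_fun_on_def\<close>)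

lemma holo_fun_on_mult:
  assumes "holo_fun_on f U" "holo_fun_on g U"
  shows "holo_fun_on (\<lambda>z. f z * g z) U"
  unfolding holo_fun_on_def
proof (intro conjI ballI)
  fix z assume "z \<in> U"
  then obtain f' g' where "(f has_derivative f') (at z)" "(g has_derivative g') (at z)"
    "\<forall>c v. f' (c *s v) = c * f' v" "\<forall>c v. g' (c *s v) = c * g' v"
    using assms unfolding holo_fun_on_def by metis
  then show "\<exists>h'. ((\<lambda>z. f z * g z) has_derivative h') (at z) \<and> (\<forall>c v. h' (c *s v) = c * h' v)"
    by (intro exI[of _ "\<lambda>v. f z * g' v + f' v * g z"])
       (auto intro!: has_derivative_mult simp: algebra_simps)
qed (use assms in \<open>simp add: holo_fun_on_def\<close>)

lemma holo_fun_on_compose_field: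
  assumes "holo_fun_on f U" "\<And>z. z \<in> U \<Longrightarrow> h field_differentiable (at (f z))"
  shows "holo_fun_on (\<lambda>z. h (f z)) U"
  unfolding holo_fun_on_def
proof (intro conjI ballI)
  fix z assume z: "z \<in> U"
  then obtain f' where f: "(f has_derivative f') (at z)" "\<forall>c v. f' (c *s v) = c * f' v"
    using assms unfolding holo_fun_on_def by metis
  from assms(2)[OF z] obtain d where "(h has_field_derivative d) (at (f z))"
    by (auto simp: field_differentiable_def)
  then have "(h has_derivative (*) d) (at (f z))" by (simp add: has_field_derivative_def)
  from has_derivative_compose[OF f(1) this]
  show "\<exists>h'. ((\<lambda>z. h (f z)) has_derivative h') (at z) \<and> (\<forall>c v. h' (c *s v) = c * h' v)"
    using f(2) by (intro exI[of _ "\<lambda>v. d * f' v"]) auto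
qed (use assms in \<open>simp add: holo_fun_on_def\<close>)

lemma holo_fun_on_uminus: "holo_fun_on f U \<Longrightarrow> holo_fun_on (\<lambda>z. - f z) U"
  by (rule holo_fun_on_compose_field[where h = uminus])
     (auto intro!: derivative_eq_intros exI simp: field_differentiable_def)

lemma holo_fun_on_diff:
  "holo_fun_on f U \<Longrightarrow> holo_fun_on g U \<Longrightarrow> holo_fun_on (\<lambda>z. f z - g z) U"
  using holo_fun_on_add[of f U "\<lambda>z. - g z"] holo_fun_on_uminus[of g U] by simp

lemma holo_fun_on_cmult: "holo_fun_on f U \<Longrightarrow> holo_fun_on (\<lambda>z. c * f z) U"
  by (intro holo_fun_on_mult holo_fun_on_const) (auto simp: holo_fun_on_open)

lemma holo_fun_on_inverse:
  "holo_fun_on f U \<Longrightarrow> (\<And>z. z \<in> U \<Longrightarrow> f z \<noteq> 0) \<Longrightarrow> holo_fun_on (\<lambda>z. inverse (f z)) U"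
  by (rule holo_fun_on_compose_field[where h = inverse])
     (auto intro!: field_differentiable_inverse field_differentiable_ident)

lemma holo_fun_on_divide:
  "holo_fun_on f U \<Longrightarrow> holo_fun_on g U \<Longrightarrow> (\<And>z. z \<in> U \<Longrightarrow> g z \<noteq> 0) \<Longrightarrow>
   holo_fun_on (\<lambda>z. f z / g z) U"
  using holo_fun_on_mult[of f U "\<lambda>z. inverse (g z)"] holo_fun_on_inverse[of g U]
  by (simp add: divide_inverse)

lemma holo_fun_on_sum:
  assumes "open U" "\<And>i. i \<in> I \<Longrightarrow> holo_fun_on (f i) U"
  shows "holo_fun_on (\<lambda>z. \<Sum>i\<in>I. f i z) U"
  using assms(2)
  by (induction I rule: infinite_finite_induct)
     (auto intro!: holo_fun_on_add holo_fun_on_const simp: assms(1))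

lemma holo_fun_on_translate:
  assumes "holo_fun_on f U"
  shows "holo_fun_on (\<lambda>z. f (z + w)) ((\<lambda>z. z + w) -` U)"
  unfolding holo_fun_on_def
proof (intro conjI ballI)
  show "open ((\<lambda>z. z + w) -` U)"
    using holo_fun_on_open[OF assms] by (intro open_vimage continuous_intros) auto
  fix z assume "z \<in> (\<lambda>z. z + w) -` U"
  then obtain f' where f: "(f has_derivative f') (at (z + w))" "\<forall>c v. f' (c *s v) = c * f' v"
    using assms unfolding holo_fun_on_def by (metis vimageD)
  have "((\<lambda>z. z + w) has_derivative (\<lambda>v. v)) (at z)" by (auto intro!: derivative_eq_intros)
  from has_derivative_compose[OF this f(1)] f(2)
  show "\<exists>h'. ((\<lambda>z. f (z + w)) has_derivative h') (at z) \<and> (\<forall>c v. h' (c *s v) = c * h' v)"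
    by blast
qed

lemma holo_fun_on_shift:
  assumes "holo_fun_on f U" "open V" "\<And>z. z \<in> V \<Longrightarrow> z + w \<in> U"
  shows "holo_fun_on (\<lambda>z. f (z + w)) V"
  by (rule holo_fun_on_subset[OF holo_fun_on_translate[OF assms(1)]]) (use assms in auto)

lemma holo_fun_on_continuous_on: "holo_fun_on f U \<Longrightarrow> continuous_on U f"
  by (meson continuous_at_imp_continuous_on has_derivative_continuous holo_fun_on_def)

lemma holo_fun_on_isCont: "holo_fun_on f U \<Longrightarrow> z \<in> U \<Longrightarrow> isCont f z"
  by (meson has_derivative_continuous holo_fun_on_def)

lemma has_derivative_line:
  "((\<lambda>t. z + t *s v) has_derivative (\<lambda>t. t *s v)) (at t)" for v :: "complex^'n"
proof -
  have "bounded_linear (\<lambda>t. t *s v)"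
    using bounded_bilinear.bounded_linear_left[OF bounded_bilinear_vector_scalar_mult] .
  then show ?thesis by (auto intro!: derivative_eq_intros bounded_linear_imp_has_derivative)
qed

lemma times_eq: "(*) c = (\<lambda>t. t * c)" for c :: complex
  by (simp add: fun_eq_iff)

lemma derivative_dir_deriv:
  assumes "(f has_derivative f') (at z)" "\<forall>c v. f' (c *s v) = c * f' v"
  shows "f' = (\<lambda>v. dir_deriv v f z)"
proof
  fix v
  have "((\<lambda>t. f (z + t *s v)) has_derivative (\<lambda>t. f' (t *s v))) (at 0)"
    using has_derivative_compose[OF has_derivative_line[of z v 0], of f f'] assms(1) by simp
  then have "((\<lambda>t. f (z + t *s v)) has_field_derivative f' v) (at 0)"
    unfolding has_field_derivative_def using assms(2) by (simp add: times_eq[of "f' v"])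
  then show "f' v = dir_deriv v f z" unfolding dir_deriv_def by (simp add: DERIV_imp_deriv)
qed

lemma holo_fun_on_has_derivative:
  assumes "holo_fun_on f U" "z \<in> U"
  shows "(f has_derivative (\<lambda>v. dir_deriv v f z)) (at z)" "dir_deriv (c *s v) f z = c * dir_deriv v f z"
proof -
  obtain f' where f': "(f has_derivative f') (at z)" "\<forall>c v. f' (c *s v) = c * f' v"
    using assms unfolding holo_fun_on_def by metis
  with derivative_dir_deriv[OF this]
  show "(f has_derivative (\<lambda>v. dir_deriv v f z)) (at z)" "dir_deriv (c *s v) f z = c * dir_deriv v f z" by metis+
qed

lemma holo_fun_onI:
  assumes "open U" "\<And>z. z \<in> U \<Longrightarrow> (f has_derivative f' z) (at z)"
    "\<And>z c v. z \<in> U \<Longrightarrow> f' z (c *s v) = c * f' z v"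
  shows "holo_fun_on f U"
  using assms unfolding holo_fun_on_def by metis

lemma dir_deriv_has_field_derivative:
  assumes "holo_fun_on f U" "z + t *s v \<in> U"
  shows "((\<lambda>t. f (z + t *s v)) has_field_derivative dir_deriv v f (z + t *s v)) (at t)"
proof -
  note d = holo_fun_on_has_derivative[OF assms]
  have "((\<lambda>t. f (z + t *s v)) has_derivative (\<lambda>s. dir_deriv (s *s v) f (z + t *s v))) (at t)"
    using has_derivative_compose[OF has_derivative_line[of z v t] d(1)] .
  then show ?thesis
    unfolding has_field_derivative_def d(2) times_eq[of "dir_deriv v f _"] by simp
qed

lemma open_line_preimage: "open U \<Longrightarrow> open {t. z + t *s v \<in> U}" for v :: "complex^'n"
  using open_vimage[of U "\<lambda>t. z + t *s v"] by (simp add: vimage_def continuous_intros)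

lemma holo_fun_on_line:
  assumes "holo_fun_on f U" "\<And>t. t \<in> T \<Longrightarrow> z + t *s v \<in> U"
  shows "(\<lambda>t. f (z + t *s v)) holomorphic_on T"
  by (rule holomorphic_onI, rule field_differentiable_at_within)
     (use dir_deriv_has_field_derivative[OF assms(1) assms(2)] in \<open>auto simp: field_differentiable_def\<close>)

lemma deriv_line:
  assumes "holo_fun_on f U" "z + t *s v \<in> U"
  shows "deriv (\<lambda>t. f (z + t *s v)) t = dir_deriv v f (z + t *s v)"
  using dir_deriv_has_field_derivative[OF assms] by (rule DERIV_imp_deriv)

lemma dir_deriv_add:
  assumes "holo_fun_on f U" "holo_fun_on g U" "z \<in> U"
  shows "dir_deriv v (\<lambda>z. f z + g z) z = dir_deriv v f z + dir_deriv v g z"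
proof -
  have "z + 0 *s v \<in> U" using assms by simp
  from DERIV_add[OF dir_deriv_has_field_derivative[OF assms(1) this] dir_deriv_has_field_derivative[OF assms(2) this]]
  show ?thesis unfolding dir_deriv_def[of v "\<lambda>z. f z + g z"] by (auto dest: DERIV_imp_deriv)
qed

lemma dir_deriv_mult:
  assumes "holo_fun_on f U" "holo_fun_on g U" "z \<in> U"
  shows "dir_deriv v (\<lambda>z. f z * g z) z = dir_deriv v f z * g z + f z * dir_deriv v g z"
proof -
  have "z + 0 *s v \<in> U" using assms by simp
  from DERIV_mult[OF dir_deriv_has_field_derivative[OF assms(1) this] dir_deriv_has_field_derivative[OF assms(2) this]]
  show ?thesis unfolding dir_deriv_def[of v "\<lambda>z. f z * g z"] by (auto dest: DERIV_imp_deriv simp: mult.commute)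
qed

lemma dir_deriv_cong:
  assumes "\<forall>\<^sub>F z in nhds p. f z = g z"
  shows "dir_deriv v f p = dir_deriv v g p"
proof -
  have "((\<lambda>t. p + t *s v) \<longlongrightarrow> p + 0 *s v) (nhds 0)"
    by (intro tendsto_intros filterlim_ident)
  then have "filterlim (\<lambda>t. p + t *s v) (nhds p) (nhds 0)" by simp
  from eventually_compose_filterlim[OF assms this]
  show ?thesis unfolding dir_deriv_def by (intro deriv_cong_ev) auto
qed

lemma contour_integral_circle:
  "contour_integral (circlepath 0 \<rho>) f =
     integral (cbox 0 1) (\<lambda>\<theta>. f (of_real \<rho> * exp (2 * of_real pi * \<i> * of_real \<theta>)) *
       (2 * of_real pi * \<i> * of_real \<rho> * exp (2 * of_real pi * \<i> * of_real \<theta>)))"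
  unfolding contour_integral_integral box_real
  by (simp add: vector_derivative_circlepath) (simp add: circlepath mult_ac)

lemma continuous_on_circle_integral:
  fixes U :: "'a::topological_space set"
  assumes "continuous_on (U \<times> sphere 0 \<rho>) (\<lambda>(x, s). K x s)" "\<rho> \<ge> 0"
  shows "continuous_on U (\<lambda>x. contour_integral (circlepath 0 \<rho>) (K x))"
  unfolding contour_integral_circle
proof (rule integral_continuous_on_param)
  have "continuous_on (U \<times> cbox 0 1)
    ((\<lambda>(x, s). K x s) \<circ> (\<lambda>(x, \<theta>). (x, of_real \<rho> * exp (2 * of_real pi * \<i> * of_real \<theta>))))"
    unfolding split_beta
  proof (rule continuous_on_compose)
    show "continuous_on (U \<times> cbox 0 1)
      (\<lambda>p. (fst p, of_real \<rho> * exp (2 * of_real pi * \<i> * of_real (snd p))))"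
      by (intro continuous_intros)
    show "continuous_on ((\<lambda>p. (fst p, of_real \<rho> * exp (2 * of_real pi * \<i> * of_real (snd p)))) `
       (U \<times> cbox 0 1)) (\<lambda>p. K (fst p) (snd p))"
      by (rule continuous_on_subset[OF assms(1)[unfolded split_beta]])
         (use assms(2) in \<open>auto simp: norm_mult\<close>)
  qed
  then show "continuous_on (U \<times> cbox 0 1)
    (\<lambda>(x, \<theta>). K x (of_real \<rho> * exp (2 * of_real pi * \<i> * of_real \<theta>)) *
       (2 * of_real pi * \<i> * of_real \<rho> * exp (2 * of_real pi * \<i> * of_real \<theta>)))"
    unfolding split_beta o_def fst_conv snd_conv by (intro continuous_intros) auto
qed

lemma dir_deriv_Cauchy:
  assumes "holo_fun_on f U" "\<rho> > 0" "\<And>t. norm t \<le> \<rho> \<Longrightarrow> z + t *s v \<in> U"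
  shows "dir_deriv v f z = contour_integral (circlepath 0 \<rho>) (\<lambda>t. f (z + t *s v) / t\<^sup>2) / (2 * pi * \<i>)"
proof -
  have h: "(\<lambda>t. f (z + t *s v)) holomorphic_on cball 0 \<rho>"
    by (rule holo_fun_on_line[OF assms(1)]) (use assms(3) in auto)
  have "contour_integral (circlepath 0 \<rho>) (\<lambda>t. f (z + t *s v) / (t - 0)\<^sup>2) =
     (2 * pi * \<i>) * deriv (\<lambda>t. f (z + t *s v)) 0"
    by (rule Cauchy_contour_integral_circlepath_2)
       (use h assms(2) in \<open>auto intro: holomorphic_on_imp_continuous_on holomorphic_on_subset\<close>)
  then show ?thesis by (simp add: dir_deriv_def)
qed

lemma line_stays_near:
  fixes v :: "complex^'n"
  assumes "open U" "p \<in> U"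
  obtains r \<rho> where "r > 0" "\<rho> > 0" "\<And>z t. z \<in> ball p r \<Longrightarrow> norm t \<le> \<rho> \<Longrightarrow> z + t *s v \<in> U"
proof -
  obtain r' where r': "r' > 0" "ball p r' \<subseteq> U"
    using assms by (meson openE)
  define r where "r = r' / 2"
  have r: "r > 0" "ball p (2 * r) \<subseteq> U" using r' by (auto simp: r_def)
  define \<rho> where "\<rho> = r / (norm v + 1)"
  show ?thesis
  proof (rule that[of r \<rho>])
    show pos: "\<rho> > 0" using r norm_ge_zero[of v] by (simp add: \<rho>_def add_nonneg_pos)
    fix z and t :: complex assume z: "z \<in> ball p r" "norm t \<le> \<rho>"
    have "norm t * norm v \<le> \<rho> * (norm v + 1)" by (intro mult_mono) (use z pos in auto)
    also have "\<dots> = r" using norm_ge_zero[of v] by (simp add: \<rho>_def add_nonneg_eq_0_iff)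
    finally have "norm (t *s v) \<le> r" by (simp add: norm_vector_scalar_mult)
    moreover have "dist p (z + t *s v) \<le> dist p z + norm (t *s v)"
      by (metis dist_norm norm_triangle_ineq4 diff_diff_eq)
    ultimately show "z + t *s v \<in> U" using r z by (auto intro!: subsetD[OF r(2)])
  qed (use r in auto)
qed

section \<open>Integrals depending holomorphically on a parameter\<close>

text \<open>Cauchy's formula writes the derivative as an integral of \<open>K\<close> itself, from which it inherits the
  joint continuity.\<close>
lemma continuous_on_dir_deriv_param:
  fixes K :: "complex^'n \<Rightarrow> 'b::t2_space \<Rightarrow> complex"
  assumes "open U" "continuous_on (U \<times> S) (\<lambda>(z, s). K z s)"
    and holo: "\<And>s. s \<in> S \<Longrightarrow> holo_fun_on (\<lambda>z. K z s) U"
  shows "continuous_on (U \<times> S) (\<lambda>(z, s). dir_deriv v (\<lambda>z. K z s) z)"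
  unfolding continuous_on_eq_continuous_within
proof
  fix x assume x: "x \<in> U \<times> S"
  then obtain r \<rho> where r: "r > 0" "\<rho> > 0"
    "\<And>z t. z \<in> ball (fst x) r \<Longrightarrow> norm t \<le> \<rho> \<Longrightarrow> z + t *s v \<in> U"
    using line_stays_near[OF assms(1), of "fst x" v] by (metis mem_Times_iff)
  let ?B = "ball (fst x) r"
  have sub: "?B \<subseteq> U" using r(3)[of _ 0] r(2) by auto
  have "continuous_on ((?B \<times> S) \<times> sphere 0 \<rho>) (\<lambda>(x, t). K (fst x + t *s v) (snd x))"
  proof -
    have "continuous_on ((?B \<times> S) \<times> sphere 0 \<rho>)
       ((\<lambda>(z, s). K z s) \<circ> (\<lambda>p. (fst (fst p) + snd p *s v, snd (fst p))))"
    proof (rule continuous_on_compose)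
      show "continuous_on ((?B \<times> S) \<times> sphere 0 \<rho>) (\<lambda>p. (fst (fst p) + snd p *s v, snd (fst p)))"
        by (intro continuous_intros)
      show "continuous_on ((\<lambda>p. (fst (fst p) + snd p *s v, snd (fst p))) ` ((?B \<times> S) \<times> sphere 0 \<rho>))
          (\<lambda>(z, s). K z s)"
        by (rule continuous_on_subset[OF assms(2)]) (use r(3) in auto)
    qed
    then show ?thesis by (simp add: o_def split_beta)
  qed
  then have "continuous_on ((?B \<times> S) \<times> sphere 0 \<rho>) (\<lambda>(x, t). K (fst x + t *s v) (snd x) / t\<^sup>2)"
    unfolding split_beta by (intro continuous_intros) (use r(2) in auto)
  from continuous_on_circle_integral[OF this] r(2)
  have "continuous_on (?B \<times> S)
      (\<lambda>x. contour_integral (circlepath 0 \<rho>) (\<lambda>t. K (fst x + t *s v) (snd x) / t\<^sup>2) / (2 * pi * \<i>))"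
    by (intro continuous_intros) auto
  moreover have "contour_integral (circlepath 0 \<rho>) (\<lambda>t. K (fst y + t *s v) (snd y) / t\<^sup>2) / (2 * pi * \<i>) =
      dir_deriv v (\<lambda>z. K z (snd y)) (fst y)" if "y \<in> ?B \<times> S" for y
    by (rule dir_deriv_Cauchy[OF holo, symmetric]) (use that r in auto)
  ultimately have c: "continuous_on (?B \<times> S) (\<lambda>x. dir_deriv v (\<lambda>z. K z (snd x)) (fst x))"
    by (simp cong: continuous_on_cong)
  have "x \<in> ?B \<times> S" using x r(1) by (auto simp: mem_Times_iff)
  with c have "continuous (at x within (?B \<times> S)) (\<lambda>x. dir_deriv v (\<lambda>z. K z (snd x)) (fst x))"
    by (rule continuous_on_eq_continuous_within[THEN iffD1, rule_format])
  moreover have "at x within (U \<times> S) = at x within (?B \<times> S)"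
    by (rule at_within_nhd[of x "?B \<times> UNIV"])
       (use sub x r(1) in \<open>auto simp: open_Times mem_Times_iff\<close>)
  ultimately show "continuous (at x within (U \<times> S)) (\<lambda>(z, s). dir_deriv v (\<lambda>z. K z s) z)"
    unfolding case_prod_beta' by simp
qed

text \<open>
  Differentiation under the integral.  The functions constructed below are all integrals of this
  kind: derivatives, extensions, power sums of roots, quotients and remainders.
\<close>
lemma holo_fun_on_circle_integral:
  fixes K :: "complex^'n \<Rightarrow> complex \<Rightarrow> complex"
  assumes "open U" "\<rho> \<ge> 0" "continuous_on (U \<times> sphere 0 \<rho>) (\<lambda>(z, s). K z s)"
    and holo: "\<And>s. norm s = \<rho> \<Longrightarrow> holo_fun_on (\<lambda>z. K z s) U"
  shows "holo_fun_on (\<lambda>z. contour_integral (circlepath 0 \<rho>) (K z)) U"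
proof (rule holo_fun_on_locally[OF assms(1)])
  fix p assume "p \<in> U"
  then obtain r where r: "r > 0" "ball p r \<subseteq> U" using assms(1) by (meson openE)
  define E where "E \<theta> = of_real \<rho> * exp (2 * of_real pi * \<i> * of_real \<theta>)" for \<theta> :: real
  define w where "w \<theta> = 2 * of_real pi * \<i> * of_real \<rho> * exp (2 * of_real pi * \<i> * of_real \<theta>)" for \<theta> :: real
  have E: "norm (E \<theta>) = \<rho>" for \<theta> using assms(2) by (simp add: E_def norm_mult)
  have cE: "continuous_on A E" and cw: "continuous_on A w" for A
    unfolding E_def w_def by (intro continuous_intros)+
  define L where "L z \<theta> v = dir_deriv v (\<lambda>z. K z (E \<theta>)) z * w \<theta>" for z \<theta> v
  have der: "((\<lambda>z. K z (E \<theta>) * w \<theta>) has_derivative L z \<theta>) (at z)" if "z \<in> U" for z \<theta>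
    unfolding L_def using holo_fun_on_has_derivative(1)[OF holo[OF E] that]
    by (auto intro!: derivative_eq_intros)
  have comp: "continuous_on (ball p r \<times> cbox 0 1) (\<lambda>(z, \<theta>). f z (E \<theta>))"
    if "continuous_on (U \<times> sphere 0 \<rho>) (\<lambda>(z, s). f z s)" for f :: "complex^'n \<Rightarrow> complex \<Rightarrow> complex"
  proof -
    have c: "continuous_on (ball p r \<times> cbox 0 1) (\<lambda>x. (fst x, E (snd x)))"
      by (intro continuous_intros continuous_on_compose2[OF cE[of UNIV]]) auto
    have "continuous_on ((\<lambda>x. (fst x, E (snd x))) ` (ball p r \<times> cbox 0 1)) (\<lambda>(z, s). f z s)"
      by (rule continuous_on_subset[OF that]) (use r E in auto)
    from continuous_on_compose[OF c this] show ?thesis by (simp add: o_def split_beta)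
  qed
  have cw2: "continuous_on (ball p r \<times> cbox 0 1) (\<lambda>x. w (snd x))"
    by (intro continuous_on_compose2[OF cw[of UNIV]] continuous_intros) auto
  have bl: "blinfun_apply (Blinfun (L z \<theta>)) = L z \<theta>" if "z \<in> U" for z \<theta>
    by (rule bounded_linear_Blinfun_apply[OF has_derivative_bounded_linear[OF der[OF that]]])
  have cont: "continuous_on (ball p r \<times> cbox 0 1) (\<lambda>(z, \<theta>). Blinfun (L z \<theta>))"
  proof (rule continuous_on_blinfun_componentwise)
    fix v :: "complex^'n"
    have "continuous_on (ball p r \<times> cbox 0 1) (\<lambda>(z, \<theta>). dir_deriv v (\<lambda>z. K z (E \<theta>)) z)"
      by (rule comp, rule continuous_on_dir_deriv_param) (use assms holo in auto)
    then have "continuous_on (ball p r \<times> cbox 0 1) (\<lambda>x. L (fst x) (snd x) v)"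
      unfolding L_def split_beta using cw2 by (intro continuous_intros)
    then show "continuous_on (ball p r \<times> cbox 0 1) (\<lambda>x. blinfun_apply (case x of (z, \<theta>) \<Rightarrow> Blinfun (L z \<theta>)) v)"
      by (rule continuous_on_eq) (use r bl in \<open>auto simp: split_beta\<close>)
  qed
  have contK: "continuous_on (ball p r \<times> cbox 0 1) (\<lambda>(z, \<theta>). K z (E \<theta>) * w \<theta>)"
    using comp[OF assms(3)] cw2 unfolding split_beta by (intro continuous_intros)
  have int: "(\<lambda>\<theta>. K z (E \<theta>) * w \<theta>) integrable_on cbox 0 1" if "z \<in> ball p r" for z
  proof (rule integrable_continuous)
    have "continuous_on (cbox 0 1) ((\<lambda>(z, \<theta>). K z (E \<theta>) * w \<theta>) \<circ> (\<lambda>\<theta>. (z, \<theta>)))"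
      by (intro continuous_on_compose continuous_intros continuous_on_subset[OF contK])
         (use that in auto)
    then show "continuous_on (cbox 0 1) (\<lambda>\<theta>. K z (E \<theta>) * w \<theta>)" by (simp add: o_def)
  qed
  have intL: "(\<lambda>\<theta>. Blinfun (L z \<theta>)) integrable_on cbox 0 1" if "z \<in> ball p r" for z
  proof (rule integrable_continuous)
    have "continuous_on (cbox 0 1) ((\<lambda>(z, \<theta>). Blinfun (L z \<theta>)) \<circ> (\<lambda>\<theta>. (z, \<theta>)))"
      by (intro continuous_on_compose continuous_intros continuous_on_subset[OF cont])
         (use that in auto)
    then show "continuous_on (cbox 0 1) (\<lambda>\<theta>. Blinfun (L z \<theta>))" by (simp add: o_def)
  qed
  have "holo_fun_on (\<lambda>z. integral (cbox 0 1) (\<lambda>\<theta>. K z (E \<theta>) * w \<theta>)) (ball p r)"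
  proof (rule holo_fun_onI)
    fix z c v assume z: "z \<in> ball p r"
    have "((\<lambda>z. integral (cbox 0 1) (\<lambda>\<theta>. K z (E \<theta>) * w \<theta>)) has_derivative
            integral (cbox 0 1) (\<lambda>\<theta>. Blinfun (L z \<theta>))) (at z within ball p r)"
    proof (rule leibniz_rule[OF _ int cont z convex_ball])
      fix x t assume "x \<in> ball p r" "t \<in> cbox (0::real) 1"
      then have "x \<in> U" using r by auto
      then show "((\<lambda>x. K x (E t) * w t) has_derivative blinfun_apply (Blinfun (L x t))) (at x within ball p r)"
        unfolding bl[OF \<open>x \<in> U\<close>] using der has_derivative_at_withinI by blast
    qed
    then show "((\<lambda>z. integral (cbox 0 1) (\<lambda>\<theta>. K z (E \<theta>) * w \<theta>)) has_derivative
            integral (cbox 0 1) (\<lambda>\<theta>. Blinfun (L z \<theta>))) (at z)"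
      using z by (simp add: at_within_open[OF z open_ball])
    have "L z \<theta> (c *s v) = c * L z \<theta> v" for \<theta>
      unfolding L_def using holo_fun_on_has_derivative(2)[OF holo[OF E]] r z by auto
    then show "blinfun_apply (integral (cbox 0 1) (\<lambda>\<theta>. Blinfun (L z \<theta>))) (c *s v) =
           c * blinfun_apply (integral (cbox 0 1) (\<lambda>\<theta>. Blinfun (L z \<theta>))) v"
      using z r by (subst (1 2) blinfun_apply_integral[OF intL[OF z]])
        (simp add: bl subset_eq)
  qed auto
  then show "\<exists>V. p \<in> V \<and> holo_fun_on (\<lambda>z. contour_integral (circlepath 0 \<rho>) (K z)) V"
    unfolding contour_integral_circle E_def w_def using r(1) by (intro exI[of _ "ball p r"]) auto
qed

lemma holo_fun_on_dir_deriv: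
  assumes "holo_fun_on f U"
  shows "holo_fun_on (dir_deriv v f) U"
proof (rule holo_fun_on_locally)
  show "open U" using assms by (rule holo_fun_on_open)
  fix p assume p: "p \<in> U"
  obtain r \<rho> where r: "r > 0" "\<rho> > 0" "\<And>z t. z \<in> ball p r \<Longrightarrow> norm t \<le> \<rho> \<Longrightarrow> z + t *s v \<in> U"
    using line_stays_near[OF holo_fun_on_open[OF assms] p] by metis
  have "holo_fun_on (\<lambda>z. contour_integral (circlepath 0 \<rho>) (\<lambda>t. f (z + t *s v) / t\<^sup>2)) (ball p r)"
  proof (rule holo_fun_on_circle_integral)
    have "continuous_on (ball p r \<times> sphere 0 \<rho>) (\<lambda>x. f (fst x + snd x *s v) / (snd x)\<^sup>2)"
      by (intro continuous_intros continuous_on_compose2[OF holo_fun_on_continuous_on[OF assms]])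
         (use r in auto)
    then show "continuous_on (ball p r \<times> sphere 0 \<rho>) (\<lambda>(z, t). f (z + t *s v) / t\<^sup>2)"
      by (simp add: split_beta)
    fix s :: complex assume s: "norm s = \<rho>"
    show "holo_fun_on (\<lambda>z. f (z + s *s v) / s\<^sup>2) (ball p r)"
      by (intro holo_fun_on_divide holo_fun_on_const holo_fun_on_shift[OF assms]) (use r s in auto)
  qed (use r in auto)
  then have A: "holo_fun_on (\<lambda>z. contour_integral (circlepath 0 \<rho>) (\<lambda>t. f (z + t *s v) / t\<^sup>2) / (2 * pi * \<i>)) (ball p r)"
    by (intro holo_fun_on_divide holo_fun_on_const) auto
  have "contour_integral (circlepath 0 \<rho>) (\<lambda>t. f (z + t *s v) / t\<^sup>2) / (2 * pi * \<i>) = dir_deriv v f z"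
    if "z \<in> ball p r" for z
    by (rule dir_deriv_Cauchy[OF assms, symmetric]) (use that r in auto)
  then have "holo_fun_on (dir_deriv v f) (ball p r)"
    by (rule holo_fun_on_cong[THEN iffD1, rotated, OF A])
  then show "\<exists>V. p \<in> V \<and> holo_fun_on (dir_deriv v f) V" using r(1) by (intro exI[of _ "ball p r"]) auto
qed

lemma holo_fun_on_dir_deriv_pow: "holo_fun_on f U \<Longrightarrow> holo_fun_on ((dir_deriv v ^^ k) f) U"
  by (induction k) (auto intro: holo_fun_on_dir_deriv)

lemma holo_fun_on_cpartial: "holo_fun_on f U \<Longrightarrow> holo_fun_on (cpartial i f) U"
  by (simp add: cpartial_eq_dir_deriv holo_fun_on_dir_deriv)

lemma higher_deriv_line:
  assumes "holo_fun_on f U" "z + t *s v \<in> U"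
  shows "(deriv ^^ k) (\<lambda>t. f (z + t *s v)) t = (dir_deriv v ^^ k) f (z + t *s v)"
  using assms(2)
proof (induction k arbitrary: t)
  case (Suc k)
  have o: "open {t. z + t *s v \<in> U}" using open_line_preimage holo_fun_on_open assms(1) by blast
  have "deriv ((deriv ^^ k) (\<lambda>t. f (z + t *s v))) t = deriv (\<lambda>t. (dir_deriv v ^^ k) f (z + t *s v)) t"
    by (rule deriv_cong_ev) (use Suc o in \<open>auto simp: eventually_nhds\<close>)
  also have "\<dots> = dir_deriv v ((dir_deriv v ^^ k) f) (z + t *s v)"
    by (rule deriv_line[OF holo_fun_on_dir_deriv_pow[OF assms(1)] Suc.prems])
  finally show ?case by simp
qed auto

section \<open>The identity theorem and the persistence of zeros\<close>

lemma convex_line_preimage: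
  fixes v :: "complex^'n"
  assumes "convex U"
  shows "convex {t. p + t *s v \<in> U}"
proof (rule convexI)
  fix s t :: complex and u w :: real
  assume *: "s \<in> {t. p + t *s v \<in> U}" "t \<in> {t. p + t *s v \<in> U}" "0 \<le> u" "0 \<le> w" "u + w = 1"
  have "u *\<^sub>R (p + s *s v) + w *\<^sub>R (p + t *s v) \<in> U"
    using assms * by (auto simp: convex_def)
  also have "u *\<^sub>R (p + s *s v) + w *\<^sub>R (p + t *s v) = (u + w) *\<^sub>R p + (u *\<^sub>R s + w *\<^sub>R t) *s v"
    by (simp add: vec_eq_iff algebra_simps)
  finally show "u *\<^sub>R s + w *\<^sub>R t \<in> {t. p + t *s v \<in> U}" using * by simp
qed

text \<open>Restriction to the complex line through \<open>p\<close> and \<open>z\<close> reduces this to one variable.\<close>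
lemma identity_theorem:
  assumes "holo_fun_on f U" "convex U" "\<forall>\<^sub>F z in nhds p. f z = 0" "p \<in> U" "z \<in> U"
  shows "f z = 0"
proof -
  let ?T = "{t. p + t *s (z - p) \<in> U}"
  have conv: "convex ?T" by (rule convex_line_preimage[OF assms(2)])
  have op: "open ?T" using open_line_preimage holo_fun_on_open assms(1) by blast
  obtain V where V: "open V" "p \<in> V" "\<And>z. z \<in> V \<Longrightarrow> f z = 0"
    using assms(3) by (auto simp: eventually_nhds)
  let ?V = "{t. p + t *s (z - p) \<in> V} \<inter> ?T"
  have "f (p + 1 *s (z - p)) = 0"
  proof (rule analytic_continuation_open[of ?V ?T "\<lambda>t. f (p + t *s (z - p))" "\<lambda>_. 0"])
    show "open ?V" using open_line_preimage V(1) op by blast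
    have "0 \<in> ?V" using V assms(4) by simp
    then show "?V \<noteq> {}" by blast
    show "(\<lambda>t. f (p + t *s (z - p))) holomorphic_on ?T"
      by (rule holo_fun_on_line[OF assms(1)]) auto
  qed (use op conv V assms in \<open>auto intro: convex_connected\<close>)
  then show ?thesis by simp
qed

lemma open_nonzero:
  fixes f :: "'a::topological_space \<Rightarrow> 'b::{t1_space,zero}"
  assumes "continuous_on U f" "open U"
  shows "open {z\<in>U. f z \<noteq> 0}"
proof -
  have "open (U \<inter> f -` (- {0}))" using assms by (intro continuous_open_preimage) auto
  then show ?thesis by (rule back_subst) auto
qed

lemma nonzero_dense:
  assumes "holo_fun_on f U" "convex U" "\<exists>z\<in>U. f z \<noteq> 0" "open O'" "O' \<inter> U \<noteq> {}"
  shows "\<exists>z\<in>O' \<inter> U. f z \<noteq> 0"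
proof (rule ccontr)
  assume *: "\<not> ?thesis"
  obtain p where p: "p \<in> O'" "p \<in> U" using assms(5) by auto
  have "open (O' \<inter> U)" using assms holo_fun_on_open by blast
  then have "\<forall>\<^sub>F z in nhds p. f z = 0" using * p by (auto simp: eventually_nhds)
  with identity_theorem[OF assms(1,2) this p(2)] assms(3) show False by auto
qed

lemma product_nonzero:
  assumes "holo_fun_on f U" "holo_fun_on g U" "convex U" "\<exists>z\<in>U. f z \<noteq> 0" "\<exists>z\<in>U. g z \<noteq> 0"
  shows "\<exists>z\<in>U. f z * g z \<noteq> 0"
proof -
  have "open {z\<in>U. f z \<noteq> 0}"
    using open_nonzero[OF holo_fun_on_continuous_on[OF assms(1)] holo_fun_on_open[OF assms(1)]] .
  from nonzero_dense[OF assms(2,3,5) this] assms(4) show ?thesis by auto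
qed

text \<open>In this form the density of \<open>f \<noteq> 0\<close> is used to cancel non-zero factors from identities.\<close>
lemma continuous_zero_of_dense:
  fixes f g :: "complex^'n \<Rightarrow> complex"
  assumes "holo_fun_on f U" "convex U" "\<exists>z\<in>U. f z \<noteq> 0" "continuous_on U g"
    and "\<And>z. z \<in> U \<Longrightarrow> f z \<noteq> 0 \<Longrightarrow> g z = 0" "z \<in> U"
  shows "g z = 0"
proof (rule ccontr)
  assume "g z \<noteq> 0"
  have "open {z\<in>U. g z \<noteq> 0}"
    using open_nonzero[OF assms(4) holo_fun_on_open[OF assms(1)]] .
  from nonzero_dense[OF assms(1,2,3) this] \<open>g z \<noteq> 0\<close> assms(5,6) show False by auto
qed

lemma tube_ball:
  fixes p :: "'a::metric_space" and K :: "'b::metric_space set"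
  assumes "compact K" "open W" "\<And>t. t \<in> K \<Longrightarrow> (p, t) \<in> W"
  shows "\<exists>\<delta>>0. \<forall>q\<in>ball p \<delta>. \<forall>t\<in>K. (q, t) \<in> W"
proof -
  have "{p} \<times> K \<subseteq> W" using assms(3) by auto
  from Elementary_Topology.tube_lemma[OF assms(1,2) this]
  obtain X where X: "p \<in> X" "open X" "X \<times> K \<subseteq> W" by blast
  then obtain \<delta> where "\<delta> > 0" "ball p \<delta> \<subseteq> X" by (meson openE)
  with X show ?thesis by blast
qed

lemma open_shear_preimage: "open U \<Longrightarrow> open {(q, t). q + t *s v \<in> U}" for v :: "complex^'n"
  using open_vimage[of U "\<lambda>x. fst x + snd x *s v"]
  by (simp add: vimage_def case_prod_beta' continuous_intros)

lemma open_shear_nonzero: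
  assumes "holo_fun_on f U"
  shows "open {(q, t). q + t *s v \<in> U \<and> f (q + t *s v) \<noteq> 0}"
  using open_shear_preimage[OF open_nonzero[OF holo_fun_on_continuous_on[OF assms] holo_fun_on_open[OF assms]]]
  by simp

text \<open>
  A zero that is isolated on a line survives, on the parallel lines, at all nearby points: otherwise
  the maximum principle is violated by \<open>1 / f\<close>.
\<close>
lemma zero_persists:
  assumes f: "holo_fun_on f U" and "f p = 0" "\<epsilon> > 0"
    and sub: "\<And>t. norm t \<le> \<epsilon> \<Longrightarrow> p + t *s v \<in> U"
    and nz: "\<And>t. norm t = \<epsilon> \<Longrightarrow> f (p + t *s v) \<noteq> 0"
  obtains \<delta> where "\<delta> > 0"
    "\<And>q. q \<in> ball p \<delta> \<Longrightarrow> \<exists>t. norm t < \<epsilon> \<and> q + t *s v \<in> U \<and> f (q + t *s v) = 0"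
proof -
  have cf: "continuous_on U f" and oU: "open U"
    using f by (auto simp: holo_fun_on_continuous_on holo_fun_on_open)
  have "continuous_on (sphere 0 \<epsilon>) (\<lambda>t. norm (f (p + t *s v)))"
    by (intro continuous_intros continuous_on_compose2[OF cf]) (use sub in auto)
  moreover have "sphere 0 \<epsilon> \<noteq> ({} :: complex set)" using \<open>\<epsilon> > 0\<close> by simp
  ultimately obtain t0 where t0: "t0 \<in> sphere 0 \<epsilon>"
    "\<And>t. t \<in> sphere 0 \<epsilon> \<Longrightarrow> norm (f (p + t0 *s v)) \<le> norm (f (p + t *s v))"
    using continuous_attains_inf[OF compact_sphere] by metis
  define \<mu> where "\<mu> = norm (f (p + t0 *s v))"
  have \<mu>: "\<mu> > 0" using t0 nz by (auto simp: \<mu>_def)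
  have op: "open {z\<in>U. P (norm (f z))}" if "open (Collect P)" for P
  proof -
    have "open (U \<inter> (\<lambda>z. norm (f z)) -` Collect P)"
      by (intro continuous_open_preimage continuous_intros cf oU that)
    then show ?thesis by (rule back_subst) auto
  qed
  have o1: "open {z\<in>U. norm (f z) > \<mu> / 2}" by (rule op, rule open_Collect_less) (intro continuous_intros)+
  have o2: "open {z\<in>U. norm (f z) < \<mu> / 2}" by (rule op, rule open_Collect_less) (intro continuous_intros)+
  have p: "p \<in> U" using sub[of 0] \<open>\<epsilon> > 0\<close> by simp
  obtain \<delta>1 where \<delta>1: "\<delta>1 > 0" "ball p \<delta>1 \<subseteq> {z\<in>U. norm (f z) < \<mu> / 2}"
    using o2 p assms(2) \<mu> by (metis (mono_tags, lifting) half_gt_zero mem_Collect_eq norm_zero openE)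
  have "\<exists>\<delta>>0. \<forall>q\<in>ball p \<delta>. \<forall>t\<in>cball 0 \<epsilon>. (q, t) \<in> {(q, t). q + t *s v \<in> U}"
    by (rule tube_ball[OF compact_cball open_shear_preimage[OF oU]]) (use sub in auto)
  then obtain \<delta>2 where \<delta>2: "\<delta>2 > 0"
    "\<And>q t. q \<in> ball p \<delta>2 \<Longrightarrow> t \<in> cball 0 \<epsilon> \<Longrightarrow> q + t *s v \<in> U" by blast
  have "\<exists>\<delta>>0. \<forall>q\<in>ball p \<delta>. \<forall>t\<in>sphere 0 \<epsilon>. (q, t) \<in> {(q, t). q + t *s v \<in> {z\<in>U. norm (f z) > \<mu> / 2}}"
  proof (rule tube_ball[OF compact_sphere open_shear_preimage[OF o1]])
    fix t :: complex assume "t \<in> sphere 0 \<epsilon>"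
    then show "(p, t) \<in> {(q, t). q + t *s v \<in> {z\<in>U. norm (f z) > \<mu> / 2}}"
      using t0(2)[of t] sub[of t] \<mu> unfolding \<mu>_def[symmetric] by auto
  qed
  then obtain \<delta>3 where \<delta>3: "\<delta>3 > 0"
    "\<And>q t. q \<in> ball p \<delta>3 \<Longrightarrow> t \<in> sphere 0 \<epsilon> \<Longrightarrow> norm (f (q + t *s v)) > \<mu> / 2" by blast
  show ?thesis
  proof (rule that[of "min \<delta>1 (min \<delta>2 \<delta>3)"])
    fix q assume q: "q \<in> ball p (min \<delta>1 (min \<delta>2 \<delta>3))"
    show "\<exists>t. norm t < \<epsilon> \<and> q + t *s v \<in> U \<and> f (q + t *s v) = 0"
    proof (rule ccontr)
      assume *: "\<not> ?thesis"
      have inU: "q + t *s v \<in> U" if "norm t \<le> \<epsilon>" for t using \<delta>2(2)[of q t] q that by auto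
      have big: "norm (f (q + t *s v)) > \<mu> / 2" if "norm t = \<epsilon>" for t
        using \<delta>3(2)[of q t] q that by auto
      have nz: "f (q + t *s v) \<noteq> 0" if "norm t \<le> \<epsilon>" for t
        using * inU[OF that] big[of t] \<mu> that by (cases "norm t = \<epsilon>") auto
      have "norm (inverse (f (q + 0 *s v))) \<le> 2 / \<mu>"
      proof (rule maximum_modulus_frontier[where S = "ball 0 \<epsilon>" and f = "\<lambda>t. inverse (f (q + t *s v))"])
        show "(\<lambda>t. inverse (f (q + t *s v))) holomorphic_on interior (ball 0 \<epsilon>)"
          by (intro holomorphic_intros holo_fun_on_line[OF f]) (use inU nz in auto)
        show "continuous_on (closure (ball 0 \<epsilon>)) (\<lambda>t. inverse (f (q + t *s v)))"
          by (intro continuous_intros continuous_on_compose2[OF cf]) (use inU nz \<open>\<epsilon> > 0\<close> in auto)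
        fix t :: complex assume "t \<in> frontier (ball 0 \<epsilon>)"
        then have "norm t = \<epsilon>" using \<open>\<epsilon> > 0\<close> by (simp add: frontier_ball)
        from big[OF this] \<mu> show "norm (inverse (f (q + t *s v))) \<le> 2 / \<mu>"
          using le_imp_inverse_le[of "\<mu> / 2" "norm (f (q + t *s v))"] by (simp add: norm_inverse)
      qed (use \<open>\<epsilon> > 0\<close> in auto)
      moreover have "norm (f q) < \<mu> / 2" "f q \<noteq> 0" using \<delta>1 q nz[of 0] \<open>\<epsilon> > 0\<close> by auto
      then have "norm (inverse (f q)) > 2 / \<mu>"
        using less_imp_inverse_less[of "norm (f q)" "\<mu> / 2"] by (simp add: norm_inverse)
      ultimately show False by simp
    qed
  qed (use \<delta>1 \<delta>2 \<delta>3 in auto)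
qed

lemma dir_deriv_eq_sum_cpartial:
  assumes "holo_fun_on f U" "z \<in> U"
  shows "dir_deriv v f z = (\<Sum>i\<in>UNIV. v $ i * cpartial i f z)"
proof -
  note d = holo_fun_on_has_derivative[OF assms]
  have lin: "linear (\<lambda>v. dir_deriv v f z)" using d(1) has_derivative_linear by blast
  have "dir_deriv v f z = dir_deriv (\<Sum>i\<in>UNIV. (v $ i) *s axis i 1) f z" by (simp add: basis_expansion)
  also have "\<dots> = (\<Sum>i\<in>UNIV. dir_deriv ((v $ i) *s axis i 1) f z)" by (rule linear_sum[OF lin])
  finally show ?thesis using d(2) by (simp add: cpartial_eq_dir_deriv)
qed

section \<open>Submanifolds and codimension\<close>

lemma complex_submanifold_Int_open:
  assumes "complex_submanifold k M" "open S"
  shows "complex_submanifold k (M \<inter> S)"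
  unfolding complex_submanifold_def
proof
  fix p assume p: "p \<in> M \<inter> S"
  then have "p \<in> M" by simp
  from bspec[OF assms(1)[unfolded complex_submanifold_def] this]
  obtain V and g :: "nat \<Rightarrow> complex^'a \<Rightarrow> complex" where V: "p \<in> V \<and> (\<forall>j<k. holo_fun_on (g j) V) \<and> open V \<and>
      M \<inter> V = {z\<in>V. \<forall>j<k. g j z = 0} \<and>
      (\<forall>c :: nat \<Rightarrow> complex. (\<forall>i. (\<Sum>j<k. c j * cpartial i (g j) p) = 0) \<longrightarrow> (\<forall>j<k. c j = 0))"
    by (elim exE) (rule that)
  show "\<exists>V (g :: nat \<Rightarrow> complex^'a \<Rightarrow> complex). p \<in> V \<and> (\<forall>j<k. holo_fun_on (g j) V) \<and> open V \<and>
      (M \<inter> S) \<inter> V = {z\<in>V. \<forall>j<k. g j z = 0} \<and>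
      (\<forall>c :: nat \<Rightarrow> complex. (\<forall>i. (\<Sum>j<k. c j * cpartial i (g j) p) = 0) \<longrightarrow> (\<forall>j<k. c j = 0))"
  proof (intro exI[of _ "V \<inter> S"] exI[of _ g] conjI)
    show "\<forall>j<k. holo_fun_on (g j) (V \<inter> S)"
      using V assms(2) by (meson holo_fun_on_subset inf_le1 open_Int)
    show "(M \<inter> S) \<inter> (V \<inter> S) = {z\<in>V \<inter> S. \<forall>j<k. g j z = 0}" using V by blast
    show "\<forall>c :: nat \<Rightarrow> complex. (\<forall>i. (\<Sum>j<k. c j * cpartial i (g j) p) = 0) \<longrightarrow> (\<forall>j<k. c j = 0)"
      using V by (elim conjE)
  qed (use V p assms(2) in auto)
qed

lemma codim_ge_subgerm:
  assumes "codim_ge k B" "subgerm A B"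
  shows "codim_ge k A"
proof -
  obtain U where U: "open U" "0 \<in> U" "\<And>j M. complex_submanifold j M \<Longrightarrow> M \<noteq> {} \<Longrightarrow> M \<subseteq> B \<inter> U \<Longrightarrow> j \<ge> k"
    using assms(1) unfolding codim_ge_def by blast
  obtain V where V: "open V" "0 \<in> V" "\<And>z. z \<in> V \<Longrightarrow> z \<in> A \<Longrightarrow> z \<in> B"
    using assms(2) by (auto simp: subgerm_def eventually_nhds)
  show ?thesis unfolding codim_ge_def
    by (rule exI[of _ "U \<inter> V"]) (use U V in blast)
qed

text \<open>A submanifold of \<open>A \<union> B\<close> that is not contained in \<open>A\<close> has a non-empty open part in \<open>B\<close>, since
  \<open>A\<close> is relatively closed near \<open>0\<close>.\<close>
lemma codim_ge_Un:
  assumes "codim_ge k A" "codim_ge k B" "open S" "0 \<in> S" "open (S - A)"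
  shows "codim_ge k (A \<union> B)"
proof -
  obtain U where U: "open U" "0 \<in> U" "\<And>j M. complex_submanifold j M \<Longrightarrow> M \<noteq> {} \<Longrightarrow> M \<subseteq> A \<inter> U \<Longrightarrow> j \<ge> k"
    using assms(1) unfolding codim_ge_def by blast
  obtain V where V: "open V" "0 \<in> V" "\<And>j M. complex_submanifold j M \<Longrightarrow> M \<noteq> {} \<Longrightarrow> M \<subseteq> B \<inter> V \<Longrightarrow> j \<ge> k"
    using assms(2) unfolding codim_ge_def by blast
  show ?thesis unfolding codim_ge_def
  proof (intro exI[of _ "U \<inter> V \<inter> S"] conjI allI impI)
    fix j M assume M: "complex_submanifold j M \<and> M \<noteq> {} \<and> M \<subseteq> (A \<union> B) \<inter> (U \<inter> V \<inter> S)"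
    show "j \<ge> k"
    proof (cases "M \<subseteq> A")
      case True with M U show ?thesis by blast
    next
      case False
      then have "M \<inter> (S - A) \<noteq> {}" "M \<inter> (S - A) \<subseteq> B \<inter> V" using M by auto
      with V(3)[OF complex_submanifold_Int_open[OF _ assms(5)]] M show ?thesis by blast
    qed
  qed (use U V assms in auto)
qed

text \<open>
  The germ \<open>c\<close> may vanish to a high order all along its zero set, so \<open>c\<close> need not be a regular
  equation of it anywhere.  At a zero where the order in a direction \<open>v\<close> is smallest, the derivative
  \<open>g\<close> of one order less vanishes at all zeros of \<open>c\<close> but has a non-zero derivative along \<open>v\<close>.  On
  every nearby line parallel to \<open>v\<close>, \<open>g\<close> has at most one zero and \<open>c\<close> at least one; hence their zero
  sets agree there, and \<open>g\<close> is a regular equation.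
\<close>
lemma zero_not_codim_ge_2:
  assumes "holo_fun_germ c" "c 0 = 0"
  shows "\<not> codim_ge 2 {z. c z = 0}"
proof
  assume "codim_ge 2 {z. c z = 0}"
  then obtain U where U: "open U" "0 \<in> U"
    "\<And>j M. complex_submanifold j M \<Longrightarrow> M \<noteq> {} \<Longrightarrow> M \<subseteq> {z. c z = 0} \<inter> U \<Longrightarrow> j \<ge> 2"
    unfolding codim_ge_def by blast
  obtain U' where U': "0 \<in> U'" "holo_fun_on c U'" using assms(1) by (auto simp: holo_fun_germ_def)
  have "open (U \<inter> U')" "0 \<in> U \<inter> U'" using U(1,2) U'(1) holo_fun_on_open[OF U'(2)] by auto
  then obtain r where r: "r > 0" "ball 0 r \<subseteq> U \<inter> U'" by (meson openE)
  define D where "D = ball (0 :: complex^'a) r"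
  have D: "open D" "convex D" "0 \<in> D" "D \<subseteq> U" "holo_fun_on c D"
    using r U' by (auto simp: D_def intro: holo_fun_on_subset)
  show False
  proof (cases "\<forall>z\<in>D. c z = 0")
    case True
    have "complex_submanifold 0 D" unfolding complex_submanifold_def using D by auto
    from U(3)[OF this] D True show False by auto
  next
    case False
    then obtain v where v: "v \<in> D" "c v \<noteq> 0" by auto
    let ?T = "{t. 0 + t *s v \<in> D}"
    have hol: "(\<lambda>t. c (0 + t *s v)) holomorphic_on ?T" by (rule holo_fun_on_line[OF D(5)]) auto
    have T: "open ?T" "connected ?T"
      using open_line_preimage[OF D(1)] convex_connected[OF convex_line_preimage[OF D(2)]] by blast+
    have T01: "0 \<in> ?T" "1 \<in> ?T" using D v by simp_all
    have "\<exists>k. (deriv ^^ k) (\<lambda>t. c (0 + t *s v)) 0 \<noteq> 0"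
      using holomorphic_fun_eq_0_on_connected[OF hol T _ T01] v by auto
    then have ex: "\<exists>k. \<exists>p\<in>D. c p = 0 \<and> (dir_deriv v ^^ k) c p \<noteq> 0"
      using higher_deriv_line[OF D(5), of 0 0 v] D assms(2) by auto
    define k where "k = (LEAST k. \<exists>p\<in>D. c p = 0 \<and> (dir_deriv v ^^ k) c p \<noteq> 0)"
    obtain p where p: "p \<in> D" "c p = 0" "(dir_deriv v ^^ k) c p \<noteq> 0"
      using LeastI_ex[OF ex] unfolding k_def by auto
    then have "k \<noteq> 0" by (metis funpow_0)
    then obtain l where l: "k = Suc l" using not0_implies_Suc by auto
    define g where "g = (dir_deriv v ^^ l) c"
    have g0: "g z = 0" if "z \<in> D" "c z = 0" for z
      using not_less_Least[of l "\<lambda>k. \<exists>p\<in>D. c p = 0 \<and> (dir_deriv v ^^ k) c p \<noteq> 0"] that l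
      by (auto simp: k_def[symmetric] g_def)
    have g: "holo_fun_on g D" unfolding g_def by (rule holo_fun_on_dir_deriv_pow[OF D(5)])
    define l0 where "l0 = dir_deriv v g p"
    have l0: "l0 \<noteq> 0" using p(3) by (simp add: l0_def g_def l)
    have "isCont (dir_deriv v g) p" using holo_fun_on_isCont[OF holo_fun_on_dir_deriv[OF g] p(1)] .
    then obtain \<rho>0 where \<rho>0: "\<rho>0 > 0" "\<And>z. z \<in> ball p \<rho>0 \<Longrightarrow> norm (dir_deriv v g z - l0) < norm l0 / 2"
      unfolding continuous_at_eps_delta l0_def
      using l0 by (metis l0_def dist_commute dist_norm half_gt_zero mem_ball zero_less_norm_iff)
    obtain \<rho>1 where \<rho>1: "\<rho>1 > 0" "ball p \<rho>1 \<subseteq> D" using D(1) p(1) by (meson openE)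
    define B where "B = ball p (min \<rho>0 \<rho>1)"
    have B: "open B" "convex B" "p \<in> B" "B \<subseteq> D" "\<And>z. z \<in> B \<Longrightarrow> norm (dir_deriv v g z - l0) < norm l0 / 2"
      using \<rho>0 \<rho>1 by (auto simp: B_def)
    \<comment> \<open>along \<open>v\<close>, \<open>g\<close> is a small perturbation of the linear function with slope \<open>l0\<close>, so it is injective\<close>
    have inj: "t = 0" if "z \<in> B" "z + t *s v \<in> B" "g z = 0" "g (z + t *s v) = 0" for z t
    proof -
      have "norm ((g (z + t *s v) - l0 * t) - (g (z + 0 *s v) - l0 * 0)) \<le> norm l0 / 2 * norm (t - 0)"
      proof (rule field_differentiable_bound)
        show "convex {s. z + s *s v \<in> B}" using convex_line_preimage B by blast
        fix s assume s: "s \<in> {s. z + s *s v \<in> B}"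
        then have "((\<lambda>s. g (z + s *s v)) has_field_derivative dir_deriv v g (z + s *s v)) (at s)"
          using B by (intro dir_deriv_has_field_derivative[OF g]) auto
        from DERIV_diff[OF this DERIV_cmult[OF DERIV_ident, of l0]]
        show "((\<lambda>s. g (z + s *s v) - l0 * s) has_field_derivative dir_deriv v g (z + s *s v) - l0)
            (at s within {s. z + s *s v \<in> B})" by (auto intro: has_field_derivative_at_within)
        show "norm (dir_deriv v g (z + s *s v) - l0) \<le> norm l0 / 2" using s B(5)[of "z + s *s v"] by auto
      qed (use that in auto)
      then have "norm l0 * norm t \<le> norm l0 / 2 * norm t" using that by (simp add: norm_mult)
      then show "t = 0" using l0 by auto
    qed
    obtain r' \<epsilon> where r': "r' > 0" "\<epsilon> > 0" "\<And>z t. z \<in> ball p r' \<Longrightarrow> norm t \<le> \<epsilon> \<Longrightarrow> z + t *s v \<in> B"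
      using line_stays_near[OF B(1,3)] by metis
    have gp: "g p = 0" using g0 p by auto
    have nz: "c (p + t *s v) \<noteq> 0" if "norm t = \<epsilon>" for t
    proof
      assume "c (p + t *s v) = 0"
      moreover have "p + t *s v \<in> B" using r' that by auto
      ultimately have "t = 0" using inj[of p t] gp g0 B by auto
      with that r' show False by auto
    qed
    have cB: "holo_fun_on c B" using D B holo_fun_on_subset by blast
    obtain \<delta> where \<delta>: "\<delta> > 0"
      "\<And>q. q \<in> ball p \<delta> \<Longrightarrow> \<exists>t. norm t < \<epsilon> \<and> q + t *s v \<in> B \<and> c (q + t *s v) = 0"
      by (rule zero_persists[OF cB p(2) r'(2) r'(3) nz]) (use r'(1) in auto)
    define V where "V = ball p \<delta> \<inter> B"
    have V: "open V" "p \<in> V" "V \<subseteq> B" using \<delta> B by (auto simp: V_def)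
    have eq: "{z. c z = 0} \<inter> V = {z\<in>V. g z = 0}"
    proof safe
      fix z assume z: "z \<in> V" "c z = 0"
      then show "g z = 0" using g0 V B by blast
    next
      fix z assume z: "z \<in> V" "g z = 0"
      then obtain t where t: "norm t < \<epsilon>" "z + t *s v \<in> B" "c (z + t *s v) = 0"
        using \<delta> by (auto simp: V_def)
      then have "t = 0" using inj[of z t] z V g0 B by auto
      with t show "c z = 0" by auto
    qed
    have "complex_submanifold 1 ({z. c z = 0} \<inter> V)"
      unfolding complex_submanifold_def
    proof
      fix q assume q: "q \<in> {z. c z = 0} \<inter> V"
      then have "dir_deriv v g q \<noteq> 0" using B(5)[of q] V l0 by auto
      then obtain i where "cpartial i g q \<noteq> 0"
        using dir_deriv_eq_sum_cpartial[OF g, of q v] q V B by (metis (no_types, lifting) Int_iff mult_zero_right subsetD sum.neutral)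
      then show "\<exists>W (h :: nat \<Rightarrow> complex^'a \<Rightarrow> complex). q \<in> W \<and> (\<forall>j<1. holo_fun_on (h j) W) \<and> open W \<and>
        {z. c z = 0} \<inter> V \<inter> W = {z \<in> W. \<forall>j<1. h j z = 0} \<and>
        (\<forall>d :: nat \<Rightarrow> complex. (\<forall>i. (\<Sum>j<1. d j * cpartial i (h j) q) = 0) \<longrightarrow> (\<forall>j<1. d j = 0))"
        using q V eq g B D
        by (intro exI[of _ V] exI[of _ "\<lambda>_. g"]) (auto intro!: holo_fun_on_subset[OF g])
    qed
    from U(3)[OF this] p V B D show False by auto
  qed
qed

section \<open>Riemann's extension theorem\<close>

lemma holomorphic_extend_finite:
  assumes "finite S" "open U" "f holomorphic_on U - S" "\<And>z. z \<in> U - S \<Longrightarrow> norm (f z) \<le> B"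
  shows "\<exists>g. g holomorphic_on U \<and> (\<forall>z\<in>U - S. g z = f z)"
  using assms
proof (induction S arbitrary: U rule: finite_induct)
  case (insert x S)
  show ?case
  proof (cases "x \<in> U")
    case False
    then have "U - insert x S = U - S" by auto
    with insert.IH[OF insert.prems(1)] insert.prems show ?thesis by auto
  next
    case True
    have "open (U - {x})" using insert.prems(1) by (simp add: open_delete)
    moreover have eq: "(U - {x}) - S = U - insert x S" by auto
    ultimately obtain g where g: "g holomorphic_on U - {x}" "\<And>z. z \<in> U - insert x S \<Longrightarrow> g z = f z"
      using insert.IH[of "U - {x}"] insert.prems by auto
    have "\<forall>\<^sub>F z in at x. z \<in> U - insert x S"
    proof -
      have "open (U - S)" using insert by (simp add: finite_imp_closed open_Diff)
      moreover have "x \<in> U - S" using True insert by auto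
      ultimately have "\<forall>\<^sub>F z in at x. z \<in> U - S - {x}"
        by (auto simp: eventually_at_topological)
      then show ?thesis by eventually_elim auto
    qed
    then have "\<forall>\<^sub>F z in at x. norm (g z) \<le> B"
      by eventually_elim (use g(2) insert.prems(3) in auto)
    then obtain h where "h holomorphic_on U" "\<forall>z\<in>U - {x}. h z = g z"
      using holomorphic_on_extend_bounded[of g U x] g(1) True insert.prems(1) by (auto simp: interior_open)
    with g(2) show ?thesis by (intro exI[of _ h]) auto
  qed
qed auto

text \<open>Near a zero of \<open>a\<close>, the extension is the Cauchy integral over a circle on a complex line on which
  \<open>a\<close> is not identically zero.\<close>
lemma riemann_extension_local:
  assumes D: "open D" "convex D" and a: "holo_fun_on a D" "\<exists>z\<in>D. a z \<noteq> 0"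
    and f: "holo_fun_on f {z\<in>D. a z \<noteq> 0}" and B: "\<And>z. z \<in> D \<Longrightarrow> a z \<noteq> 0 \<Longrightarrow> norm (f z) \<le> B"
    and p: "p \<in> D"
  shows "\<exists>\<delta> g. \<delta> > 0 \<and> ball p \<delta> \<subseteq> D \<and> holo_fun_on g (ball p \<delta>) \<and> (\<forall>z\<in>ball p \<delta>. a z \<noteq> 0 \<longrightarrow> g z = f z)"
proof (cases "a p = 0")
  case False
  then have "p \<in> {z\<in>D. a z \<noteq> 0}" using p by simp
  then obtain \<delta> where "\<delta> > 0" "ball p \<delta> \<subseteq> {z\<in>D. a z \<noteq> 0}"
    using holo_fun_on_open[OF f] by (meson openE)
  then show ?thesis
    by (intro exI[of _ \<delta>] exI[of _ f]) (auto intro: holo_fun_on_subset[OF f])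
next
  case True
  obtain q where q: "q \<in> D" "a q \<noteq> 0" using a(2) by auto
  define v where "v = q - p"
  let ?T = "{t. p + t *s v \<in> D}"
  have T: "open ?T" "connected ?T"
    using open_line_preimage[OF D(1)] convex_connected[OF convex_line_preimage[OF D(2)]] by blast+
  have T01: "0 \<in> ?T" "1 \<in> ?T" using p q by (simp_all add: v_def)
  have hol: "(\<lambda>t. a (p + t *s v)) holomorphic_on ?T" by (rule holo_fun_on_line[OF a(1)]) auto
  obtain r where r: "r > 0" "ball 0 r \<subseteq> ?T" "\<And>t. t \<in> ball 0 r - {0} \<Longrightarrow> a (p + t *s v) \<noteq> 0"
    using isolated_zeros[OF hol T T01(1) _ T01(2)] True q by (auto simp: v_def)
  define \<epsilon> where "\<epsilon> = r / 2"
  have \<epsilon>: "\<epsilon> > 0" "\<And>t. norm t \<le> \<epsilon> \<Longrightarrow> p + t *s v \<in> D" "\<And>t. norm t = \<epsilon> \<Longrightarrow> a (p + t *s v) \<noteq> 0"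
  proof -
    show "\<epsilon> > 0" using r by (simp add: \<epsilon>_def)
    show "p + t *s v \<in> D" if "norm t \<le> \<epsilon>" for t
    proof -
      have "t \<in> ball 0 r" using that r(1) by (simp add: \<epsilon>_def)
      with r(2) show ?thesis by blast
    qed
    show "a (p + t *s v) \<noteq> 0" if "norm t = \<epsilon>" for t
      using that r(1) by (intro r(3)) (auto simp: \<epsilon>_def)
  qed
  have "\<exists>\<delta>>0. \<forall>q\<in>ball p \<delta>. \<forall>t\<in>cball 0 \<epsilon>. (q, t) \<in> {(q, t). q + t *s v \<in> D}"
    by (rule tube_ball[OF compact_cball open_shear_preimage[OF D(1)]]) (use \<epsilon> in auto)
  then obtain \<delta>1 where \<delta>1: "\<delta>1 > 0"
    "\<And>q t. q \<in> ball p \<delta>1 \<Longrightarrow> t \<in> cball 0 \<epsilon> \<Longrightarrow> q + t *s v \<in> D" by blast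
  have "\<exists>\<delta>>0. \<forall>q\<in>ball p \<delta>. \<forall>t\<in>sphere 0 \<epsilon>. (q, t) \<in> {(q, t). q + t *s v \<in> D \<and> a (q + t *s v) \<noteq> 0}"
    by (rule tube_ball[OF compact_sphere open_shear_nonzero[OF a(1)]]) (use \<epsilon> in auto)
  then obtain \<delta>2 where \<delta>2: "\<delta>2 > 0"
    "\<And>q t. q \<in> ball p \<delta>2 \<Longrightarrow> t \<in> sphere 0 \<epsilon> \<Longrightarrow> a (q + t *s v) \<noteq> 0" by blast
  define \<delta> where "\<delta> = min \<delta>1 \<delta>2"
  have \<delta>: "\<delta> > 0" "\<And>q t. q \<in> ball p \<delta> \<Longrightarrow> norm t \<le> \<epsilon> \<Longrightarrow> q + t *s v \<in> D"
    "\<And>q t. q \<in> ball p \<delta> \<Longrightarrow> norm t = \<epsilon> \<Longrightarrow> a (q + t *s v) \<noteq> 0"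
    using \<delta>1 \<delta>2 by (auto simp: \<delta>_def)
  have sub: "ball p \<delta> \<subseteq> D" using \<delta>(2)[of _ 0] \<epsilon>(1) by auto
  define g where "g z = contour_integral (circlepath 0 \<epsilon>) (\<lambda>t. f (z + t *s v) / t) / (2 * of_real pi * \<i>)" for z
  have "holo_fun_on (\<lambda>z. contour_integral (circlepath 0 \<epsilon>) (\<lambda>t. f (z + t *s v) / t)) (ball p \<delta>)"
  proof (rule holo_fun_on_circle_integral)
    have "continuous_on (ball p \<delta> \<times> sphere 0 \<epsilon>) (\<lambda>x. f (fst x + snd x *s v) / snd x)"
      by (intro continuous_intros continuous_on_compose2[OF holo_fun_on_continuous_on[OF f]])
         (use \<epsilon>(1) \<delta> in auto)
    then show "continuous_on (ball p \<delta> \<times> sphere 0 \<epsilon>) (\<lambda>(z, t). f (z + t *s v) / t)"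
      by (simp add: case_prod_beta')
    fix s :: complex assume s: "norm s = \<epsilon>"
    show "holo_fun_on (\<lambda>z. f (z + s *s v) / s) (ball p \<delta>)"
      by (intro holo_fun_on_divide holo_fun_on_const holo_fun_on_shift[OF f]) (use \<epsilon>(1) \<delta> s in auto)
  qed (use \<epsilon> in auto)
  then have g: "holo_fun_on g (ball p \<delta>)"
    unfolding g_def by (intro holo_fun_on_divide holo_fun_on_const) auto
  have "g z = f z" if z: "z \<in> ball p \<delta>" "a z \<noteq> 0" for z
  proof -
    let ?S = "{t. z + t *s v \<in> D}"
    have S: "open ?S" "connected ?S"
      using open_line_preimage[OF D(1)] convex_connected[OF convex_line_preimage[OF D(2)]] by blast+
    have holS: "(\<lambda>t. a (z + t *s v)) holomorphic_on ?S" by (rule holo_fun_on_line[OF a(1)]) auto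
    define Z where "Z = {t\<in>cball 0 \<epsilon>. a (z + t *s v) = 0}"
    have "finite Z"
    proof (cases "(\<lambda>t. a (z + t *s v)) constant_on ?S")
      case True
      have "a (z + t *s v) = a (z + 0 *s v)" if "t \<in> ?S" for t
        using True that z sub unfolding constant_on_def by (metis (mono_tags, lifting) add.right_neutral
            mem_Collect_eq subsetD vector_smult_lzero)
      then have "Z = {}" using z \<delta>(2)[OF z(1)] by (auto simp: Z_def)
      then show ?thesis by simp
    next
      case False
      have "cball 0 \<epsilon> \<subseteq> ?S" using \<delta>(2)[OF z(1)] by auto
      from holomorphic_compact_finite_zeros[OF holS S compact_cball this False]
      show ?thesis by (simp add: Z_def)
    qed
    \<comment> \<open>an open neighbourhood of the closed disc that adds no zeros of \<open>a\<close> to the finitely many in the disc\<close>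
    define W where "W = {t\<in>?S. a (z + t *s v) \<noteq> 0} \<union> ball 0 \<epsilon>"
    have W: "open W"
      unfolding W_def using open_nonzero[OF holomorphic_on_imp_continuous_on[OF holS] S(1)] by auto
    have cW: "cball 0 \<epsilon> \<subseteq> W"
    proof
      fix t :: complex assume "t \<in> cball 0 \<epsilon>"
      then show "t \<in> W" using \<delta>(2,3)[OF z(1), of t] by (cases "norm t = \<epsilon>") (auto simp: W_def)
    qed
    have WZ: "z + t *s v \<in> {z\<in>D. a z \<noteq> 0}" if "t \<in> W - Z" for t
      using that \<delta>(2)[OF z(1), of t] by (auto simp: W_def Z_def)
    have "(\<lambda>t. f (z + t *s v)) holomorphic_on W - Z" by (rule holo_fun_on_line[OF f]) (use WZ in auto)
    then obtain h where h: "h holomorphic_on W" "\<And>t. t \<in> W - Z \<Longrightarrow> h t = f (z + t *s v)"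
      using holomorphic_extend_finite[OF \<open>finite Z\<close> W, of "\<lambda>t. f (z + t *s v)" B] B WZ by auto
    have "((\<lambda>t. h t / (t - 0)) has_contour_integral 2 * of_real pi * \<i> * h 0) (circlepath 0 \<epsilon>)"
      by (rule Cauchy_integral_circlepath_simple) (use h(1) cW \<epsilon>(1) in \<open>auto intro: holomorphic_on_subset\<close>)
    then have "contour_integral (circlepath 0 \<epsilon>) (\<lambda>t. h t / t) = 2 * of_real pi * \<i> * h 0"
      by (simp add: contour_integral_unique)
    moreover have "contour_integral (circlepath 0 \<epsilon>) (\<lambda>t. h t / t) =
        contour_integral (circlepath 0 \<epsilon>) (\<lambda>t. f (z + t *s v) / t)"
    proof (rule contour_integral_cong)
      fix t assume "t \<in> path_image (circlepath 0 \<epsilon>)"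
      then have "norm t = \<epsilon>" using \<epsilon>(1) by auto
      then have "t \<in> W - Z" using cW \<delta>(3)[OF z(1)] by (auto simp: Z_def)
      then show "h t / t = f (z + t *s v) / t" using h(2) by simp
    qed auto
    moreover have "0 \<in> W - Z" using cW \<epsilon>(1) z(2) by (auto simp: Z_def)
    then have "h 0 = f z" using h(2)[of 0] by simp
    ultimately show ?thesis by (simp add: g_def)
  qed
  with \<delta>(1) sub g show ?thesis by blast
qed

text \<open>The local extensions fit together, because they are continuous and agree with \<open>f\<close> on the dense
  set where \<open>a \<noteq> 0\<close>.\<close>
lemma riemann_extension:
  assumes D: "open D" "convex D" and a: "holo_fun_on a D" "\<exists>z\<in>D. a z \<noteq> 0"
    and f: "holo_fun_on f {z\<in>D. a z \<noteq> 0}" and B: "\<And>z. z \<in> D \<Longrightarrow> a z \<noteq> 0 \<Longrightarrow> norm (f z) \<le> B"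
  shows "\<exists>g. holo_fun_on g D \<and> (\<forall>z\<in>D. a z \<noteq> 0 \<longrightarrow> g z = f z)"
proof -
  have "\<forall>p\<in>D. \<exists>\<delta> g. \<delta> > 0 \<and> ball p \<delta> \<subseteq> D \<and> holo_fun_on g (ball p \<delta>) \<and>
      (\<forall>z\<in>ball p \<delta>. a z \<noteq> 0 \<longrightarrow> g z = f z)"
    using riemann_extension_local[OF D a f B] by blast
  then obtain d G where dG: "\<And>p. p \<in> D \<Longrightarrow> d p > 0 \<and> ball p (d p) \<subseteq> D \<and> holo_fun_on (G p) (ball p (d p)) \<and>
      (\<forall>z\<in>ball p (d p). a z \<noteq> 0 \<longrightarrow> G p z = f z)"
    by metis
  have eq: "G q q = G p q" if p: "p \<in> D" and q: "q \<in> ball p (d p)" for p q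
  proof -
    have qD: "q \<in> D" using dG[OF p] q by auto
    have "q \<in> ball p (d p) \<inter> ball q (d q)" "open (ball p (d p) \<inter> ball q (d q))"
      using q dG[OF qD] by auto
    then obtain e where e: "e > 0" "ball q e \<subseteq> ball p (d p) \<inter> ball q (d q)" by (meson openE)
    have sub: "ball q e \<subseteq> D" using e dG[OF p] by auto
    have ae: "holo_fun_on a (ball q e)" using a(1) sub by (auto intro: holo_fun_on_subset)
    have "ball q e \<inter> D \<noteq> {}" using qD e(1) by (metis centre_in_ball disjoint_iff)
    then have ne: "\<exists>z\<in>ball q e. a z \<noteq> 0"
      using nonzero_dense[OF a(1) D(2) a(2) open_ball, of q e] by auto
    have cont: "continuous_on (ball q e) (\<lambda>z. G q z - G p z)"
      by (intro continuous_intros holo_fun_on_continuous_on holo_fun_on_subset[where V = "ball q e"])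
         (use dG[OF p] dG[OF qD] e in auto)
    have "G q q - G p q = 0"
    proof (rule continuous_zero_of_dense[OF ae convex_ball ne cont])
      fix z assume z: "z \<in> ball q e" "a z \<noteq> 0"
      then have "z \<in> ball p (d p)" "z \<in> ball q (d q)" using e(2) by blast+
      then show "G q z - G p z = 0" using dG[OF p] dG[OF qD] z(2) by simp
    qed (use e in auto)
    then show ?thesis by simp
  qed
  have "holo_fun_on (\<lambda>z. G z z) D"
  proof (rule holo_fun_on_locally[OF D(1)])
    fix p assume p: "p \<in> D"
    have h: "holo_fun_on (G p) (ball p (d p))" using dG[OF p] by blast
    have "holo_fun_on (\<lambda>z. G z z) (ball p (d p))"
      by (rule holo_fun_on_cong[THEN iffD1, rotated, OF h]) (rule eq[OF p, symmetric])
    then show "\<exists>V. p \<in> V \<and> holo_fun_on (\<lambda>z. G z z) V"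
      using dG[OF p] by (intro exI[of _ "ball p (d p)"]) auto
  qed
  then show ?thesis using dG by (intro exI[of _ "\<lambda>z. G z z"]) auto
qed

section \<open>Polynomials with holomorphic coefficients\<close>

lemma coeff_prod_linear_bound:
  assumes "\<forall>x\<in>#A. norm x \<le> 1"
  shows "norm (coeff (\<Prod>x\<in>#A. [:- x, 1 :: complex:]) k) \<le> 2 ^ size A"
  using assms
proof (induction A arbitrary: k)
  case empty
  then show ?case by (cases k) auto
next
  case (add x A)
  let ?p = "\<Prod>x\<in>#A. [:- x, 1:]"
  have IH: "norm (coeff ?p k) \<le> 2 ^ size A" for k using add by auto
  have "norm x * norm (coeff ?p k) \<le> 1 * 2 ^ size A" using add IH by (intro mult_mono) auto
  moreover have "norm (coeff (pCons 0 ?p) k) \<le> 2 ^ size A" by (cases k) (auto simp: IH)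
  moreover have "norm (coeff (\<Prod>x\<in>#add_mset x A. [:- x, 1:]) k) \<le>
      norm x * norm (coeff ?p k) + norm (coeff (pCons 0 ?p) k)"
    using norm_triangle_ineq[of "- (x * coeff ?p k)" "coeff (pCons 0 ?p) k"] by (simp add: norm_mult)
  ultimately show ?case by simp
qed

lemma poly_prod_linear: "poly (\<Prod>x\<in>#A. [:- x, 1 :: complex:]) t = (\<Prod>x\<in>#A. t - x)"
  by (induction A) (auto simp: algebra_simps)

lemma norm_prod_linear_lower:
  fixes t :: complex
  assumes "\<forall>x\<in>#A. norm x \<le> e" "norm t \<ge> e"
  shows "norm (\<Prod>x\<in>#A. t - x) \<ge> (norm t - e) ^ size A"
  using assms
proof (induction A)
  case (add x A)
  have "norm t - e \<le> norm (t - x)" using add norm_triangle_ineq2[of t x] by auto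
  then have "(norm t - e) * (norm t - e) ^ size A \<le> norm (t - x) * norm (\<Prod>x\<in>#A. t - x)"
    using add by (intro mult_mono) auto
  then show ?case by (simp add: norm_mult)
qed auto

text \<open>The coefficients of a monic polynomial, leading one first, as functions of the power sums
  \<open>N 1, N 2, \<dots>\<close> of its roots.\<close>
fun newton :: "(nat \<Rightarrow> complex) \<Rightarrow> nat \<Rightarrow> complex" where
  "newton N 0 = 1"
| "newton N (Suc k) = - (\<Sum>i=0..k. newton N i * N (Suc (k - i))) / of_nat (Suc k)"

text \<open>Newton's recursion is a comparison of coefficients in the logarithmic derivative of the power
  series \<open>\<Prod>(1 - x X)\<close>, whose coefficients are those of the polynomial in reverse order.\<close>
lemma newton_identities:
  fixes A :: "complex multiset"
  assumes "\<And>k. N k = (\<Sum>x\<in>#A. x ^ k)"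
  shows "(\<Prod>x\<in>#A. t - x) = (\<Sum>k\<le>size A. newton N k * t ^ (size A - k))"
proof -
  define G where "G A = (\<Prod>x\<in>#A. 1 - fps_const x * fps_X)" for A :: "complex multiset"
  have G_add: "G (add_mset x A) = (1 - fps_const x * fps_X) * G A" for x A by (simp add: G_def)
  have nth_add: "fps_nth (G (add_mset x A)) k = fps_nth (G A) k - x * (if k = 0 then 0 else fps_nth (G A) (k - 1))" for x A k
    by (simp add: G_add left_diff_distrib mult.assoc)
  have zero: "fps_nth (G A) k = 0" if "k > size A" for A k
    using that
  proof (induction A arbitrary: k)
    case empty
    then show ?case by (simp add: G_def)
  qed (auto simp: nth_add)
  have prod: "(\<Prod>x\<in>#A. t - x) = (\<Sum>k\<le>size A. fps_nth (G A) k * t ^ (size A - k))" for A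
  proof (induction A)
    case empty
    then show ?case by (simp add: G_def)
  next
    case (add x A)
    let ?n = "size A"
    have "(\<Sum>k\<le>Suc ?n. fps_nth (G (add_mset x A)) k * t ^ (Suc ?n - k)) =
      (\<Sum>k\<le>Suc ?n. fps_nth (G A) k * t ^ (Suc ?n - k)) -
      (\<Sum>k\<le>Suc ?n. x * (if k = 0 then 0 else fps_nth (G A) (k - 1)) * t ^ (Suc ?n - k))"
      by (simp only: nth_add left_diff_distrib sum_subtractf)
    also have "(\<Sum>k\<le>Suc ?n. fps_nth (G A) k * t ^ (Suc ?n - k)) = (\<Sum>k\<le>?n. fps_nth (G A) k * t ^ (Suc ?n - k))"
      by (simp add: zero)
    also have "\<dots> = t * (\<Sum>k\<le>?n. fps_nth (G A) k * t ^ (?n - k))"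
      unfolding sum_distrib_left by (intro sum.cong) (auto simp: Suc_diff_le)
    also have "(\<Sum>k\<le>Suc ?n. x * (if k = 0 then 0 else fps_nth (G A) (k - 1)) * t ^ (Suc ?n - k)) =
       x * (\<Sum>k\<le>?n. fps_nth (G A) k * t ^ (?n - k))"
      by (subst sum.atMost_Suc_shift) (simp add: sum_distrib_left mult.assoc)
    finally show ?case using add by (simp add: algebra_simps)
  qed
  have deriv: "fps_deriv (G A) = - (G A * Abs_fps (\<lambda>k. \<Sum>x\<in>#A. x ^ Suc k))" for A
  proof (induction A)
    case empty
    have "Abs_fps (\<lambda>k. 0) = (0 :: complex fps)" by (simp add: fps_eq_iff)
    then show ?case by (simp add: G_def)
  next
    case (add x A)
    let ?S = "Abs_fps (\<lambda>k. \<Sum>x\<in>#A. x ^ Suc k)"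
    have geo: "(1 - fps_const x * fps_X) * Abs_fps (\<lambda>k. x ^ Suc k) = fps_const x"
    proof (rule fps_ext)
      fix n show "fps_nth ((1 - fps_const x * fps_X) * Abs_fps (\<lambda>k. x ^ Suc k)) n = fps_nth (fps_const x) n"
        by (cases n) (simp_all add: left_diff_distrib mult.assoc)
    qed
    have ring: "- (u * v) * g - u * (g * s) = - (u * g * (v + s))" for u v g s :: "complex fps"
      by (simp add: algebra_simps)
    have split: "Abs_fps (\<lambda>k. \<Sum>y\<in>#add_mset x A. y ^ Suc k) = Abs_fps (\<lambda>k. x ^ Suc k) + ?S"
      by (simp add: fps_eq_iff)
    have "fps_deriv (G (add_mset x A)) = - fps_const x * G A + (1 - fps_const x * fps_X) * fps_deriv (G A)"
      by (simp add: G_add)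
    also have "\<dots> = - ((1 - fps_const x * fps_X) * Abs_fps (\<lambda>k. x ^ Suc k)) * G A -
        (1 - fps_const x * fps_X) * (G A * ?S)"
      unfolding geo add by simp
    also have "\<dots> = - (G (add_mset x A) * Abs_fps (\<lambda>k. \<Sum>y\<in>#add_mset x A. y ^ Suc k))"
      unfolding split G_add by (rule ring)
    finally show ?case .
  qed
  have "newton N k = fps_nth (G A) k" for k
  proof (induction k rule: less_induct)
    case (less k)
    show ?case
    proof (cases k)
      case 0
      have "fps_nth (G A) 0 = 1" by (induction A) (auto simp: nth_add, simp add: G_def)
      with 0 show ?thesis by simp
    next
      case (Suc j)
      have "of_nat (Suc j) * fps_nth (G A) (Suc j) = fps_nth (fps_deriv (G A)) j" by simp
      also have "\<dots> = - (\<Sum>i=0..j. fps_nth (G A) i * N (Suc (j - i)))"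
        unfolding deriv by (simp add: fps_mult_nth assms)
      also have "(\<Sum>i=0..j. fps_nth (G A) i * N (Suc (j - i))) = (\<Sum>i=0..j. newton N i * N (Suc (j - i)))"
        using less Suc by (intro sum.cong) auto
      finally have "fps_nth (G A) (Suc j) = - (\<Sum>i=0..j. newton N i * N (Suc (j - i))) / of_nat (Suc j)"
        by (simp add: field_simps del: of_nat_Suc)
      then show ?thesis using Suc by simp
    qed
  qed
  then show ?thesis using prod by simp
qed

lemma holo_fun_on_newton:
  assumes "open U" "\<And>k. holo_fun_on (N k) U"
  shows "holo_fun_on (\<lambda>z. newton (\<lambda>k. N k z) j) U"
proof (induction j rule: less_induct)
  case (less j)
  show ?case
  proof (cases j)
    case 0
    then show ?thesis using assms by (simp add: holo_fun_on_const)
  next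
    case (Suc k)
    show ?thesis unfolding Suc newton.simps
      by (intro holo_fun_on_divide holo_fun_on_uminus holo_fun_on_sum holo_fun_on_mult
          holo_fun_on_const assms less) (use Suc in \<open>auto simp del: of_nat_Suc\<close>)
  qed
qed

text \<open>
  \<open>P\<close> vanishes at the points of \<open>S\<close> that lie outside a proper analytic subset \<open>a = 0\<close> of the base.
  With this tolerance, a polynomial may be divided by a non-zero function of \<open>z\<close> alone.
\<close>
definition generic_zero ::
    "(complex^'n) set \<Rightarrow> ((complex^'n) \<times> complex) set \<Rightarrow> (complex^'n \<Rightarrow> complex \<Rightarrow> complex) \<Rightarrow> bool" where
  "generic_zero D S P \<longleftrightarrow>
     (\<exists>a. holo_fun_on a D \<and> (\<exists>z\<in>D. a z \<noteq> 0) \<and> (\<forall>(z, t)\<in>S. a z * P z t = 0))"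

text \<open>Division by a polynomial whose leading coefficient is not invertible, at the cost of a power of
  that coefficient.\<close>
lemma pseudo_division:
  fixes p :: "nat \<Rightarrow> complex^'n \<Rightarrow> complex"
  assumes "open D" "\<And>k. k \<le> m \<Longrightarrow> holo_fun_on (p k) D" "\<And>k. k < n \<Longrightarrow> holo_fun_on (q k) D"
  shows "\<exists>N Q r. (\<forall>k<m. holo_fun_on (r k) D) \<and>
    (\<forall>z t. p m z ^ N * (\<Sum>k<n. q k z * t ^ k) = Q z t * (\<Sum>k\<le>m. p k z * t ^ k) + (\<Sum>k<m. r k z * t ^ k))"
  using assms(3)
proof (induction n arbitrary: q)
  case 0
  show ?case
    by (intro exI[of _ 0] exI[of _ "\<lambda>_ _. 0"] exI[of _ "\<lambda>_ _. 0"])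
       (auto intro: holo_fun_on_const assms(1))
next
  case (Suc n)
  show ?case
  proof (cases "n < m")
    case True
    have "(\<Sum>k<m. (if k \<le> n then q k z else 0) * t ^ k) = (\<Sum>k<Suc n. q k z * t ^ k)" for z t
      using True by (intro sum.mono_neutral_cong_right) auto
    note eq = this
    show ?thesis
    proof (rule exI[of _ 0], rule exI[of _ "\<lambda>_ _. 0"],
        rule exI[of _ "\<lambda>k z. if k \<le> n then q k z else 0"], intro conjI allI impI)
      fix k show "holo_fun_on (\<lambda>z. if k \<le> n then q k z else 0) D"
        using Suc.prems by (cases "k \<le> n") (auto intro: holo_fun_on_const assms(1))
    qed (simp only: eq power_0 mult_1 mult_zero_left add_0)
  next
    case False
    then have nm: "m \<le> n" by simp
    define q' where "q' k z = p m z * q k z - (if n - m \<le> k then q n z * p (k - (n - m)) z else 0)" for k z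
    have q': "holo_fun_on (q' k) D" if "k < n" for k
    proof (cases "n - m \<le> k")
      case True
      have "holo_fun_on (\<lambda>z. p m z * q k z - q n z * p (k - (n - m)) z) D"
        using that by (intro holo_fun_on_diff holo_fun_on_mult assms(2) Suc.prems) auto
      with True show ?thesis by (simp add: q'_def[abs_def])
    next
      case False
      have "holo_fun_on (\<lambda>z. p m z * q k z) D"
        using that by (intro holo_fun_on_mult assms(2) Suc.prems) auto
      with False show ?thesis by (simp add: q'_def[abs_def])
    qed
    from Suc.IH[of q', OF q'] obtain N Q r where r: "\<forall>k<m. holo_fun_on (r k) D"
      "\<And>z t. p m z ^ N * (\<Sum>k<n. q' k z * t ^ k) = Q z t * (\<Sum>k\<le>m. p k z * t ^ k) + (\<Sum>k<m. r k z * t ^ k)"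
      by blast
    have key: "(\<Sum>k<n. q' k z * t ^ k) = p m z * (\<Sum>k<Suc n. q k z * t ^ k) -
        q n z * t ^ (n - m) * (\<Sum>k\<le>m. p k z * t ^ k)" for z t
    proof -
      have "q n z * t ^ (n - m) * (\<Sum>k\<le>m. p k z * t ^ k) = (\<Sum>k\<le>m. q n z * p k z * t ^ (k + (n - m)))"
        by (simp add: sum_distrib_left power_add mult_ac)
      also have "\<dots> = (\<Sum>k\<in>{n-m..n}. q n z * p (k - (n - m)) z * t ^ k)"
        by (rule sum.reindex_bij_witness[of _ "\<lambda>k. k - (n - m)" "\<lambda>k. k + (n - m)"]) (use nm in auto)
      also have "\<dots> = (\<Sum>k<Suc n. (if n - m \<le> k then q n z * p (k - (n - m)) z else 0) * t ^ k)"
        by (intro sum.mono_neutral_cong_left) auto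
      finally have "p m z * (\<Sum>k<Suc n. q k z * t ^ k) - q n z * t ^ (n - m) * (\<Sum>k\<le>m. p k z * t ^ k) =
          (\<Sum>k<Suc n. q' k z * t ^ k)"
        by (simp only: q'_def sum_distrib_left sum_subtractf left_diff_distrib mult.assoc)
      moreover have "q' n z = 0" using nm by (simp add: q'_def)
      ultimately show ?thesis by simp
    qed
    have "p m z ^ Suc N * (\<Sum>k<Suc n. q k z * t ^ k) =
        (Q z t + p m z ^ N * q n z * t ^ (n - m)) * (\<Sum>k\<le>m. p k z * t ^ k) + (\<Sum>k<m. r k z * t ^ k)" for z t
    proof -
      have "p m z ^ Suc N * (\<Sum>k<Suc n. q k z * t ^ k) =
        p m z ^ N * (\<Sum>k<n. q' k z * t ^ k) + p m z ^ N * q n z * t ^ (n - m) * (\<Sum>k\<le>m. p k z * t ^ k)"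
        unfolding key by (simp only: algebra_simps power_Suc)
      then show ?thesis unfolding r(2) by (simp only: algebra_simps)
    qed
    with r(1) show ?thesis
      by (intro exI[of _ "Suc N"] exI[of _ "\<lambda>z t. Q z t + p m z ^ N * q n z * t ^ (n - m)"] exI[of _ r]) blast
  qed
qed

text \<open>
  Let \<open>p\<close> be a polynomial of least degree that vanishes generically on \<open>S\<close>.  By minimality the
  remainder of the monic polynomial \<open>w\<close> modulo \<open>p\<close> is zero, so that, where the leading coefficient of
  \<open>p\<close> does not vanish, the roots of \<open>p\<close> are roots of \<open>w\<close> and lie in the disc of radius \<open>e\<close>.  The
  coefficients of \<open>p\<close> divided by the leading one are then bounded, and Riemann's theorem makes them
  holomorphic.  The last two conclusions say that the resulting monic polynomial still vanishes
  generically on \<open>S\<close> and that nothing of smaller degree does.  The lower bound excludes roots outside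
  the disc also where the leading coefficient of \<open>p\<close> vanishes.
\<close>
lemma minimal_polynomial:
  fixes w :: "nat \<Rightarrow> complex^'n \<Rightarrow> complex"
  assumes D: "open D" "convex D"
    and S: "\<And>z t. (z, t) \<in> S \<Longrightarrow> z \<in> D" and B: "open B" "B \<noteq> {}" "\<And>z. z \<in> B \<Longrightarrow> \<exists>t. (z, t) \<in> S"
    and w: "\<And>k. k < d \<Longrightarrow> holo_fun_on (w k) D"
    and WS: "\<And>z t. (z, t) \<in> S \<Longrightarrow> t ^ d + (\<Sum>k<d. w k z * t ^ k) = 0"
    and We: "\<And>z t. z \<in> D \<Longrightarrow> t ^ d + (\<Sum>k<d. w k z * t ^ k) = 0 \<Longrightarrow> norm t \<le> e"
    and e: "e \<le> 1"
  shows "\<exists>m h. m \<ge> 1 \<and> (\<forall>k<m. holo_fun_on (h k) D) \<and>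
    (\<forall>z\<in>D. \<forall>t. norm t \<ge> e \<longrightarrow> norm (t ^ m + (\<Sum>k<m. h k z * t ^ k)) \<ge> (norm t - e) ^ m) \<and>
    generic_zero D S (\<lambda>z t. t ^ m + (\<Sum>k<m. h k z * t ^ k)) \<and>
    (\<forall>r. (\<forall>k<m. holo_fun_on (r k) D) \<longrightarrow> generic_zero D S (\<lambda>z t. \<Sum>k<m. r k z * t ^ k) \<longrightarrow>
      (\<forall>k<m. \<forall>z\<in>D. r k z = 0))"
proof -
  define good where "good m p \<longleftrightarrow> (\<forall>k\<le>m. holo_fun_on (p k) D) \<and> (\<exists>z\<in>D. p m z \<noteq> 0) \<and>
     generic_zero D S (\<lambda>z t. \<Sum>k\<le>m. p k z * t ^ k)" for m and p :: "nat \<Rightarrow> complex^'n \<Rightarrow> complex"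
  define w' where "w' k z = (if k < d then w k z else 1)" for k z
  have w': "holo_fun_on (w' k) D" for k
    using w by (cases "k < d") (auto simp: w'_def[abs_def] intro: holo_fun_on_const D(1))
  have w'_sum: "(\<Sum>k<Suc d. w' k z * t ^ k) = t ^ d + (\<Sum>k<d. w k z * t ^ k)" for z t
    by (simp add: w'_def)
  have BD: "B \<subseteq> D" using B(3) S by blast
  have Dne: "D \<noteq> {}" using BD B(2) by auto
  have "good d w'"
    unfolding good_def generic_zero_def lessThan_Suc_atMost[symmetric] w'_sum using WS Dne w'
    by (auto intro!: exI[of _ "\<lambda>_. 1"] holo_fun_on_const D(1) simp: w'_def)
  then have ex: "\<exists>m p. good m p" by blast
  define m where "m = (LEAST m. \<exists>p. good m p)"
  obtain p where p: "good m p" using LeastI_ex[OF ex] unfolding m_def by blast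
  have least: "m \<le> k" if "good k q" for k q unfolding m_def using that by (intro Least_le) blast
  have ph: "\<And>k. k \<le> m \<Longrightarrow> holo_fun_on (p k) D" and pm: "\<exists>z\<in>D. p m z \<noteq> 0" using p by (auto simp: good_def)
  obtain a where a: "holo_fun_on a D" "\<exists>z\<in>D. a z \<noteq> 0"
    "\<And>z t. (z, t) \<in> S \<Longrightarrow> a z * (\<Sum>k\<le>m. p k z * t ^ k) = 0"
    using p unfolding good_def generic_zero_def by blast
  have apm: "\<exists>z\<in>D. a z * p m z \<noteq> 0" by (rule product_nonzero[OF a(1) ph D(2) a(2) pm]) simp
  have ap: "holo_fun_on (\<lambda>z. a z * p m z) D" by (intro holo_fun_on_mult a ph) simp
  have small: "r k z = 0" if r: "\<And>k. k < m \<Longrightarrow> holo_fun_on (r k) D"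
      and gz: "generic_zero D S (\<lambda>z t. \<Sum>k<m. r k z * t ^ k)" and k: "k < m" and z: "z \<in> D" for r k z
  proof (rule ccontr)
    assume "r k z \<noteq> 0"
    define K where "K = {k. k < m \<and> (\<exists>z\<in>D. r k z \<noteq> 0)}"
    have K: "finite K" "K \<noteq> {}" using \<open>r k z \<noteq> 0\<close> k z by (auto simp: K_def)
    define l where "l = Max K"
    have l: "l \<in> K" using Max_in[OF K] by (simp add: l_def)
    have "r j z = 0" if "z \<in> D" "j < m" "j > l" for j z
    proof (rule ccontr)
      assume "r j z \<noteq> 0"
      then have "j \<in> K" using that by (auto simp: K_def)
      from Max_ge[OF K(1) this] that show False by (simp add: l_def)
    qed
    then have eq: "(\<Sum>k<m. r k z * t ^ k) = (\<Sum>k\<le>l. r k z * t ^ k)" if "z \<in> D" for z t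
      using that l by (intro sum.mono_neutral_right) (auto simp: K_def)
    obtain b where b: "holo_fun_on b D" "\<exists>z\<in>D. b z \<noteq> 0"
      "\<And>z t. (z, t) \<in> S \<Longrightarrow> b z * (\<Sum>k<m. r k z * t ^ k) = 0"
      using gz unfolding generic_zero_def by blast
    have "generic_zero D S (\<lambda>z t. \<Sum>k\<le>l. r k z * t ^ k)"
      unfolding generic_zero_def
    proof (intro exI[of _ b] conjI b ballI, clarify)
      fix z t assume st: "(z, t) \<in> S"
      from b(3)[OF this] show "b z * (\<Sum>k\<le>l. r k z * t ^ k) = 0" unfolding eq[OF S[OF st]] .
    qed
    then have "good l r" using l r by (auto simp: good_def K_def)
    from least[OF this] l show False by (simp add: K_def)
  qed
  have "m \<noteq> 0"
  proof
    assume "m = 0"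
    have "B \<inter> D \<noteq> {}" using BD B(2) by auto
    from nonzero_dense[OF ap D(2) apm B(1) this]
    obtain z where z: "z \<in> B" "a z * p m z \<noteq> 0" by auto
    then obtain t where "(z, t) \<in> S" using B(3) by blast
    from a(3)[OF this] z(2) \<open>m = 0\<close> show False by simp
  qed
  obtain N Q r where r: "\<And>k. k < m \<Longrightarrow> holo_fun_on (r k) D"
    "\<And>z t. p m z ^ N * (\<Sum>k<Suc d. w' k z * t ^ k) = Q z t * (\<Sum>k\<le>m. p k z * t ^ k) + (\<Sum>k<m. r k z * t ^ k)"
    using pseudo_division[OF D(1) ph w', of m "\<lambda>k. k" "\<lambda>k. k" "Suc d"] by blast
  have "generic_zero D S (\<lambda>z t. \<Sum>k<m. r k z * t ^ k)"
    unfolding generic_zero_def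
  proof (intro exI[of _ a] conjI a ballI, clarify)
    fix z t assume st: "(z, t) \<in> S"
    have "(\<Sum>k<m. r k z * t ^ k) = - (Q z t * (\<Sum>k\<le>m. p k z * t ^ k))"
      using r(2)[of z t] WS[OF st] unfolding w'_sum by (simp add: eq_neg_iff_add_eq_0 add.commute)
    then show "a z * (\<Sum>k<m. r k z * t ^ k) = 0" using a(3)[OF st] by auto
  qed
  then have r0: "r k z = 0" if "k < m" "z \<in> D" for k z using small r that by blast
  have roots: "norm t \<le> e" if "z \<in> D" "p m z \<noteq> 0" "(\<Sum>k\<le>m. p k z * t ^ k) = 0" for z t
    using r(2)[of z t] that r0 We[of z t] unfolding w'_sum by simp
  have fact: "\<exists>A. size A = m \<and> (\<forall>x\<in>#A. norm x \<le> e) \<and> (\<forall>k\<le>m. p k z / p m z = coeff (\<Prod>x\<in>#A. [:- x, 1:]) k) \<and>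
      (\<forall>t. (\<Sum>k\<le>m. p k z * t ^ k) = p m z * (\<Prod>x\<in>#A. t - x))" if z: "z \<in> D" "p m z \<noteq> 0" for z
  proof -
    define P where "P = (\<Sum>k\<le>m. monom (p k z / p m z) k)"
    have cP: "coeff P k = (if k \<le> m then p k z / p m z else 0)" for k
      by (simp add: P_def coeff_sum)
    have deg: "degree P = m"
    proof (rule antisym)
      show "degree P \<le> m" by (rule degree_le) (simp add: cP)
      show "m \<le> degree P" by (rule le_degree) (simp add: cP z)
    qed
    have lc: "lead_coeff P = 1" using deg cP z by simp
    then have "P \<noteq> 0" by auto
    then obtain A where A: "size A = m" "P = (\<Prod>x\<in>#A. [:- x, 1:])"
      using alg_closed_imp_factorization[of P] lc deg by auto
    have polyP: "p m z * poly P t = (\<Sum>k\<le>m. p k z * t ^ k)" for t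
      unfolding P_def using z(2) by (simp add: poly_sum poly_monom sum_distrib_left)
    have "norm x \<le> e" if "x \<in># A" for x
    proof (rule roots[OF z])
      have "(\<Prod>y\<in>#A. x - y) = 0" using that by auto
      then show "(\<Sum>k\<le>m. p k z * x ^ k) = 0"
        unfolding polyP[symmetric] A(2) poly_prod_linear by simp
    qed
    then show ?thesis
      using A cP polyP poly_prod_linear by (intro exI[of _ A]) auto
  qed
  have bound: "norm (p k z / p m z) \<le> 2 ^ m" if z: "z \<in> D" "p m z \<noteq> 0" and k: "k < m" for z k
  proof -
    obtain A where "size A = m" "\<forall>x\<in>#A. norm x \<le> e" "p k z / p m z = coeff (\<Prod>x\<in>#A. [:- x, 1:]) k"
      using fact[OF z] k by auto
    with coeff_prod_linear_bound[of A k] e show ?thesis by (metis order_trans)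
  qed
  have "\<exists>g. holo_fun_on g D \<and> (\<forall>z\<in>D. p m z \<noteq> 0 \<longrightarrow> g z = p k z / p m z)" if k: "k < m" for k
  proof (rule riemann_extension[OF D ph pm])
    have o: "open {z\<in>D. p m z \<noteq> 0}"
      using open_nonzero[OF holo_fun_on_continuous_on[OF ph] D(1)] by auto
    show "holo_fun_on (\<lambda>z. p k z / p m z) {z\<in>D. p m z \<noteq> 0}"
      using k by (intro holo_fun_on_divide holo_fun_on_subset[OF ph] o) auto
  qed (use bound k in auto)
  then obtain h where h: "\<And>k. k < m \<Longrightarrow> holo_fun_on (h k) D"
    "\<And>k z. k < m \<Longrightarrow> z \<in> D \<Longrightarrow> p m z \<noteq> 0 \<Longrightarrow> h k z = p k z / p m z"
    by metis
  define H where "H z t = t ^ m + (\<Sum>k<m. h k z * t ^ k)" for z t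
  have PH: "(\<Sum>k\<le>m. p k z * t ^ k) = p m z * H z t" if "z \<in> D" "p m z \<noteq> 0" for z t
    using that h(2) by (simp add: H_def lessThan_Suc_atMost[symmetric] distrib_left sum_distrib_left)
  have Hc: "continuous_on D (\<lambda>z. H z t)" for t
    unfolding H_def by (intro continuous_intros holo_fun_on_continuous_on h(1)) auto
  have "norm (H z t) \<ge> (norm t - e) ^ m" if z: "z \<in> D" and t: "norm t \<ge> e" for z t
  proof (rule ccontr)
    assume *: "\<not> ?thesis"
    define O' where "O' = D \<inter> (\<lambda>z. norm (H z t)) -` {..<(norm t - e) ^ m}"
    have "open O'" unfolding O'_def
      by (intro continuous_open_preimage continuous_intros Hc D)
    moreover have "O' \<inter> D \<noteq> {}" using * z by (auto simp: O'_def)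
    ultimately obtain y where y: "y \<in> O'" "y \<in> D" "p m y \<noteq> 0"
      using nonzero_dense[OF ph D(2) pm] by blast
    obtain A where A: "size A = m" "\<forall>x\<in>#A. norm x \<le> e"
      "(\<Sum>k\<le>m. p k y * t ^ k) = p m y * (\<Prod>x\<in>#A. t - x)" using fact[OF y(2,3)] by blast
    then have "H y t = (\<Prod>x\<in>#A. t - x)" using PH[OF y(2,3)] y(3) by simp
    with norm_prod_linear_lower[OF A(2) t] A(1) y(1) show False by (auto simp: O'_def)
  qed
  moreover have "generic_zero D S H"
    unfolding generic_zero_def
  proof (intro exI[of _ "\<lambda>z. a z * p m z"] conjI ap apm ballI, clarify)
    fix z t assume st: "(z, t) \<in> S"
    show "a z * p m z * H z t = 0"
      using PH[OF S[OF st], of t] a(3)[OF st] by (cases "p m z = 0") (auto simp: mult.assoc)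
  qed
  ultimately show ?thesis
    using \<open>m \<noteq> 0\<close> h(1) small unfolding H_def by (intro exI[of _ m] exI[of _ h]) (simp add: Suc_leI)
qed

section \<open>Weierstrass preparation and division\<close>

text \<open>
  By the argument principle the power sums of the roots of \<open>t \<mapsto> f (z + tv)\<close> are integrals over a
  circle, hence holomorphic in \<open>z\<close>.  The power sum with exponent zero counts the roots; it is
  continuous with integer values, so the degree does not depend on \<open>z\<close>.
\<close>
lemma weierstrass_polynomial:
  fixes v :: "complex^'n"
  assumes f: "holo_fun_on f U" and D: "open D" "connected D" and e: "e > 0"
    and dom: "\<And>z t. z \<in> D \<Longrightarrow> norm t < 3 * e \<Longrightarrow> z + t *s v \<in> U"
    and nz: "\<And>z t. z \<in> D \<Longrightarrow> e \<le> norm t \<Longrightarrow> norm t < 3 * e \<Longrightarrow> f (z + t *s v) \<noteq> 0"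
  shows "\<exists>d w. (\<forall>k<d. holo_fun_on (w k) D) \<and>
    (\<forall>z\<in>D. \<forall>t. t ^ d + (\<Sum>k<d. w k z * t ^ k) = 0 \<longleftrightarrow> norm t < 3 * e \<and> f (z + t *s v) = 0)"
proof -
  define N where "N k z = contour_integral (circlepath 0 (2 * e))
      (\<lambda>s. dir_deriv v f (z + s *s v) * s ^ k / f (z + s *s v)) / (2 * of_real pi * \<i>)" for k z
  have circ: "s \<in> sphere 0 (2 * e) \<Longrightarrow> e \<le> norm s \<and> norm s < 3 * e" for s :: complex using e by simp
  have N: "holo_fun_on (N k) D" for k
  proof -
    have "holo_fun_on (\<lambda>z. contour_integral (circlepath 0 (2 * e))
      (\<lambda>s. dir_deriv v f (z + s *s v) * s ^ k / f (z + s *s v))) D"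
    proof (rule holo_fun_on_circle_integral)
      have "continuous_on (D \<times> sphere 0 (2 * e))
        (\<lambda>x. dir_deriv v f (fst x + snd x *s v) * snd x ^ k / f (fst x + snd x *s v))"
        by (intro continuous_intros continuous_on_compose2[OF holo_fun_on_continuous_on[OF f]]
             continuous_on_compose2[OF holo_fun_on_continuous_on[OF holo_fun_on_dir_deriv[OF f]]])
           (use dom nz circ in \<open>auto simp del: mem_sphere\<close>)
      then show "continuous_on (D \<times> sphere 0 (2 * e))
        (\<lambda>(z, s). dir_deriv v f (z + s *s v) * s ^ k / f (z + s *s v))" by (simp add: case_prod_beta')
      fix s :: complex assume "norm s = 2 * e"
      with circ[of s] show "holo_fun_on (\<lambda>z. dir_deriv v f (z + s *s v) * s ^ k / f (z + s *s v)) D"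
        by (intro holo_fun_on_divide holo_fun_on_mult holo_fun_on_const D(1) holo_fun_on_shift[OF f]
            holo_fun_on_shift[OF holo_fun_on_dir_deriv[OF f]]) (use dom nz in auto)
    qed (use D e in auto)
    then show ?thesis unfolding N_def by (intro holo_fun_on_divide holo_fun_on_const D(1)) auto
  qed
  have roots: "\<exists>A. (\<forall>k. N k z = (\<Sum>x\<in>#A. x ^ k)) \<and> (\<forall>t. t \<in># A \<longleftrightarrow> norm t < 3 * e \<and> f (z + t *s v) = 0)"
    if z: "z \<in> D" for z
  proof -
    define \<phi> where "\<phi> t = f (z + t *s v)" for t
    let ?S = "ball (0 :: complex) (3 * e)"
    have hol: "\<phi> holomorphic_on ?S"
      unfolding \<phi>_def by (rule holo_fun_on_line[OF f]) (use dom[OF z] in auto)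
    have \<phi>nz: "\<phi> t \<noteq> 0" if "e \<le> norm t" "norm t < 3 * e" for t
      using nz[OF z that] by (simp add: \<phi>_def)
    define pz where "pz = {w \<in> ?S. \<phi> w = 0 \<or> w \<in> {}}"
    have "finite {t\<in>cball 0 e. \<phi> t = 0}"
    proof (cases "\<phi> constant_on ?S")
      case True
      then obtain c where c: "\<And>t. t \<in> ?S \<Longrightarrow> \<phi> t = c" unfolding constant_on_def by blast
      have "\<phi> (of_real (2 * e)) = c" using e by (intro c) (simp add: norm_mult)
      moreover have "\<phi> (of_real (2 * e)) \<noteq> 0" using e by (intro \<phi>nz) (auto simp: norm_mult)
      ultimately have "c \<noteq> 0" by simp
      have "\<phi> t \<noteq> 0" if "t \<in> cball 0 e" for t
      proof -
        have "t \<in> ?S" using that e by simp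
        from c[OF this] \<open>c \<noteq> 0\<close> show ?thesis by simp
      qed
      then have "{t\<in>cball 0 e. \<phi> t = 0} = {}" by blast
      then show ?thesis by (simp only: finite.emptyI)
    next
      case False
      show ?thesis
        by (rule holomorphic_compact_finite_zeros[OF hol]) (use e False in auto)
    qed
    moreover have pz_eq: "pz = {t\<in>cball 0 e. \<phi> t = 0}"
      using \<phi>nz e by (force simp: pz_def)
    ultimately have fin: "finite pz" by simp
    have pos: "zorder \<phi> p > 0" if "p \<in> pz" for p
    proof -
      have p: "p \<in> ?S" "\<phi> p = 0" using that by (auto simp: pz_def)
      have "open (?S - (pz - {p}))" using fin by (simp add: finite_imp_closed open_Diff)
      then have "\<forall>\<^sub>F t in at p. t \<in> ?S - (pz - {p}) \<and> t \<noteq> p"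
        using p by (auto simp: eventually_at_topological)
      then have "\<forall>\<^sub>F t in at p. \<phi> t \<noteq> 0" by eventually_elim (auto simp: pz_def)
      then have "\<exists>\<^sub>F t in at p. \<phi> t \<noteq> 0" by (simp add: eventually_frequently)
      with zorder_pos_iff[OF hol _ p(1)] p show ?thesis by simp
    qed
    define A where "A = (\<Sum>p\<in>pz. replicate_mset (nat (zorder \<phi> p)) p)"
    have "N k z = (\<Sum>x\<in>#A. x ^ k)" for k
    proof -
      have "contour_integral (circlepath 0 (2 * e)) (\<lambda>x. deriv \<phi> x * x ^ k / \<phi> x) =
         2 * pi * \<i> * (\<Sum>p\<in>pz. winding_number (circlepath 0 (2 * e)) p * p ^ k * zorder \<phi> p)"
        unfolding pz_def
      proof (rule argument_principle)
        show "path_image (circlepath 0 (2 * e)) \<subseteq> ?S - {w \<in> ?S. \<phi> w = 0 \<or> w \<in> {}}"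
          using e \<phi>nz by auto
        show "\<forall>z. z \<notin> ?S \<longrightarrow> winding_number (circlepath 0 (2 * e)) z = 0"
          using e by (intro allI impI winding_number_zero_outside[of _ ?S]) auto
        show "finite {w \<in> ?S. \<phi> w = 0 \<or> w \<in> {}}" using fin by (simp add: pz_def)
      qed (use hol in \<open>auto intro!: holomorphic_intros\<close>)
      also have "contour_integral (circlepath 0 (2 * e)) (\<lambda>x. deriv \<phi> x * x ^ k / \<phi> x) =
        contour_integral (circlepath 0 (2 * e)) (\<lambda>s. dir_deriv v f (z + s *s v) * s ^ k / f (z + s *s v))"
      proof (rule contour_integral_cong)
        fix s assume "s \<in> path_image (circlepath 0 (2 * e))"
        then have "z + s *s v \<in> U" using e by (intro dom[OF z]) auto
        from deriv_line[OF f this] show "deriv \<phi> s * s ^ k / \<phi> s = dir_deriv v f (z + s *s v) * s ^ k / f (z + s *s v)"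
          by (simp add: \<phi>_def[abs_def])
      qed auto
      finally have "N k z = (\<Sum>p\<in>pz. winding_number (circlepath 0 (2 * e)) p * p ^ k * zorder \<phi> p)"
        by (simp add: N_def)
      also have "\<dots> = (\<Sum>p\<in>pz. of_nat (nat (zorder \<phi> p)) * p ^ k)"
      proof (rule sum.cong[OF refl])
        fix p assume p: "p \<in> pz"
        then have "norm p \<le> e" by (simp add: pz_eq)
        then have "winding_number (circlepath 0 (2 * e)) p = 1" using e by (intro winding_number_circlepath) auto
        then show "winding_number (circlepath 0 (2 * e)) p * p ^ k * zorder \<phi> p = of_nat (nat (zorder \<phi> p)) * p ^ k"
          using pos[OF p] by simp
      qed
      also have "\<dots> = (\<Sum>x\<in>#A. x ^ k)"
        unfolding A_def using fin by (induction pz rule: finite_induct) auto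
      finally show ?thesis .
    qed
    moreover have "t \<in># A \<longleftrightarrow> t \<in> pz" for t
      unfolding A_def using fin by (auto simp: set_mset_sum not_le split: if_splits dest: pos)
    ultimately show ?thesis
      by (intro exI[of _ A]) (auto simp: pz_def \<phi>_def)
  qed
  then obtain A where A: "\<And>z k. z \<in> D \<Longrightarrow> N k z = (\<Sum>x\<in>#A z. x ^ k)"
    "\<And>z t. z \<in> D \<Longrightarrow> t \<in># A z \<longleftrightarrow> norm t < 3 * e \<and> f (z + t *s v) = 0" by metis
  have N0: "N 0 z = of_nat (size (A z))" if "z \<in> D" for z using A(1)[OF that, of 0] by simp
  have "N 0 constant_on D"
  proof (rule continuous_discrete_range_constant[OF D(2) holo_fun_on_continuous_on[OF N]])
    fix z assume z: "z \<in> D"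
    show "\<exists>c>0. \<forall>y. y \<in> D \<and> N 0 y \<noteq> N 0 z \<longrightarrow> c \<le> norm (N 0 y - N 0 z)"
    proof (intro exI[of _ 1] conjI allI impI)
      fix y assume y: "y \<in> D \<and> N 0 y \<noteq> N 0 z"
      have "N 0 y - N 0 z = of_int (int (size (A y)) - int (size (A z)))" using N0 y z by simp
      moreover have "int (size (A y)) - int (size (A z)) \<noteq> 0" using N0 y z by auto
      then have "\<bar>int (size (A y)) - int (size (A z))\<bar> \<ge> 1" by linarith
      then have "norm (of_int (int (size (A y)) - int (size (A z))) :: complex) \<ge> 1"
        unfolding norm_of_int by linarith
      ultimately show "1 \<le> norm (N 0 y - N 0 z)" by simp
    qed simp
  qed
  then obtain d where d: "\<And>z. z \<in> D \<Longrightarrow> size (A z) = d"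
    using N0 unfolding constant_on_def by (metis of_nat_eq_iff)
  define w where "w k z = newton (\<lambda>k. N k z) (d - k)" for k z
  show ?thesis
  proof (intro exI[of _ d] exI[of _ w] conjI allI impI ballI)
    show "holo_fun_on (w k) D" for k
      unfolding w_def by (rule holo_fun_on_newton[OF D(1) N])
    fix z t assume z: "z \<in> D"
    have "(\<Prod>x\<in>#A z. t - x) = (\<Sum>k\<le>d. newton (\<lambda>k. N k z) k * t ^ (d - k))"
      using newton_identities[of "\<lambda>k. N k z" "A z" t] A(1)[OF z] d[OF z] by simp
    also have "\<dots> = (\<Sum>k\<le>d. w k z * t ^ k)"
      unfolding w_def by (rule sum.reindex_bij_witness[of _ "\<lambda>k. d - k" "\<lambda>k. d - k"]) auto
    also have "\<dots> = t ^ d + (\<Sum>k<d. w k z * t ^ k)"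
      by (simp add: lessThan_Suc_atMost[symmetric] w_def)
    finally have "t ^ d + (\<Sum>k<d. w k z * t ^ k) = (\<Prod>x\<in>#A z. t - x)" by simp
    then show "t ^ d + (\<Sum>k<d. w k z * t ^ k) = 0 \<longleftrightarrow> norm t < 3 * e \<and> f (z + t *s v) = 0"
      using A(2)[OF z, of t] by auto
  qed
qed

lemma polynomial_difference_quotient:
  fixes s t :: complex
  shows "(\<Sum>k\<le>m. h k * s ^ k) - (\<Sum>k\<le>m. h k * t ^ k) =
    (s - t) * (\<Sum>j<m. t ^ j * (\<Sum>k | k \<le> m \<and> j < k. h k * s ^ (k - Suc j)))"
proof -
  have "(\<Sum>k\<le>m. h k * s ^ k) - (\<Sum>k\<le>m. h k * t ^ k) = (\<Sum>k\<le>m. h k * (s ^ k - t ^ k))"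
    by (simp add: sum_subtractf right_diff_distrib)
  also have "\<dots> = (\<Sum>k\<le>m. \<Sum>j | j < m \<and> j < k. (s - t) * (t ^ j * (h k * s ^ (k - Suc j))))"
  proof (rule sum.cong[OF refl])
    fix k assume "k \<in> {..m}"
    then have "{j. j < m \<and> j < k} = {..<k}" by auto
    moreover have "s ^ k - t ^ k = (s - t) * (\<Sum>j<k. t ^ j * s ^ (k - Suc j))"
      using power_diff_sumr2[of t k s] by (simp add: mult.commute minus_diff_eq algebra_simps)
    ultimately show "h k * (s ^ k - t ^ k) = (\<Sum>j | j < m \<and> j < k. (s - t) * (t ^ j * (h k * s ^ (k - Suc j))))"
      by (simp add: sum_distrib_left mult_ac)
  qed
  also have "\<dots> = (\<Sum>j<m. \<Sum>k | k \<le> m \<and> j < k. (s - t) * (t ^ j * (h k * s ^ (k - Suc j))))"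
    using sum.swap_restrict[of "{..m}" "{..<m}" "\<lambda>k j. (s - t) * (t ^ j * (h k * s ^ (k - Suc j)))" "\<lambda>k j. j < k"]
    by simp
  finally show ?thesis by (simp add: sum_distrib_left mult_ac)
qed

text \<open>
  In Cauchy's formula for \<open>G t\<close>, write the integrand as \<open>G s / H s \<cdot> H s / (s - t)\<close> and split \<open>H s\<close>
  into \<open>H t + (H s - H t)\<close>.  The first part gives the multiple of \<open>H t\<close>; in the second \<open>s - t\<close>
  cancels, which leaves a polynomial in \<open>t\<close> of degree less than \<open>m\<close>.
\<close>
lemma cauchy_division:
  fixes h :: "nat \<Rightarrow> complex"
  assumes G: "G holomorphic_on cball 0 \<rho>" and nz: "\<And>s. norm s = \<rho> \<Longrightarrow> (\<Sum>k\<le>m. h k * s ^ k) \<noteq> 0"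
    and t: "norm t < \<rho>"
  shows "2 * of_real pi * \<i> * G t =
    (\<Sum>k\<le>m. h k * t ^ k) * contour_integral (circlepath 0 \<rho>) (\<lambda>s. G s / ((\<Sum>k\<le>m. h k * s ^ k) * (s - t))) +
    (\<Sum>j<m. contour_integral (circlepath 0 \<rho>)
       (\<lambda>s. G s / (\<Sum>k\<le>m. h k * s ^ k) * (\<Sum>k | k \<le> m \<and> j < k. h k * s ^ (k - Suc j))) * t ^ j)"
proof -
  define H where "H s = (\<Sum>k\<le>m. h k * s ^ k)" for s
  have \<rho>: "\<rho> > 0" using t norm_ge_zero[of t] by linarith
  have cG: "continuous_on (sphere 0 \<rho>) G"
    using holomorphic_on_imp_continuous_on[OF G] by (rule continuous_on_subset) auto
  have cH: "continuous_on A H" for A unfolding H_def by (intro continuous_intros)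
  have Hnz: "s \<in> sphere 0 \<rho> \<Longrightarrow> H s \<noteq> 0" for s using nz by (simp add: H_def)
  have st: "s \<in> sphere 0 \<rho> \<Longrightarrow> s - t \<noteq> 0" for s using t by auto
  define K where "K j s = G s / H s * (\<Sum>k | k \<le> m \<and> j < k. h k * s ^ (k - Suc j))" for j s
  have i1: "(\<lambda>s. G s / (H s * (s - t))) contour_integrable_on circlepath 0 \<rho>"
    using \<rho> Hnz st by (intro contour_integrable_continuous_circlepath)
      (auto intro!: continuous_intros cG cH simp del: mem_sphere)
  have i2: "(\<lambda>s. K j s) contour_integrable_on circlepath 0 \<rho>" for j
    unfolding K_def using \<rho> Hnz by (intro contour_integrable_continuous_circlepath)
      (auto intro!: continuous_intros cG cH simp del: mem_sphere)
  have "2 * of_real pi * \<i> * G t = contour_integral (circlepath 0 \<rho>) (\<lambda>s. G s / (s - t))"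
    using Cauchy_integral_circlepath_simple[OF G, of t] t by (simp add: contour_integral_unique)
  also have "\<dots> = contour_integral (circlepath 0 \<rho>) (\<lambda>s. H t * (G s / (H s * (s - t))) + (\<Sum>j<m. t ^ j * K j s))"
  proof (rule contour_integral_cong)
    fix s assume "s \<in> path_image (circlepath 0 \<rho>)"
    then have s: "H s \<noteq> 0" "s - t \<noteq> 0" using Hnz[of s] st[of s] \<rho> by auto
    have "H s - H t = (s - t) * (\<Sum>j<m. t ^ j * (\<Sum>k | k \<le> m \<and> j < k. h k * s ^ (k - Suc j)))"
      unfolding H_def by (rule polynomial_difference_quotient)
    moreover have "(\<Sum>j<m. t ^ j * K j s) =
      G s / H s * (\<Sum>j<m. t ^ j * (\<Sum>k | k \<le> m \<and> j < k. h k * s ^ (k - Suc j)))"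
      unfolding K_def by (subst sum_distrib_left) (simp add: mult_ac)
    ultimately have "(\<Sum>j<m. t ^ j * K j s) = G s / H s * ((H s - H t) / (s - t))" using s by simp
    then show "G s / (s - t) = H t * (G s / (H s * (s - t))) + (\<Sum>j<m. t ^ j * K j s)"
      using s by (simp add: field_simps)
  qed auto
  also have "\<dots> = contour_integral (circlepath 0 \<rho>) (\<lambda>s. H t * (G s / (H s * (s - t)))) +
      contour_integral (circlepath 0 \<rho>) (\<lambda>s. \<Sum>j<m. t ^ j * K j s)"
    by (intro contour_integral_add contour_integrable_lmul contour_integrable_sum i1 i2 finite_lessThan)
  also have "\<dots> = H t * contour_integral (circlepath 0 \<rho>) (\<lambda>s. G s / (H s * (s - t))) +
      (\<Sum>j<m. contour_integral (circlepath 0 \<rho>) (K j) * t ^ j)"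
    by (simp only: contour_integral_lmul[OF i1] contour_integral_lmul[OF i2]
        contour_integral_sum[OF finite_lessThan contour_integrable_lmul[OF i2]]) (simp only: mult.commute)
  finally show ?thesis unfolding H_def[symmetric] K_def[abs_def] .
qed

section \<open>Common factors\<close>

text \<open>Open pieces of the zero set are excluded by the identity theorem.\<close>
lemma smooth_hypersurface_in_zero_set:
  fixes F :: "complex^'n \<Rightarrow> complex^'i"
  assumes F: "\<And>i. holo_fun_on (\<lambda>z. F z $ i) U" and U: "convex U" "0 \<in> U"
    and nz: "z0 \<in> U" "F z0 $ i0 \<noteq> 0" and cod: "\<not> codim_ge 2 (zero_set F)" and \<epsilon>: "\<epsilon> > 0"
  obtains p g V where "norm p < \<epsilon>" "p \<in> V" "holo_fun_on g V" "g p = 0"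
    "\<And>z. z \<in> V \<Longrightarrow> g z = 0 \<Longrightarrow> F z = 0" "\<exists>i. cpartial i g p \<noteq> 0"
proof -
  have "open (U \<inter> ball 0 \<epsilon>)" "0 \<in> U \<inter> ball 0 \<epsilon>" using holo_fun_on_open[OF F] U \<epsilon> by auto
  then obtain j M where M: "complex_submanifold j M" "M \<noteq> {}" "M \<subseteq> zero_set F \<inter> (U \<inter> ball 0 \<epsilon>)" "j < 2"
    using cod unfolding codim_ge_def by (metis not_le)
  then obtain p where p: "p \<in> M" by blast
  from bspec[OF M(1)[unfolded complex_submanifold_def] p]
  obtain V and g :: "nat \<Rightarrow> complex^'n \<Rightarrow> complex" where V: "p \<in> V" "\<forall>k<j. holo_fun_on (g k) V" "open V"
      "M \<inter> V = {z\<in>V. \<forall>k<j. g k z = 0}"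
      "\<forall>c :: nat \<Rightarrow> complex. (\<forall>i. (\<Sum>k<j. c k * cpartial i (g k) p) = 0) \<longrightarrow> (\<forall>k<j. c k = 0)"
    by (elim exE conjE) (rule that)
  consider "j = 0" | "j = 1" using M(4) by linarith
  then show ?thesis
  proof cases
    case 1
    then have VM: "V \<subseteq> M" using V(4) by auto
    have "\<forall>\<^sub>F z in nhds p. F z $ i0 = 0"
      unfolding eventually_nhds using V VM M(3) by (intro exI[of _ V]) (auto simp: zero_set_def subset_eq)
    moreover have "p \<in> U" using p M(3) by blast
    ultimately show ?thesis using identity_theorem[OF F U(1) _ _ nz(1)] nz(2) by blast
  next
    case 2
    have eq: "M \<inter> V = {z\<in>V. g 0 z = 0}" using V(4) 2 by simp
    have sub: "z \<in> V \<Longrightarrow> g 0 z = 0 \<Longrightarrow> z \<in> M" for z using eq by blast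
    have "\<exists>i. cpartial i (g 0) p \<noteq> 0"
      using spec[OF V(5), of "\<lambda>_. 1"] 2 by auto
    moreover have "norm p < \<epsilon>" using p M(3) by auto
    moreover have "g 0 p = 0" using eq p V(1) by blast
    moreover have "F z = 0" if "z \<in> V" "g 0 z = 0" for z
      using sub[OF that] M(3) by (auto simp: zero_set_def)
    ultimately show ?thesis using that[of p V "g 0"] V(1,2) 2 by simp
  qed
qed

text \<open>Baire's theorem, applied to the complements of countably many hyperplanes.\<close>
lemma generic_direction:
  fixes g :: "nat \<Rightarrow> complex^'n \<Rightarrow> complex"
  assumes g: "\<And>k. holo_fun_on (g k) (V k)" "\<And>k. p k \<in> V k" "\<And>k. \<exists>i. cpartial i (g k) (p k) \<noteq> 0"
    and W: "open W" "W \<noteq> {}"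
  shows "\<exists>v\<in>W. \<forall>k. dir_deriv v (g k) (p k) \<noteq> 0"
proof -
  define G where "G k = {v. dir_deriv v (g k) (p k) \<noteq> 0}" for k
  have lin: "bounded_linear (\<lambda>v. dir_deriv v (g k) (p k))" for k
    using has_derivative_bounded_linear[OF holo_fun_on_has_derivative(1)[OF g(1,2)]] .
  have "openin (top_of_set UNIV) (G k) \<and> UNIV \<subseteq> closure (G k)" for k
  proof
    have "continuous_on UNIV (\<lambda>v. dir_deriv v (g k) (p k))"
      using lin by (simp add: linear_continuous_on)
    from open_nonzero[OF this open_UNIV] show "openin (top_of_set UNIV) (G k)"
      by (simp add: G_def)
    obtain i where i: "cpartial i (g k) (p k) \<noteq> 0" using g(3) by blast
    define u where "u = axis i (1 :: complex)"
    have u: "dir_deriv u (g k) (p k) \<noteq> 0" using i by (simp add: u_def cpartial_eq_dir_deriv)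
    show "UNIV \<subseteq> closure (G k)"
    proof
      fix v
      show "v \<in> closure (G k)"
      proof (cases "dir_deriv v (g k) (p k) = 0")
        case False
        then show ?thesis using closure_subset[of "G k"] by (auto simp: G_def)
      next
        case True
        have "u \<noteq> 0" by (simp add: u_def axis_eq_0_iff)
        show ?thesis unfolding closure_approachable
        proof (intro allI impI)
          fix e :: real assume e: "e > 0"
          define y where "y = v + (e / (2 * norm u)) *\<^sub>R u"
          have "dir_deriv y (g k) (p k) = (e / (2 * norm u)) *\<^sub>R dir_deriv u (g k) (p k)"
            unfolding y_def using True by (simp add: linear_add[OF bounded_linear.linear[OF lin]] linear_scale[OF bounded_linear.linear[OF lin]])
          then have "y \<in> G k" using u e \<open>u \<noteq> 0\<close> by (simp add: G_def)
          moreover have "dist y v < e" using e \<open>u \<noteq> 0\<close> by (simp add: y_def dist_norm)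
          ultimately show "\<exists>y\<in>G k. dist y v < e" by blast
        qed
      qed
    qed
  qed
  then have "UNIV \<subseteq> closure (\<Inter> (range G))" by (intro Baire) auto
  then have "W \<inter> \<Inter> (range G) \<noteq> {}"
    using open_Int_closure_eq_empty[OF W(1), of "\<Inter> (range G)"] W(2) by blast
  then show ?thesis by (auto simp: G_def)
qed

text \<open>
  The factor is \<open>c z = H z 0\<close> for the minimal polynomial \<open>H\<close> of the common zeros in a direction \<open>v\<close>.
  It vanishes at \<open>0\<close>: the polynomial \<open>H 0\<close> has a root in the small disc, and such a root is a zero
  of \<open>t \<mapsto> f (tv)\<close>, whose only zero there is \<open>0\<close>.
\<close>
lemma common_factor:
  fixes F :: "complex^'n \<Rightarrow> complex^'i"
  assumes F: "\<And>i. holo_fun_on (\<lambda>z. F z $ i) (ball 0 r)" and r: "r > 0"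
    and nz: "z0 \<in> ball 0 r" "F z0 $ i0 \<noteq> 0" and cod: "\<not> codim_ge 2 (zero_set F)"
  shows "\<exists>\<delta> c (F' :: complex^'n \<Rightarrow> complex^'i). \<delta> > 0 \<and> holo_fun_on c (ball 0 \<delta>) \<and> c 0 = 0 \<and>
    (\<forall>i. holo_fun_on (\<lambda>z. F' z $ i) (ball 0 \<delta>)) \<and> (\<forall>z\<in>ball 0 \<delta>. F z = c z *s F' z)"
proof -
  let ?U = "ball (0 :: complex^'n) r"
  define f where "f z = F z $ i0" for z
  have f: "holo_fun_on f ?U" unfolding f_def by (rule F)
  have "\<forall>k :: nat. \<exists>p g V. norm p < 1 / Suc k \<and> p \<in> V \<and> holo_fun_on g V \<and> g p = 0 \<and>
      (\<forall>z\<in>V. g z = 0 \<longrightarrow> F z = 0) \<and> (\<exists>i. cpartial i g p \<noteq> 0)"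
  proof
    fix k
    show "\<exists>p g V. norm p < 1 / Suc k \<and> p \<in> V \<and> holo_fun_on g V \<and> g p = 0 \<and>
      (\<forall>z\<in>V. g z = 0 \<longrightarrow> F z = 0) \<and> (\<exists>i. cpartial i g p \<noteq> 0)"
      by (rule smooth_hypersurface_in_zero_set[OF F convex_ball _ nz cod, of "1 / Suc k"])
         (use r in \<open>auto\<close>)
  qed
  then obtain p g V where pgV: "\<And>k :: nat. norm (p k) < 1 / Suc k" "\<And>k. p k \<in> V k" "\<And>k. holo_fun_on (g k) (V k)"
      "\<And>k. g k (p k) = 0" "\<And>k z. z \<in> V k \<Longrightarrow> g k z = 0 \<Longrightarrow> F z = 0" "\<And>k. \<exists>i. cpartial i (g k) (p k) \<noteq> 0"
    by metis
  have "open {z\<in>?U. f z \<noteq> 0}" "{z\<in>?U. f z \<noteq> 0} \<noteq> {}"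
    using open_nonzero[OF holo_fun_on_continuous_on[OF f]] nz by (auto simp: f_def)
  \<comment> \<open>one direction has to serve hypersurfaces arbitrarily close to \<open>0\<close>, because the size of the
    neighbourhood \<open>D\<close> below depends on it\<close>
  from generic_direction[of g V p, OF pgV(3,2,6) this]
  obtain v where v: "v \<in> ?U" "f v \<noteq> 0" "\<And>k. dir_deriv v (g k) (p k) \<noteq> 0" by blast
  have small: "\<exists>k. norm (p k) < \<epsilon>" if "\<epsilon> > 0" for \<epsilon>
    using reals_Archimedean[OF that] pgV(1) by (metis inverse_eq_divide less_trans)
  have f0: "f 0 = 0"
  proof (rule ccontr)
    assume "f 0 \<noteq> 0"
    then have "0 \<in> {z\<in>?U. f z \<noteq> 0}" using r by simp
    with \<open>open {z\<in>?U. f z \<noteq> 0}\<close> obtain \<epsilon> where "\<epsilon> > 0" "ball 0 \<epsilon> \<subseteq> {z\<in>?U. f z \<noteq> 0}"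
      by (meson openE)
    moreover from small[OF this(1)] obtain k where "norm (p k) < \<epsilon>" by blast
    ultimately have "f (p k) \<noteq> 0" by auto
    then show False using pgV(5)[OF pgV(2,4), of k] by (simp add: f_def)
  qed
  let ?T = "{t. 0 + t *s v \<in> ?U}"
  have T: "open ?T" "connected ?T"
    using open_line_preimage[OF open_ball] convex_connected[OF convex_line_preimage[OF convex_ball]] by blast+
  have T01: "0 \<in> ?T" "1 \<in> ?T" using r v(1) by simp_all
  have hol: "(\<lambda>t. f (0 + t *s v)) holomorphic_on ?T" by (rule holo_fun_on_line[OF f]) auto
  obtain \<rho> where \<rho>: "\<rho> > 0" "ball 0 \<rho> \<subseteq> ?T" "\<And>t. t \<in> ball 0 \<rho> - {0} \<Longrightarrow> f (0 + t *s v) \<noteq> 0"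
    using isolated_zeros[OF hol T T01(1) _ T01(2)] f0 v(2) by auto
  define e where "e = min (1 / 3) (\<rho> / 4)"
  have e: "e > 0" "3 * e < \<rho>" "3 * e \<le> 1" using \<rho>(1) by (auto simp: e_def)
  have fv: "f (t *s v) \<noteq> 0" if "t \<noteq> 0" "norm t \<le> 3 * e" for t
    using \<rho>(3)[of t] that e by auto
  have tU: "t *s v \<in> ?U" if "norm t \<le> 3 * e" for t
  proof -
    have "t \<in> ball 0 \<rho>" using that e by simp
    with \<rho>(2) have "t \<in> ?T" by blast
    then show ?thesis by simp
  qed
  have "\<exists>\<delta>>0. \<forall>q\<in>ball 0 \<delta>. \<forall>t\<in>cball 0 (3 * e). (q, t) \<in> {(q, t). q + t *s v \<in> ?U}"
    by (rule tube_ball[OF compact_cball open_shear_preimage[OF open_ball]]) (use tU in auto)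
  then obtain \<delta>1 where \<delta>1: "\<delta>1 > 0"
    "\<And>q t. q \<in> ball 0 \<delta>1 \<Longrightarrow> t \<in> cball 0 (3 * e) \<Longrightarrow> q + t *s v \<in> ?U" by blast
  have "\<exists>\<delta>>0. \<forall>q\<in>ball 0 \<delta>. \<forall>t\<in>cball 0 (3 * e) - ball 0 e. (q, t) \<in> {(q, t). q + t *s v \<in> ?U \<and> f (q + t *s v) \<noteq> 0}"
  proof (rule tube_ball[OF _ open_shear_nonzero[OF f]])
    show "compact (cball 0 (3 * e) - ball 0 e :: complex set)" by (intro compact_diff) auto
    fix t :: complex assume t: "t \<in> cball 0 (3 * e) - ball 0 e"
    then have "t \<noteq> 0" using e(1) by auto
    with t show "(0, t) \<in> {(q, t). q + t *s v \<in> ?U \<and> f (q + t *s v) \<noteq> 0}"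
      using tU[of t] fv[of t] by auto
  qed
  then obtain \<delta>2 where \<delta>2: "\<delta>2 > 0"
    "\<And>q t. q \<in> ball 0 \<delta>2 \<Longrightarrow> t \<in> cball 0 (3 * e) - ball 0 e \<Longrightarrow> f (q + t *s v) \<noteq> 0" by blast
  define \<delta> where "\<delta> = min \<delta>1 \<delta>2"
  define D where "D = ball (0 :: complex^'n) \<delta>"
  have D: "open D" "convex D" "connected D" "0 \<in> D" using \<delta>1 \<delta>2 by (auto simp: D_def \<delta>_def)
  have dom: "z + t *s v \<in> ?U" if "z \<in> D" "norm t < 3 * e" for z t
    using \<delta>1(2)[of z t] that by (auto simp: D_def \<delta>_def)
  have annulus: "f (z + t *s v) \<noteq> 0" if "z \<in> D" "e \<le> norm t" "norm t < 3 * e" for z t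
    using \<delta>2(2)[of z t] that by (auto simp: D_def \<delta>_def)
  have "\<exists>d w. (\<forall>k<d. holo_fun_on (w k) D) \<and>
    (\<forall>z\<in>D. \<forall>t. t ^ d + (\<Sum>k<d. w k z * t ^ k) = 0 \<longleftrightarrow> norm t < 3 * e \<and> f (z + t *s v) = 0)"
    by (rule weierstrass_polynomial[OF f D(1,3) e(1) dom annulus])
  then obtain d w where dw: "\<forall>k<d. holo_fun_on (w k) D"
    "\<forall>z\<in>D. \<forall>t. t ^ d + (\<Sum>k<d. w k z * t ^ k) = 0 \<longleftrightarrow> norm t < 3 * e \<and> f (z + t *s v) = 0"
    by (elim exE conjE) (rule that)
  have w: "holo_fun_on (w k) D" if "k < d" for k using dw(1) that by simp
  have W: "t ^ d + (\<Sum>k<d. w k z * t ^ k) = 0 \<longleftrightarrow> norm t < 3 * e \<and> f (z + t *s v) = 0" if "z \<in> D" for z t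
    using bspec[OF dw(2) that] by (rule spec)
  \<comment> \<open>an open set of parameters over which the components of \<open>F\<close> have a common zero: the lines through
    nearby points still meet the hypersurface \<open>g k = 0\<close>, which is transverse to \<open>v\<close>\<close>
  obtain B where B: "open B" "B \<noteq> {}" "B \<subseteq> D" "\<And>z. z \<in> B \<Longrightarrow> \<exists>t. norm t < e \<and> F (z + t *s v) = 0"
  proof -
    have "\<delta> > 0" using \<delta>1 \<delta>2 by (simp add: \<delta>_def)
    from small[OF this] obtain k where k: "norm (p k) < \<delta>" by blast
    have pk: "p k + 0 *s v \<in> V k" using pgV(2) by simp
    have oV: "open (V k)" using holo_fun_on_open[OF pgV(3)] .
    have "((\<lambda>t. (g k (p k + t *s v) - g k (p k + 0 *s v)) / (t - 0)) \<longlongrightarrow> dir_deriv v (g k) (p k + 0 *s v)) (at 0)"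
      using dir_deriv_has_field_derivative[OF pgV(3) pk] unfolding has_field_derivative_iff by simp
    then have "\<forall>\<^sub>F t in at 0. (g k (p k + t *s v) - g k (p k + 0 *s v)) / (t - 0) \<noteq> 0"
      by (rule tendsto_imp_eventually_ne) (use v(3) in simp)
    then obtain \<epsilon>1 where \<epsilon>1: "\<epsilon>1 > 0" "\<And>t. t \<noteq> 0 \<Longrightarrow> norm t < \<epsilon>1 \<Longrightarrow> g k (p k + t *s v) \<noteq> 0"
      using pgV(4) unfolding eventually_at by (auto simp: dist_norm)
    obtain r' \<epsilon>2 where \<epsilon>2: "r' > 0" "\<epsilon>2 > 0" "\<And>z t. z \<in> ball (p k) r' \<Longrightarrow> norm t \<le> \<epsilon>2 \<Longrightarrow> z + t *s v \<in> V k"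
      using line_stays_near[OF oV pgV(2), of v] by metis
    define \<epsilon> where "\<epsilon> = min e (min (\<epsilon>1 / 2) \<epsilon>2)"
    have \<epsilon>: "\<epsilon> > 0" "\<epsilon> \<le> e" "\<epsilon> < \<epsilon>1" "\<epsilon> \<le> \<epsilon>2" using e(1) \<epsilon>1(1) \<epsilon>2(2) by (auto simp: \<epsilon>_def)
    obtain \<delta>' where \<delta>': "\<delta>' > 0"
      "\<And>q. q \<in> ball (p k) \<delta>' \<Longrightarrow> \<exists>t. norm t < \<epsilon> \<and> q + t *s v \<in> V k \<and> g k (q + t *s v) = 0"
    proof (rule zero_persists[OF pgV(3,4) \<epsilon>(1), of k v])
      fix t :: complex
      show "p k + t *s v \<in> V k" if "norm t \<le> \<epsilon>" using \<epsilon>2(1,3) that \<epsilon>(4) by auto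
      show "g k (p k + t *s v) \<noteq> 0" if "norm t = \<epsilon>" using \<epsilon>1(2)[of t] that \<epsilon> by auto
    qed blast
    show ?thesis
    proof (rule that)
      show "open (ball (p k) \<delta>' \<inter> D)" using D(1) by blast
      have "p k \<in> ball (p k) \<delta>' \<inter> D" using \<delta>'(1) k by (simp add: D_def)
      then show "ball (p k) \<delta>' \<inter> D \<noteq> {}" by blast
      fix z assume "z \<in> ball (p k) \<delta>' \<inter> D"
      with \<delta>'(2) obtain t where t: "norm t < \<epsilon>" "z + t *s v \<in> V k" "g k (z + t *s v) = 0" by blast
      have "F (z + t *s v) = 0" using pgV(5) t(2,3) .
      with t(1) \<epsilon>(2) show "\<exists>t. norm t < e \<and> F (z + t *s v) = 0" by (intro exI[of _ t]) simp
    qed auto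
  qed
  define S where "S = {(z, t). z \<in> B \<and> norm t < e \<and> F (z + t *s v) = 0}"
  have SD: "z \<in> D" if "(z, t) \<in> S" for z t using that B(3) by (auto simp: S_def)
  have "\<exists>m h. m \<ge> 1 \<and> (\<forall>k<m. holo_fun_on (h k) D) \<and>
    (\<forall>z\<in>D. \<forall>t. norm t \<ge> e \<longrightarrow> norm (t ^ m + (\<Sum>k<m. h k z * t ^ k)) \<ge> (norm t - e) ^ m) \<and>
    generic_zero D S (\<lambda>z t. t ^ m + (\<Sum>k<m. h k z * t ^ k)) \<and>
    (\<forall>r. (\<forall>k<m. holo_fun_on (r k) D) \<longrightarrow> generic_zero D S (\<lambda>z t. \<Sum>k<m. r k z * t ^ k) \<longrightarrow>
      (\<forall>k<m. \<forall>z\<in>D. r k z = 0))"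
  proof (rule minimal_polynomial[OF D(1,2) SD B(1,2) _ w])
    fix z t
    show "\<exists>t. (z, t) \<in> S" if "z \<in> B" using B(4)[OF that] that by (auto simp: S_def)
    show "t ^ d + (\<Sum>k<d. w k z * t ^ k) = 0" if "(z, t) \<in> S"
      using W[OF SD[OF that], of t] that e(1) by (auto simp: S_def f_def)
    show "norm t \<le> e" if "z \<in> D" "t ^ d + (\<Sum>k<d. w k z * t ^ k) = 0"
      using W[OF that(1), of t] that(2) annulus[OF that(1), of t] by force
    show "e \<le> 1" using e by simp
  qed auto
  then obtain m h where mh: "m \<ge> 1" "\<forall>k<m. holo_fun_on (h k) D"
    "\<forall>z\<in>D. \<forall>t. norm t \<ge> e \<longrightarrow> norm (t ^ m + (\<Sum>k<m. h k z * t ^ k)) \<ge> (norm t - e) ^ m"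
    "generic_zero D S (\<lambda>z t. t ^ m + (\<Sum>k<m. h k z * t ^ k))"
    "\<forall>r. (\<forall>k<m. holo_fun_on (r k) D) \<longrightarrow> generic_zero D S (\<lambda>z t. \<Sum>k<m. r k z * t ^ k) \<longrightarrow>
       (\<forall>k<m. \<forall>z\<in>D. r k z = 0)"
    by (elim exE conjE) (rule that)
  define h' where "h' z k = (if k < m then h k z else 1)" for z k
  define H where "H z t = (\<Sum>k\<le>m. h' z k * t ^ k)" for z t
  have H_eq: "H z t = t ^ m + (\<Sum>k<m. h k z * t ^ k)" for z t
    by (simp add: H_def h'_def lessThan_Suc_atMost[symmetric])
  have h': "holo_fun_on (\<lambda>z. h' z k) D" for k
    using mh(2) by (cases "k < m") (auto simp: h'_def intro: holo_fun_on_const D(1))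
  have Hnz: "H z s \<noteq> 0" if "z \<in> D" "norm s > e" for z s
  proof -
    have "(norm s - e) ^ m > 0" using that(2) by simp
    moreover have "norm (H z s) \<ge> (norm s - e) ^ m"
      using mh(3) that unfolding H_eq by (meson less_imp_le)
    ultimately show ?thesis by auto
  qed
  have Hhol: "holo_fun_on (\<lambda>z. H z s) D" for s
    unfolding H_def by (intro holo_fun_on_sum holo_fun_on_mult holo_fun_on_const h' D(1))
  have Hcont: "continuous_on (D \<times> A) (\<lambda>x. H (fst x) (snd x))" for A
    unfolding H_def
    by (intro continuous_intros continuous_on_compose2[OF holo_fun_on_continuous_on[OF h']]) auto
  let ?C = "circlepath 0 (2 * e)"
  define q where "q i z t = contour_integral ?C (\<lambda>s. F (z + s *s v) $ i / (H z s * (s - t))) / (2 * of_real pi * \<i>)" for i z t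
  define R where "R i j z = contour_integral ?C (\<lambda>s. F (z + s *s v) $ i / H z s *
      (\<Sum>k | k \<le> m \<and> j < k. h' z k * s ^ (k - Suc j))) / (2 * of_real pi * \<i>)" for i j z
  have circ: "s \<in> sphere 0 (2 * e) \<Longrightarrow> e < norm s \<and> norm s < 3 * e" for s :: complex using e by simp
  have Fcont: "continuous_on (D \<times> sphere 0 (2 * e)) (\<lambda>x. F (fst x + snd x *s v) $ i)" for i
    by (intro continuous_intros continuous_on_compose2[OF holo_fun_on_continuous_on[OF F]])
       (use dom circ in \<open>auto simp del: mem_sphere mem_ball\<close>)
  have q0: "holo_fun_on (\<lambda>z. q i z 0) D" for i
  proof -
    have "holo_fun_on (\<lambda>z. contour_integral ?C (\<lambda>s. F (z + s *s v) $ i / (H z s * (s - 0)))) D"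
    proof (rule holo_fun_on_circle_integral)
      have "continuous_on (D \<times> sphere 0 (2 * e)) (\<lambda>x. F (fst x + snd x *s v) $ i / (H (fst x) (snd x) * (snd x - 0)))"
        by (intro continuous_intros Fcont Hcont) (use Hnz circ e(1) in \<open>force simp del: mem_sphere\<close>)
      then show "continuous_on (D \<times> sphere 0 (2 * e)) (\<lambda>(z, s). F (z + s *s v) $ i / (H z s * (s - 0)))"
        by (simp add: case_prod_beta')
      fix s :: complex assume s: "norm s = 2 * e"
      show "holo_fun_on (\<lambda>z. F (z + s *s v) $ i / (H z s * (s - 0))) D"
        by (intro holo_fun_on_divide holo_fun_on_mult holo_fun_on_const D(1) holo_fun_on_shift[OF F] Hhol)
           (use dom Hnz s e(1) in auto)
    qed (use D e in auto)
    then show ?thesis unfolding q_def by (intro holo_fun_on_divide holo_fun_on_const D(1)) auto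
  qed
  have Rhol: "holo_fun_on (R i j) D" for i j
  proof -
    have "holo_fun_on (\<lambda>z. contour_integral ?C (\<lambda>s. F (z + s *s v) $ i / H z s *
        (\<Sum>k | k \<le> m \<and> j < k. h' z k * s ^ (k - Suc j)))) D"
    proof (rule holo_fun_on_circle_integral)
      have "continuous_on (D \<times> sphere 0 (2 * e)) (\<lambda>x. F (fst x + snd x *s v) $ i / H (fst x) (snd x) *
          (\<Sum>k | k \<le> m \<and> j < k. h' (fst x) k * snd x ^ (k - Suc j)))"
        by (intro continuous_intros Fcont Hcont continuous_on_compose2[OF holo_fun_on_continuous_on[OF h']])
           (use Hnz circ in \<open>auto simp del: mem_sphere\<close>)
      then show "continuous_on (D \<times> sphere 0 (2 * e)) (\<lambda>(z, s). F (z + s *s v) $ i / H z s *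
          (\<Sum>k | k \<le> m \<and> j < k. h' z k * s ^ (k - Suc j)))"
        by (simp add: case_prod_beta')
      fix s :: complex assume s: "norm s = 2 * e"
      show "holo_fun_on (\<lambda>z. F (z + s *s v) $ i / H z s * (\<Sum>k | k \<le> m \<and> j < k. h' z k * s ^ (k - Suc j))) D"
        by (intro holo_fun_on_divide holo_fun_on_mult holo_fun_on_const holo_fun_on_sum D(1)
            holo_fun_on_shift[OF F] Hhol h') (use dom Hnz s e(1) in auto)
    qed (use D e in auto)
    then show ?thesis unfolding R_def by (intro holo_fun_on_divide holo_fun_on_const D(1)) auto
  qed
  have division: "F (z + t *s v) $ i = H z t * q i z t + (\<Sum>j<m. R i j z * t ^ j)"
    if z: "z \<in> D" and t: "norm t < 2 * e" for i z t
  proof -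
    have hol: "(\<lambda>s. F (z + s *s v) $ i) holomorphic_on cball 0 (2 * e)"
      by (rule holo_fun_on_line[OF F]) (use dom[OF z] e(1) in auto)
    have nz: "(\<Sum>k\<le>m. h' z k * s ^ k) \<noteq> 0" if "norm s = 2 * e" for s
      using Hnz[OF z, of s] that e(1) by (simp add: H_def)
    have q: "contour_integral ?C (\<lambda>s. F (z + s *s v) $ i / (H z s * (s - t))) = 2 * of_real pi * \<i> * q i z t"
      by (simp add: q_def)
    have R: "contour_integral ?C (\<lambda>s. F (z + s *s v) $ i / H z s *
      (\<Sum>k | k \<le> m \<and> j < k. h' z k * s ^ (k - Suc j))) = 2 * of_real pi * \<i> * R i j z" for j
      by (simp add: R_def)
    have "2 * of_real pi * \<i> * F (z + t *s v) $ i =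
      H z t * (2 * of_real pi * \<i> * q i z t) + (\<Sum>j<m. 2 * of_real pi * \<i> * R i j z * t ^ j)"
      using cauchy_division[OF hol nz t] unfolding H_def[symmetric] q R .
    also have "\<dots> = 2 * of_real pi * \<i> * (H z t * q i z t + (\<Sum>j<m. R i j z * t ^ j))"
      by (simp add: distrib_left sum_distrib_left mult_ac)
    finally have "2 * of_real pi * \<i> * F (z + t *s v) $ i =
      2 * of_real pi * \<i> * (H z t * q i z t + (\<Sum>j<m. R i j z * t ^ j))" .
    then show ?thesis by simp
  qed
  have gz: "generic_zero D S (\<lambda>z t. \<Sum>j<m. R i j z * t ^ j)" for i
  proof -
    obtain a where a: "holo_fun_on a D" "\<exists>z\<in>D. a z \<noteq> 0" "\<And>z t. (z, t) \<in> S \<Longrightarrow> a z * H z t = 0"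
      using mh(4) unfolding generic_zero_def H_eq by blast
    show ?thesis unfolding generic_zero_def
    proof (intro exI[of _ a] conjI a ballI, clarify)
      fix z t assume st: "(z, t) \<in> S"
      then have "F (z + t *s v) $ i = 0" "norm t < 2 * e" using e(1) by (auto simp: S_def)
      with division[OF SD[OF st], of t i] have "(\<Sum>j<m. R i j z * t ^ j) = - (H z t * q i z t)"
        by (simp add: eq_neg_iff_add_eq_0 add.commute)
      then show "a z * (\<Sum>j<m. R i j z * t ^ j) = 0" using a(3)[OF st] by auto
    qed
  qed
  have R0: "R i j z = 0" if "j < m" "z \<in> D" for i j z
    using spec[OF mh(5), of "R i"] Rhol[of i] gz[of i] that by simp
  have factor: "F (z + t *s v) $ i = H z t * q i z t" if "z \<in> D" "norm t < 2 * e" for i z t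
    using division[OF that] R0 that(1) by simp
  have "H 0 0 = 0"
  proof -
    obtain t where t: "H 0 t = 0"
      using alg_closed[of m "h' 0"] mh(1) unfolding H_def by (auto simp: h'_def)
    then have te: "norm t \<le> e" using Hnz[OF D(4), of t] by force
    then have "f (t *s v) = 0" using factor[OF D(4), of t i0] t e(1) by (simp add: f_def)
    then have "t = 0" using fv[of t] te e(1) by force
    with t show ?thesis by simp
  qed
  show ?thesis
  proof (intro exI[of _ \<delta>] exI[of _ "\<lambda>z. H z 0"] exI[of _ "\<lambda>z. \<chi> i. q i z 0"] conjI ballI)
    show "\<delta> > 0" using \<delta>1 \<delta>2 by (simp add: \<delta>_def)
    fix z :: "complex^'n" assume "z \<in> ball 0 \<delta>"
    then show "F z = H z 0 *s (\<chi> i. q i z 0)"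
      using factor[of z 0] e(1) by (simp add: vec_eq_iff D_def)
  qed (use Hhol q0 \<open>H 0 0 = 0\<close> in \<open>simp_all add: D_def\<close>)
qed

section \<open>Germs\<close>

lemma eventually_nhds_0_ball:
  fixes P :: "'a::real_normed_vector \<Rightarrow> bool"
  assumes "\<forall>\<^sub>F z in nhds 0. P z"
  shows "\<forall>\<^sub>F r in at_right 0. \<forall>z\<in>ball 0 r. P z"
proof -
  obtain d where "d > 0" "\<And>z. dist z 0 < d \<Longrightarrow> P z" using assms unfolding eventually_nhds_metric by blast
  then show ?thesis
    unfolding eventually_at_right_field by (intro exI[of _ d]) (auto simp: dist_norm)
qed

lemma eventually_ball_nhds_0:
  fixes P :: "'a::real_normed_vector \<Rightarrow> bool"
  assumes "r > 0" "\<And>z. z \<in> ball 0 r \<Longrightarrow> P z"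
  shows "\<forall>\<^sub>F z in nhds 0. P z"
  unfolding eventually_nhds_metric using assms by (intro exI[of _ r]) (auto simp: dist_norm)

text \<open>Properties of germs are collected as properties of all small radii, so that finitely many of them
  hold on one ball.\<close>
lemma eventually_radius:
  fixes r0 :: real
  assumes "\<forall>\<^sub>F r in at_right 0. P r" "0 < r0"
  obtains r where "0 < r" "r \<le> r0" "P r"
proof -
  obtain b where b: "b > 0" "\<And>y. 0 < y \<Longrightarrow> y < b \<Longrightarrow> P y"
    using assms(1) unfolding eventually_at_right_field by blast
  show ?thesis by (rule that[of "min (b / 2) r0"]) (use b assms(2) in auto)
qed

lemma holo_fun_germ_ball: "holo_fun_germ f \<Longrightarrow> \<forall>\<^sub>F r in at_right 0. holo_fun_on f (ball 0 r)"
proof -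
  assume "holo_fun_germ f"
  then obtain U where U: "0 \<in> U" "holo_fun_on f U" by (auto simp: holo_fun_germ_def)
  then have "\<forall>\<^sub>F z in nhds 0. z \<in> U" using holo_fun_on_open eventually_nhds_in_open by blast
  from eventually_nhds_0_ball[OF this] show ?thesis
    by eventually_elim (rule holo_fun_on_subset[OF U(2)], auto)
qed

lemma holo_germ_ball:
  assumes "holo_germ F"
  shows "\<forall>\<^sub>F r in at_right 0. \<forall>i. holo_fun_on (\<lambda>z. F z $ i) (ball 0 r)"
proof -
  have "\<forall>i. \<forall>\<^sub>F r in at_right 0. holo_fun_on (\<lambda>z. F z $ i) (ball 0 r)"
    using assms by (intro allI holo_fun_germ_ball) (auto simp: holo_germ_def holo_on_def holo_fun_germ_def)
  then show ?thesis by (intro eventually_all_finite) auto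
qed

lemma holo_fun_germI: "r > 0 \<Longrightarrow> holo_fun_on f (ball 0 r) \<Longrightarrow> holo_fun_germ f"
  unfolding holo_fun_germ_def by (intro exI[of _ "ball 0 r"]) auto

lemma holo_germI: "r > 0 \<Longrightarrow> (\<And>i. holo_fun_on (\<lambda>z. F z $ i) (ball 0 r)) \<Longrightarrow> holo_germ F"
  unfolding holo_germ_def holo_on_def by (intro exI[of _ "ball 0 r"]) auto

lemma not_zero_germ_scalar:
  assumes "holo_fun_on f (ball 0 r)" "z \<in> ball 0 r" "f z \<noteq> 0"
  shows "\<not> zero_germ f"
proof
  assume "zero_germ f"
  then have "\<forall>\<^sub>F z in nhds 0. f z = 0" by (simp add: zero_germ_def)
  moreover have "(0 :: complex^'a) \<in> ball 0 r" using assms(2) le_less_trans[OF norm_ge_zero[of z], of r] by simp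
  ultimately show False using identity_theorem[OF assms(1) convex_ball _ _ assms(2)] assms(3) by blast
qed

lemma nonzero_in_ball:
  fixes f :: "complex^'n \<Rightarrow> 'b::zero"
  assumes "\<not> zero_germ f" "r > 0"
  shows "\<exists>z\<in>ball 0 r. f z \<noteq> 0"
  using assms(1) eventually_ball_nhds_0[OF assms(2), of "\<lambda>z. f z = 0"] unfolding zero_germ_def by blast

lemma zero_germ_component:
  assumes "\<not> zero_germ F"
  shows "\<exists>i. \<not> zero_germ (\<lambda>z. F z $ i)"
proof (rule ccontr)
  assume "\<not> ?thesis"
  then have "\<forall>i. \<forall>\<^sub>F z in nhds 0. F z $ i = 0" by (simp add: zero_germ_def)
  then have "\<forall>\<^sub>F z in nhds 0. \<forall>i. F z $ i = 0" by (intro eventually_all_finite) auto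
  then have "zero_germ F" unfolding zero_germ_def by eventually_elim (simp add: vec_eq_iff)
  with assms show False by simp
qed

lemma eventually_line:
  fixes v :: "complex^'n"
  assumes "\<forall>\<^sub>F z in nhds 0. P z"
  shows "\<forall>\<^sub>F t in nhds 0. P (t *s v)"
proof -
  have "((\<lambda>t. t *s v) \<longlongrightarrow> 0 *s v) (nhds 0)" by (intro tendsto_intros filterlim_ident)
  then have "filterlim (\<lambda>t. t *s v) (nhds 0) (nhds 0)" by simp
  from eventually_compose_filterlim[OF assms this] show ?thesis .
qed

lemma analytic_line:
  assumes "holo_fun_on f (ball 0 r)" "r > 0"
  shows "(\<lambda>t. f (t *s v)) analytic_on {0}"
proof -
  have "open {t. 0 + t *s v \<in> ball 0 r}" by (rule open_line_preimage) simp
  moreover have "(\<lambda>t. f (0 + t *s v)) holomorphic_on {t. 0 + t *s v \<in> ball 0 r}"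
    by (rule holo_fun_on_line[OF assms(1)]) auto
  ultimately show ?thesis
    using assms(2) by (auto simp: analytic_at intro!: exI[of _ "{t. 0 + t *s v \<in> ball 0 r}"])
qed

section \<open>Existence of saturations\<close>

text \<open>As long as the zero set contains hypersurfaces, a common factor that vanishes at \<open>0\<close> is split
  off; each time the order of \<open>F $ i0\<close> at \<open>0\<close> along the line spanned by \<open>v\<close> drops.\<close>
lemma saturation_exists_aux:
  fixes F :: "complex^'n \<Rightarrow> complex^'i"
  assumes "r > 0" "\<And>i. holo_fun_on (\<lambda>z. F z $ i) (ball 0 r)"
    and "\<forall>\<^sub>F t in at 0. F (t *s v) $ i0 \<noteq> 0"
  shows "\<exists>\<gamma>. saturation F \<gamma>"
  using assms
proof (induction "nat (zorder (\<lambda>t. F (t *s v) $ i0) 0)" arbitrary: F r rule: less_induct)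
  case (less F r)
  note r = less.prems(1) and F = less.prems(2) and nz = less.prems(3)
  have "\<forall>\<^sub>F z in nhds 0. z \<in> ball (0 :: complex^'n) r" using r by (intro eventually_nhds_in_open) auto
  from eventually_line[OF this, of v] have "\<forall>\<^sub>F t in at 0. t *s v \<in> ball (0 :: complex^'n) r"
    by (rule eventually_nhds_conv_at[THEN iffD1, THEN conjunct1])
  with nz have "\<forall>\<^sub>F t in at 0. t *s v \<in> ball 0 r \<and> F (t *s v) $ i0 \<noteq> 0" by eventually_elim auto
  then obtain t0 where t0: "t0 *s v \<in> ball 0 r" "F (t0 *s v) $ i0 \<noteq> 0"
    using eventually_happens'[of "at (0 :: complex)"] by force
  show ?case
  proof (cases "codim_ge 2 (zero_set F)")
    case True
    have "saturation F F" unfolding saturation_def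
    proof (intro conjI exI[of _ "\<lambda>_. 1"])
      show "holo_fun_germ (\<lambda>_ :: complex^'n. 1)" by (rule holo_fun_germI[OF r]) (auto intro: holo_fun_on_const)
      show "\<not> zero_germ (\<lambda>_ :: complex^'n. 1 :: complex)" by (simp add: zero_germ_def)
    qed (use True holo_germI[OF r F] in auto)
    then show ?thesis by blast
  next
    case False
    obtain \<delta> c and F' :: "complex^'n \<Rightarrow> complex^'i" where "\<delta> > 0 \<and> holo_fun_on c (ball 0 \<delta>) \<and> c 0 = 0 \<and>
      (\<forall>i. holo_fun_on (\<lambda>z. F' z $ i) (ball 0 \<delta>)) \<and> (\<forall>z\<in>ball 0 \<delta>. F z = c z *s F' z)"
      using common_factor[OF F r t0 False] by (elim exE) (rule that)
    then have cF: "\<delta> > 0" "holo_fun_on c (ball 0 \<delta>)" "c 0 = 0"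
      "\<And>i. holo_fun_on (\<lambda>z. F' z $ i) (ball 0 \<delta>)" "\<And>z. z \<in> ball 0 \<delta> \<Longrightarrow> F z = c z *s F' z"
      by simp_all
    define f where "f t = F (t *s v) $ i0" for t
    define c1 where "c1 t = c (t *s v)" for t
    define f1 where "f1 t = F' (t *s v) $ i0" for t
    have Feq: "\<forall>\<^sub>F z in nhds 0. F z = c z *s F' z"
      by (rule eventually_ball_nhds_0[OF cF(1) cF(5)])
    from eventually_line[OF this, of v] have eq: "\<forall>\<^sub>F t in nhds 0. f t = c1 t * f1 t"
      by eventually_elim (simp add: f_def c1_def f1_def)
    then have eq': "\<forall>\<^sub>F t in at 0. f t = c1 t * f1 t" by (simp add: eventually_nhds_conv_at)
    have fnz: "\<forall>\<^sub>F t in at 0. f t \<noteq> 0" using nz by (simp add: f_def)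
    have pnz: "\<forall>\<^sub>F t in at 0. c1 t * f1 t \<noteq> 0" using eq' fnz by eventually_elim simp
    then have cnz: "\<forall>\<^sub>F t in at 0. c1 t \<noteq> 0" by eventually_elim simp
    from pnz have f1nz: "\<forall>\<^sub>F t in at 0. f1 t \<noteq> 0" by eventually_elim simp
    have an: "c1 analytic_on {0}" "f1 analytic_on {0}"
      unfolding c1_def f1_def using analytic_line[OF cF(2,1)] analytic_line[OF cF(4,1)] by auto
    have "zorder f 0 = zorder (\<lambda>t. c1 t * f1 t) 0" by (rule zorder_cong[OF eq' refl])
    also have "\<dots> = zorder c1 0 + zorder f1 0" by (rule zorder_times_analytic[OF an pnz])
    finally have z1: "zorder f 0 = zorder c1 0 + zorder f1 0" .
    have "c1 0 = 0" using cF(3) by (simp add: c1_def)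
    then have z2: "zorder c1 0 > 0"
      using zorder_pos_iff'[OF an(1) eventually_frequently[OF _ cnz]] by simp
    have z3: "zorder f1 0 \<ge> 0"
      by (rule zorder_ge_0[OF an(2) eventually_frequently[OF _ f1nz]]) simp
    have "nat (zorder (\<lambda>t. F' (t *s v) $ i0) 0) < nat (zorder (\<lambda>t. F (t *s v) $ i0) 0)"
      using z1 z2 z3 unfolding f_def f1_def by linarith
    from less.hyps[OF this cF(1,4)] f1nz obtain \<gamma> where "saturation F' \<gamma>" by (auto simp: f1_def)
    then obtain h where \<gamma>: "holo_germ \<gamma>" "codim_ge 2 (zero_set \<gamma>)" "holo_fun_germ h"
      "\<forall>\<^sub>F z in nhds 0. F' z = h z *s \<gamma> z" unfolding saturation_def by blast
    have eq2: "\<forall>\<^sub>F z in nhds 0. F z = (c z * h z) *s \<gamma> z"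
      using Feq \<gamma>(4) by eventually_elim (simp add: vec_eq_iff)
    have "holo_fun_germ (\<lambda>z. c z * h z)"
    proof -
      obtain s where s: "0 < s" "s \<le> \<delta>" "holo_fun_on h (ball 0 s)"
        by (rule eventually_radius[OF holo_fun_germ_ball[OF \<gamma>(3)] cF(1)])
      show ?thesis
        by (intro holo_fun_germI[OF s(1)] holo_fun_on_mult s(3) holo_fun_on_subset[OF cF(2) open_ball subset_ball] s(2))
    qed
    moreover have "\<not> zero_germ (\<lambda>z. c z * h z)"
    proof
      assume "zero_germ (\<lambda>z. c z * h z)"
      then have "\<forall>\<^sub>F z in nhds 0. F z $ i0 = 0"
        using eq2 unfolding zero_germ_def by eventually_elim simp
      from eventually_line[OF this, of v] have "\<forall>\<^sub>F t in at 0. f t = 0"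
        by (simp add: f_def eventually_nhds_conv_at)
      with fnz have "\<forall>\<^sub>F t in at (0 :: complex). False" by eventually_elim simp
      then show False by simp
    qed
    ultimately have "saturation F \<gamma>" unfolding saturation_def using \<gamma> eq2 by blast
    then show ?thesis by blast
  qed
qed

lemma saturation_exists:
  fixes F :: "complex^'n \<Rightarrow> complex^'i"
  assumes "holo_germ F" "\<not> zero_germ F"
  shows "\<exists>\<gamma>. saturation F \<gamma>"
proof -
  obtain r where "0 < r" "\<forall>i. holo_fun_on (\<lambda>z. F z $ i) (ball 0 r)"
    by (rule eventually_radius[OF holo_germ_ball[OF assms(1)] zero_less_one]) (rule that)
  then have r: "r > 0" "\<And>i. holo_fun_on (\<lambda>z. F z $ i) (ball 0 r)" by blast+
  obtain i0 where "\<not> zero_germ (\<lambda>z. F z $ i0)" using zero_germ_component[OF assms(2)] by blast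
  from nonzero_in_ball[OF this r(1)] obtain v where v: "v \<in> ball 0 r" "F v $ i0 \<noteq> 0" by blast
  let ?T = "{t. 0 + t *s v \<in> ball 0 r}"
  have T: "open ?T" "connected ?T"
    using open_line_preimage[OF open_ball] convex_connected[OF convex_line_preimage[OF convex_ball]] by blast+
  have T01: "0 \<in> ?T" "1 \<in> ?T" using r v by simp_all
  have hol: "(\<lambda>t. F (0 + t *s v) $ i0) holomorphic_on ?T" by (rule holo_fun_on_line[OF r(2)]) auto
  have "\<forall>\<^sub>F t in at 0. F (t *s v) $ i0 \<noteq> 0"
  proof (cases "F 0 $ i0 = 0")
    case True
    obtain \<rho> where "\<rho> > 0" "\<And>t. t \<in> ball 0 \<rho> - {0} \<Longrightarrow> F (0 + t *s v) $ i0 \<noteq> 0"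
      by (rule isolated_zeros[OF hol T T01(1) _ T01(2)]) (use True v(2) in auto)
    then show ?thesis unfolding eventually_at by (intro exI[of _ \<rho>]) (auto simp: dist_norm)
  next
    case False
    have "open {z\<in>ball 0 r. F z $ i0 \<noteq> 0}"
      by (rule open_nonzero[OF holo_fun_on_continuous_on[OF r(2)] open_ball])
    moreover have "0 \<in> {z\<in>ball 0 r. F z $ i0 \<noteq> 0}" using r(1) False by simp
    ultimately have "\<forall>\<^sub>F z in nhds 0. z \<in> {z\<in>ball 0 r. F z $ i0 \<noteq> 0}" by (rule eventually_nhds_in_open)
    then have "\<forall>\<^sub>F z in nhds 0. F z $ i0 \<noteq> 0" by eventually_elim simp
    from eventually_line[OF this] show ?thesis by (simp add: eventually_nhds_conv_at)
  qed
  from saturation_exists_aux[OF r this] show ?thesis .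
qed

section \<open>Forms tangent to a decomposable 2-form\<close>

text \<open>Contracting \<open>e \<and> x = 0\<close> with two basis vectors on which \<open>e = a \<and> b\<close> does not vanish solves for
  \<open>x\<close>.\<close>
lemma tangent_in_span:
  fixes a b x :: "complex^'n" and e :: "complex^('n \<times> 'n)"
  assumes e: "\<And>i j. e $ (i, j) = a $ i * b $ j - a $ j * b $ i" and "e \<noteq> 0"
    and x: "\<And>i j k. e $ (i, j) * x $ k + e $ (j, k) * x $ i + e $ (k, i) * x $ j = 0"
  shows "\<exists>s u. \<forall>m. x $ m = s * a $ m + u * b $ m"
proof -
  obtain p q where pq: "e $ (p, q) \<noteq> 0" using assms(2) by (auto simp: vec_eq_iff)
  show ?thesis
  proof (intro exI allI)
    fix m
    have "e $ (p, q) * x $ m = (b $ q * x $ p - b $ p * x $ q) * a $ m + (a $ p * x $ q - a $ q * x $ p) * b $ m"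
      using x[of p q m] unfolding e by algebra
    then have "x $ m = ((b $ q * x $ p - b $ p * x $ q) * a $ m + (a $ p * x $ q - a $ q * x $ p) * b $ m) / e $ (p, q)"
      using pq by (metis nonzero_mult_div_cancel_left)
    then show "x $ m = (b $ q * x $ p - b $ p * x $ q) / e $ (p, q) * a $ m +
        (a $ p * x $ q - a $ q * x $ p) / e $ (p, q) * b $ m"
      by (simp add: add_divide_distrib)
  qed
qed

lemma tangent_wedge_proportional:
  fixes x y :: "complex^'n" and e :: "complex^('n \<times> 'n)"
  assumes e: "e \<noteq> 0 \<Longrightarrow> \<exists>a b. \<forall>i j. e $ (i, j) = a $ i * b $ j - a $ j * (b :: complex^'n) $ i"
    and x: "\<And>i j k. e $ (i, j) * x $ k + e $ (j, k) * x $ i + e $ (k, i) * x $ j = 0"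
    and y: "\<And>i j k. e $ (i, j) * y $ k + e $ (j, k) * y $ i + e $ (k, i) * y $ j = 0"
  shows "(x $ i * y $ j - x $ j * y $ i) * e $ (k, l) = (x $ k * y $ l - x $ l * y $ k) * e $ (i, j)"
proof (cases "e = 0")
  case False
  then obtain a b where ab: "\<And>i j. e $ (i, j) = a $ i * b $ j - a $ j * (b :: complex^'n) $ i" using e by blast
  obtain s u where su: "\<And>m. x $ m = s * a $ m + u * b $ m" using tangent_in_span[OF ab False x] by blast
  obtain s' u' where su': "\<And>m. y $ m = s' * a $ m + u' * b $ m" using tangent_in_span[OF ab False y] by blast
  show ?thesis unfolding su su' ab by algebra
qed simp

text \<open>Three vectors in the plane spanned by \<open>a\<close> and \<open>b\<close> are dependent; this is Cramer's rule for the
  components \<open>k\<close> and \<open>l\<close>.\<close>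
lemma tangent_relation:
  fixes x y w :: "complex^'n" and e :: "complex^('n \<times> 'n)"
  assumes e: "e \<noteq> 0" "\<exists>a b. \<forall>i j. e $ (i, j) = a $ i * b $ j - a $ j * (b :: complex^'n) $ i"
    and x: "\<And>i j k. e $ (i, j) * x $ k + e $ (j, k) * x $ i + e $ (k, i) * x $ j = 0"
    and y: "\<And>i j k. e $ (i, j) * y $ k + e $ (j, k) * y $ i + e $ (k, i) * y $ j = 0"
    and w: "\<And>i j k. e $ (i, j) * w $ k + e $ (j, k) * w $ i + e $ (k, i) * w $ j = 0"
  shows "(y $ k * w $ l - y $ l * w $ k) * x $ m + (w $ k * x $ l - w $ l * x $ k) * y $ m +
    (x $ k * y $ l - x $ l * y $ k) * w $ m = 0"
proof -
  obtain a b where ab: "\<And>i j. e $ (i, j) = a $ i * b $ j - a $ j * (b :: complex^'n) $ i" using e by blast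
  obtain s u where su: "\<And>m. x $ m = s * a $ m + u * b $ m" using tangent_in_span[OF ab e(1) x] by blast
  obtain s' u' where su': "\<And>m. y $ m = s' * a $ m + u' * b $ m" using tangent_in_span[OF ab e(1) y] by blast
  obtain s2 u2 where su2: "\<And>m. w $ m = s2 * a $ m + u2 * b $ m" using tangent_in_span[OF ab e(1) w] by blast
  show ?thesis unfolding su su' su2 by algebra
qed

text \<open>The contraction of \<open>e \<and> x = 0\<close> with \<open>v\<close> is \<open>x(v) e = 0\<close>.\<close>
lemma kernel_annihilates_tangent:
  fixes x v :: "complex^'n" and e :: "complex^('n \<times> 'n)"
  assumes "e \<noteq> 0" and alt: "\<And>i j. e $ (i, j) = - e $ (j, i)"
    and x: "\<And>i j k. e $ (i, j) * x $ k + e $ (j, k) * x $ i + e $ (k, i) * x $ j = 0"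
    and v: "\<And>j. (\<Sum>i\<in>UNIV. v $ i * e $ (i, j)) = 0"
  shows "(\<Sum>i\<in>UNIV. v $ i * x $ i) = 0"
proof -
  obtain j k where jk: "e $ (j, k) \<noteq> 0" using assms(1) by (auto simp: vec_eq_iff)
  have "0 = (\<Sum>i\<in>UNIV. v $ i * (e $ (i, j) * x $ k + e $ (j, k) * x $ i + e $ (k, i) * x $ j))"
    by (simp add: x)
  also have "\<dots> = (\<Sum>i\<in>UNIV. x $ k * (v $ i * e $ (i, j)) + e $ (j, k) * (v $ i * x $ i) - x $ j * (v $ i * e $ (i, k)))"
    by (intro sum.cong refl, subst alt[of k]) (simp add: algebra_simps)
  also have "\<dots> = x $ k * (\<Sum>i\<in>UNIV. v $ i * e $ (i, j)) + e $ (j, k) * (\<Sum>i\<in>UNIV. v $ i * x $ i) -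
      x $ j * (\<Sum>i\<in>UNIV. v $ i * e $ (i, k))"
    by (simp add: sum.distrib sum_subtractf sum_distrib_left)
  finally show ?thesis using jk v by simp
qed

section \<open>Integrability\<close>

lemma ext_deriv_component:
  "ext_deriv \<omega> z $ (i, j) = cpartial i (\<lambda>w. \<omega> w $ j) z - cpartial j (\<lambda>w. \<omega> w $ i) z"
  by (simp add: ext_deriv_def)

lemma wedge12_component:
  "wedge12 \<alpha> \<eta> z $ (i, j, k) = \<alpha> z $ i * \<eta> z $ (j, k) + \<alpha> z $ j * \<eta> z $ (k, i) + \<alpha> z $ k * \<eta> z $ (i, j)"
  by (simp add: wedge12_def)

lemma wedge21_component:
  "wedge21 \<eta> \<alpha> z $ (i, j, k) = \<eta> z $ (i, j) * \<alpha> z $ k + \<eta> z $ (j, k) * \<alpha> z $ i + \<eta> z $ (k, i) * \<alpha> z $ j"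
  by (simp add: wedge21_def)

lemma wedge11_component: "wedge11 \<alpha> \<beta> z $ (i, j) = \<alpha> z $ i * \<beta> z $ j - \<alpha> z $ j * \<beta> z $ i"
  by (simp add: wedge11_def)

lemma cpartial_mult: "holo_fun_on f U \<Longrightarrow> holo_fun_on g U \<Longrightarrow> z \<in> U \<Longrightarrow>
    cpartial i (\<lambda>z. f z * g z) z = cpartial i f z * g z + f z * cpartial i g z"
  unfolding cpartial_eq_dir_deriv by (rule dir_deriv_mult)

lemma cpartial_add: "holo_fun_on f U \<Longrightarrow> holo_fun_on g U \<Longrightarrow> z \<in> U \<Longrightarrow>
    cpartial i (\<lambda>z. f z + g z) z = cpartial i f z + cpartial i g z"
  unfolding cpartial_eq_dir_deriv by (rule dir_deriv_add)

lemma cpartial_const: "cpartial i (\<lambda>z. c) z = 0"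
  by (simp add: cpartial_def)

lemma cpartial_cmult: "holo_fun_on f U \<Longrightarrow> z \<in> U \<Longrightarrow> cpartial i (\<lambda>z. c * f z) z = c * cpartial i f z"
  using cpartial_mult[of "\<lambda>_. c" U f z i] holo_fun_on_open[of f U] by (simp add: cpartial_const holo_fun_on_const)

lemma cpartial_sum:
  assumes "open U" "\<And>j. j \<in> J \<Longrightarrow> holo_fun_on (f j) U" "z \<in> U"
  shows "cpartial i (\<lambda>z. \<Sum>j\<in>J. f j z) z = (\<Sum>j\<in>J. cpartial i (f j) z)"
  using assms(2)
proof (induction J rule: infinite_finite_induct)
  case (insert x J)
  then show ?case
    using cpartial_add[of "f x" U "\<lambda>z. \<Sum>j\<in>J. f j z" z i] assms by (simp add: holo_fun_on_sum)
qed (simp_all add: cpartial_const)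

lemma cpartial_cong:
  assumes "open U" "z \<in> U" "\<And>w. w \<in> U \<Longrightarrow> f w = g w"
  shows "cpartial i f z = cpartial i g z"
  unfolding cpartial_eq_dir_deriv by (rule dir_deriv_cong) (use assms in \<open>auto simp: eventually_nhds\<close>)

text \<open>\<open>f\<omega> \<and> d(f\<omega>) = f\<^sup>2 \<omega> \<and> d\<omega> + f \<omega> \<and> df \<and> \<omega>\<close>, and the last term is zero.\<close>
lemma integrable_scale:
  assumes f: "holo_fun_on f U" and \<omega>: "\<And>i. holo_fun_on (\<lambda>z. \<omega> z $ i) U" and z: "z \<in> U"
    and int: "wedge12 \<omega> (ext_deriv \<omega>) z = 0"
  shows "wedge12 (\<lambda>z. f z *s \<omega> z) (ext_deriv (\<lambda>z. f z *s \<omega> z)) z = 0"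
proof -
  have d: "cpartial i (\<lambda>w. f w * \<omega> w $ j) z = cpartial i f z * \<omega> z $ j + f z * cpartial i (\<lambda>w. \<omega> w $ j) z" for i j
    by (rule cpartial_mult[OF f \<omega> z])
  have "wedge12 (\<lambda>z. f z *s \<omega> z) (ext_deriv (\<lambda>z. f z *s \<omega> z)) z $ (i, j, k) = 0" for i j k
  proof -
    have "wedge12 \<omega> (ext_deriv \<omega>) z $ (i, j, k) = 0" by (simp add: int)
    then show ?thesis
      unfolding wedge12_component ext_deriv_component vector_smult_component d by algebra
  qed
  then show ?thesis by (simp add: vec_eq_iff)
qed

text \<open>A quadratic form that vanishes at \<open>\<alpha>\<close>, \<open>\<beta>\<close> and \<open>\<alpha> + \<beta>\<close> has no mixed term, so it vanishes on
  their span.\<close>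
lemma integrable_pencil_members:
  assumes \<alpha>: "\<And>i. holo_fun_on (\<lambda>z. \<alpha> z $ i) U" and \<beta>: "\<And>i. holo_fun_on (\<lambda>z. \<beta> z $ i) U" and z: "z \<in> U"
    and int: "wedge12 \<alpha> (ext_deriv \<alpha>) z = 0" "wedge12 \<beta> (ext_deriv \<beta>) z = 0"
      "wedge12 (\<lambda>z. \<alpha> z + \<beta> z) (ext_deriv (\<lambda>z. \<alpha> z + \<beta> z)) z = 0"
  shows "wedge12 (\<lambda>z. a *s \<alpha> z + b *s \<beta> z) (ext_deriv (\<lambda>z. a *s \<alpha> z + b *s \<beta> z)) z = 0"
proof -
  have d: "cpartial i (\<lambda>w. a * \<alpha> w $ j + b * \<beta> w $ j) z =
      a * cpartial i (\<lambda>w. \<alpha> w $ j) z + b * cpartial i (\<lambda>w. \<beta> w $ j) z" for a b i j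
    using cpartial_add[OF holo_fun_on_cmult[OF \<alpha>] holo_fun_on_cmult[OF \<beta>] z] cpartial_cmult[OF \<alpha> z]
      cpartial_cmult[OF \<beta> z] by simp
  have d1: "cpartial i (\<lambda>w. \<alpha> w $ j + \<beta> w $ j) z = cpartial i (\<lambda>w. \<alpha> w $ j) z + cpartial i (\<lambda>w. \<beta> w $ j) z" for i j
    by (rule cpartial_add[OF \<alpha> \<beta> z])
  have "wedge12 (\<lambda>z. a *s \<alpha> z + b *s \<beta> z) (ext_deriv (\<lambda>z. a *s \<alpha> z + b *s \<beta> z)) z $ (i, j, k) = 0" for i j k
  proof -
    have "wedge12 \<alpha> (ext_deriv \<alpha>) z $ (i, j, k) = 0" "wedge12 \<beta> (ext_deriv \<beta>) z $ (i, j, k) = 0"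
      "wedge12 (\<lambda>z. \<alpha> z + \<beta> z) (ext_deriv (\<lambda>z. \<alpha> z + \<beta> z)) z $ (i, j, k) = 0"
      by (simp_all only: int zero_index)
    then show ?thesis
      unfolding wedge12_component ext_deriv_component vector_smult_component vector_add_component d d1
      by algebra
  qed
  then show ?thesis by (simp add: vec_eq_iff)
qed

text \<open>The Frobenius condition in terms of vector fields, by Cartan's formula for \<open>d\<omega>(X, Y)\<close>.\<close>
lemma integrable_lie_bracket:
  assumes \<omega>: "\<And>i. holo_fun_on (\<lambda>z. \<omega> z $ i) V" and X: "\<And>i. holo_fun_on (\<lambda>z. X z $ i) V"
    and Y: "\<And>i. holo_fun_on (\<lambda>z. Y z $ i) V" and z: "z \<in> V"
    and \<omega>X: "\<And>z. z \<in> V \<Longrightarrow> (\<Sum>i\<in>UNIV. X z $ i * \<omega> z $ i) = 0"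
    and \<omega>Y: "\<And>z. z \<in> V \<Longrightarrow> (\<Sum>i\<in>UNIV. Y z $ i * \<omega> z $ i) = 0"
    and int: "wedge12 \<omega> (ext_deriv \<omega>) z = 0" and nz: "\<omega> z \<noteq> 0"
  shows "(\<Sum>i\<in>UNIV. lie_bracket X Y z $ i * \<omega> z $ i) = 0"
proof -
  have oV: "open V" using holo_fun_on_open[OF \<omega>] .
  define E where "E i j = ext_deriv \<omega> z $ (i, j)" for i j
  have leib: "(\<Sum>j\<in>UNIV. cpartial i (\<lambda>w. Z w $ j) z * \<omega> z $ j) = - (\<Sum>j\<in>UNIV. Z z $ j * cpartial i (\<lambda>w. \<omega> w $ j) z)"
    if Z: "\<And>i. holo_fun_on (\<lambda>z. Z z $ i) V" and \<omega>Z: "\<And>z. z \<in> V \<Longrightarrow> (\<Sum>i\<in>UNIV. Z z $ i * \<omega> z $ i) = 0"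
    for Z :: "complex^'a \<Rightarrow> complex^'a" and i
  proof -
    have "0 = cpartial i (\<lambda>w. \<Sum>j\<in>UNIV. Z w $ j * \<omega> w $ j) z"
      using cpartial_cong[OF oV z, of "\<lambda>w. \<Sum>j\<in>UNIV. Z w $ j * \<omega> w $ j" "\<lambda>_. 0" i] \<omega>Z by (simp add: cpartial_const)
    also have "\<dots> = (\<Sum>j\<in>UNIV. cpartial i (\<lambda>w. Z w $ j * \<omega> w $ j) z)"
      by (rule cpartial_sum[OF oV _ z]) (intro holo_fun_on_mult Z \<omega>)
    also have "\<dots> = (\<Sum>j\<in>UNIV. cpartial i (\<lambda>w. Z w $ j) z * \<omega> z $ j + Z z $ j * cpartial i (\<lambda>w. \<omega> w $ j) z)"
      by (intro sum.cong refl cpartial_mult[OF Z \<omega> z])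
    finally show ?thesis by (simp add: sum.distrib eq_neg_iff_add_eq_0)
  qed
  have leibX: "(\<Sum>j\<in>UNIV. cpartial i (\<lambda>w. X w $ j) z * \<omega> z $ j) = - (\<Sum>j\<in>UNIV. X z $ j * cpartial i (\<lambda>w. \<omega> w $ j) z)"
    for i by (rule leib[OF X \<omega>X])
  have leibY: "(\<Sum>j\<in>UNIV. cpartial i (\<lambda>w. Y w $ j) z * \<omega> z $ j) = - (\<Sum>j\<in>UNIV. Y z $ j * cpartial i (\<lambda>w. \<omega> w $ j) z)"
    for i by (rule leib[OF Y \<omega>Y])
  have "(\<Sum>j\<in>UNIV. lie_bracket X Y z $ j * \<omega> z $ j) =
      (\<Sum>j\<in>UNIV. \<Sum>i\<in>UNIV. X z $ i * (cpartial i (\<lambda>w. Y w $ j) z * \<omega> z $ j)) -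
      (\<Sum>j\<in>UNIV. \<Sum>i\<in>UNIV. Y z $ i * (cpartial i (\<lambda>w. X w $ j) z * \<omega> z $ j))"
    by (simp add: lie_bracket_def sum_distrib_right sum_subtractf left_diff_distrib mult.assoc)
  also have "(\<Sum>j\<in>UNIV. \<Sum>i\<in>UNIV. X z $ i * (cpartial i (\<lambda>w. Y w $ j) z * \<omega> z $ j)) =
      (\<Sum>i\<in>UNIV. X z $ i * (\<Sum>j\<in>UNIV. cpartial i (\<lambda>w. Y w $ j) z * \<omega> z $ j))"
    by (subst sum.swap) (simp add: sum_distrib_left)
  also have "\<dots> = - (\<Sum>i\<in>UNIV. \<Sum>j\<in>UNIV. X z $ i * Y z $ j * cpartial i (\<lambda>w. \<omega> w $ j) z)"
    unfolding leibY by (simp add: sum_distrib_left sum_negf mult.assoc)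
  also have "(\<Sum>j\<in>UNIV. \<Sum>i\<in>UNIV. Y z $ i * (cpartial i (\<lambda>w. X w $ j) z * \<omega> z $ j)) =
      (\<Sum>i\<in>UNIV. Y z $ i * (\<Sum>j\<in>UNIV. cpartial i (\<lambda>w. X w $ j) z * \<omega> z $ j))"
    by (subst sum.swap) (simp add: sum_distrib_left)
  also have "\<dots> = - (\<Sum>i\<in>UNIV. \<Sum>j\<in>UNIV. Y z $ i * X z $ j * cpartial i (\<lambda>w. \<omega> w $ j) z)"
    unfolding leibX by (simp add: sum_distrib_left sum_negf mult.assoc)
  also have "(\<Sum>i\<in>UNIV. \<Sum>j\<in>UNIV. Y z $ i * X z $ j * cpartial i (\<lambda>w. \<omega> w $ j) z) =
      (\<Sum>i\<in>UNIV. \<Sum>j\<in>UNIV. X z $ i * Y z $ j * cpartial j (\<lambda>w. \<omega> w $ i) z)"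
    by (subst sum.swap) (simp add: mult.commute)
  finally have cartan: "(\<Sum>j\<in>UNIV. lie_bracket X Y z $ j * \<omega> z $ j) = - (\<Sum>i\<in>UNIV. \<Sum>j\<in>UNIV. X z $ i * Y z $ j * E i j)"
    by (simp add: E_def ext_deriv_component sum_subtractf right_diff_distrib)
  obtain k where k: "\<omega> z $ k \<noteq> 0" using nz by (auto simp: vec_eq_iff)
  have w: "\<omega> z $ i * E j k + \<omega> z $ j * E k i + \<omega> z $ k * E i j = 0" for i j
    using int wedge12_component[of \<omega> "ext_deriv \<omega>" z i j k] by (simp add: E_def)
  have "\<omega> z $ k * (\<Sum>i\<in>UNIV. \<Sum>j\<in>UNIV. X z $ i * Y z $ j * E i j) =
      (\<Sum>i\<in>UNIV. \<Sum>j\<in>UNIV. X z $ i * Y z $ j * (\<omega> z $ k * E i j))"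
    by (simp add: sum_distrib_left mult_ac)
  also have "\<dots> = (\<Sum>i\<in>UNIV. \<Sum>j\<in>UNIV. - (X z $ i * \<omega> z $ i) * (Y z $ j * E j k) - (X z $ i * E k i) * (Y z $ j * \<omega> z $ j))"
  proof (intro sum.cong refl)
    fix i j
    show "X z $ i * Y z $ j * (\<omega> z $ k * E i j) = - (X z $ i * \<omega> z $ i) * (Y z $ j * E j k) - (X z $ i * E k i) * (Y z $ j * \<omega> z $ j)"
      using w[of i j] by algebra
  qed
  also have "\<dots> = - (\<Sum>i\<in>UNIV. X z $ i * \<omega> z $ i) * (\<Sum>j\<in>UNIV. Y z $ j * E j k) -
      (\<Sum>i\<in>UNIV. X z $ i * E k i) * (\<Sum>j\<in>UNIV. Y z $ j * \<omega> z $ j)"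
    by (simp add: sum_subtractf sum_product sum_negf)
  also have "\<dots> = 0" using \<omega>X[OF z] \<omega>Y[OF z] by simp
  finally show ?thesis using k cartan by simp
qed

section \<open>Proportional forms and relations between forms\<close>

lemma open_ball_minus_zero_set:
  assumes "\<And>i. holo_fun_on (\<lambda>z. F z $ i) (ball 0 r)"
  shows "open (ball 0 r - zero_set F)"
proof -
  have "ball 0 r - zero_set F = (\<Union>i. {z\<in>ball 0 r. F z $ i \<noteq> 0})"
    by (auto simp: zero_set_def vec_eq_iff)
  moreover have "open {z\<in>ball 0 r. F z $ i \<noteq> 0}" for i
    by (rule open_nonzero[OF holo_fun_on_continuous_on[OF assms] open_ball])
  ultimately show ?thesis by auto
qed

text \<open>
  Reduce the fraction \<open>\<beta> $ k / \<gamma> $ k\<close> to \<open>B $ 1 / B $ 2\<close> with the zero set of \<open>B\<close> of codimension two;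
  then \<open>B $ 2 \<cdot> \<beta> = B $ 1 \<cdot> \<gamma>\<close>.  If the denominator vanished at \<open>0\<close>, it would vanish on hypersurfaces
  close to \<open>0\<close>, and on these \<open>B $ 1\<close> or \<open>\<gamma>\<close> would vanish, against the codimension of their zero sets.
  So \<open>\<beta>\<close> is a holomorphic multiple of \<open>\<gamma>\<close>.
\<close>
lemma saturationI_proportional:
  fixes \<beta> \<gamma> :: "complex^'n \<Rightarrow> complex^'i"
  assumes \<beta>: "holo_germ \<beta>" "\<not> zero_germ (\<lambda>z. \<beta> z $ k)"
    and \<gamma>: "holo_germ \<gamma>" "\<not> zero_germ (\<lambda>z. \<gamma> z $ k)" "codim_ge 2 (zero_set \<gamma>)"
    and proportional: "\<forall>\<^sub>F z in nhds 0. \<forall>j. \<beta> z $ j * \<gamma> z $ k = \<beta> z $ k * \<gamma> z $ j"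
  shows "saturation \<beta> \<gamma>"
proof -
  define A :: "complex^'n \<Rightarrow> complex^2" where "A z = vector [\<beta> z $ k, \<gamma> z $ k]" for z
  have A: "A z $ 1 = \<beta> z $ k" "A z $ 2 = \<gamma> z $ k" for z by (simp_all add: A_def)
  obtain r0 where r0: "0 < r0" "\<forall>i. holo_fun_on (\<lambda>z. \<beta> z $ i) (ball 0 r0)"
      "\<forall>i. holo_fun_on (\<lambda>z. \<gamma> z $ i) (ball 0 r0)"
    by (rule eventually_radius[OF eventually_conj[OF holo_germ_ball[OF \<beta>(1)] holo_germ_ball[OF \<gamma>(1)]] zero_less_one])
       (elim conjE, rule that)
  have "holo_germ A"
  proof (rule holo_germI[of r0])
    fix i :: 2
    show "holo_fun_on (\<lambda>z. A z $ i) (ball 0 r0)" using r0 exhaust_2[of i] by (auto simp: A)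
  qed (use r0 in simp)
  moreover have "\<not> zero_germ A"
  proof
    assume "zero_germ A"
    then have "zero_germ (\<lambda>z. \<beta> z $ k)"
      unfolding zero_germ_def by (rule eventually_mono) (simp add: A(1)[symmetric])
    with \<beta>(2) show False by simp
  qed
  ultimately obtain B where "saturation A B" using saturation_exists by blast
  then obtain h where B: "holo_germ B" "codim_ge 2 (zero_set B)" "holo_fun_germ h" "\<not> zero_germ h"
    "\<forall>\<^sub>F z in nhds 0. A z = h z *s B z" unfolding saturation_def by blast
  obtain r where r: "0 < r" "r \<le> r0" "\<forall>i. holo_fun_on (\<lambda>z. B z $ i) (ball 0 r)"
      "holo_fun_on h (ball 0 r)" "\<forall>z\<in>ball 0 r. A z = h z *s B z"
      "\<forall>z\<in>ball 0 r. \<forall>j. \<beta> z $ j * \<gamma> z $ k = \<beta> z $ k * \<gamma> z $ j"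
    by (rule eventually_radius[OF eventually_conj[OF holo_germ_ball[OF B(1)] eventually_conj[OF
        holo_fun_germ_ball[OF B(3)] eventually_conj[OF eventually_nhds_0_ball[OF B(5)]
        eventually_nhds_0_ball[OF proportional]]]] r0(1)])
       (elim conjE, rule that)
  let ?D = "ball (0 :: complex^'n) r"
  have holB: "holo_fun_on (\<lambda>z. B z $ i) ?D" for i using r by simp
  have holh: "holo_fun_on h ?D" using r by simp
  have hol: "holo_fun_on (\<lambda>z. \<beta> z $ j) ?D" "holo_fun_on (\<lambda>z. \<gamma> z $ j) ?D" for j
    using r0 r by (simp_all add: holo_fun_on_subset[OF _ open_ball subset_ball, of _ 0 r0 r])
  have hne: "\<exists>z\<in>?D. h z \<noteq> 0" using nonzero_in_ball[OF B(4)] r by blast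
  have cross: "B z $ 2 * \<beta> z $ j = B z $ 1 * \<gamma> z $ j" if z: "z \<in> ?D" for z j
  proof -
    have "B z $ 2 * \<beta> z $ j - B z $ 1 * \<gamma> z $ j = 0"
    proof (rule continuous_zero_of_dense[OF holh convex_ball hne _ _ z])
      show "continuous_on ?D (\<lambda>z. B z $ 2 * \<beta> z $ j - B z $ 1 * \<gamma> z $ j)"
        by (intro holo_fun_on_continuous_on holo_fun_on_diff holo_fun_on_mult holB hol)
      fix z assume z: "z \<in> ?D" "h z \<noteq> 0"
      then have Ah: "A z = h z *s B z" and bg: "\<beta> z $ j * \<gamma> z $ k = \<beta> z $ k * \<gamma> z $ j" using r by blast+
      have "\<beta> z $ k = h z * B z $ 1" "\<gamma> z $ k = h z * B z $ 2"
        using A[of z] unfolding Ah by simp_all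
      with bg have "h z * (B z $ 2 * \<beta> z $ j - B z $ 1 * \<gamma> z $ j) = 0" by (simp add: algebra_simps)
      then show "B z $ 2 * \<beta> z $ j - B z $ 1 * \<gamma> z $ j = 0" using z(2) by simp
    qed
    then show ?thesis by simp
  qed
  have "B 0 $ 2 \<noteq> 0"
  proof
    assume B0: "B 0 $ 2 = 0"
    have "codim_ge 2 (zero_set \<gamma> \<union> zero_set B)"
      by (rule codim_ge_Un[OF \<gamma>(3) B(2) open_ball _ open_ball_minus_zero_set[OF hol(2)]]) (use r in simp)
    moreover have "subgerm {z. B z $ 2 = 0} (zero_set \<gamma> \<union> zero_set B)"
      unfolding subgerm_def
    proof (rule eventually_ball_nhds_0[of r])
      fix z assume z: "z \<in> ?D"
      show "z \<in> {z. B z $ 2 = 0} \<longrightarrow> z \<in> zero_set \<gamma> \<union> zero_set B"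
      proof
        assume "z \<in> {z. B z $ 2 = 0}"
        then have b: "B z $ 2 = 0" by simp
        then have "B z $ 1 = 0 \<or> (\<forall>j. \<gamma> z $ j = 0)" using cross[OF z] by auto
        with b show "z \<in> zero_set \<gamma> \<union> zero_set B" by (auto simp: zero_set_def vec_eq_iff forall_2)
      qed
    qed (use r in simp)
    ultimately have "codim_ge 2 {z. B z $ 2 = 0}" by (rule codim_ge_subgerm)
    with zero_not_codim_ge_2[OF holo_fun_germI[OF _ holB, of 2]] B0 r show False by simp
  qed
  then have "\<forall>\<^sub>F z in nhds 0. B z $ 2 \<noteq> 0"
  proof -
    have "open {z\<in>?D. B z $ 2 \<noteq> 0}" by (rule open_nonzero[OF holo_fun_on_continuous_on[OF holB] open_ball])
    then have "\<forall>\<^sub>F z in nhds 0. z \<in> {z\<in>?D. B z $ 2 \<noteq> 0}"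
      using \<open>B 0 $ 2 \<noteq> 0\<close> r by (intro eventually_nhds_in_open) auto
    then show ?thesis by (rule eventually_mono) simp
  qed
  then obtain s where s: "0 < s" "s \<le> r" "\<forall>z\<in>ball 0 s. B z $ 2 \<noteq> 0"
    by (rule eventually_radius[OF eventually_nhds_0_ball r(1)])
  let ?q = "\<lambda>z. B z $ 1 / B z $ 2"
  have q: "holo_fun_on ?q (ball 0 s)"
    using s by (intro holo_fun_on_divide holo_fun_on_subset[OF holB]) (auto simp: subset_ball)
  have eq: "\<beta> z = ?q z *s \<gamma> z" if "z \<in> ball 0 s" for z
  proof -
    have "B z $ 2 \<noteq> 0" "z \<in> ?D" using that s by auto
    then show ?thesis using cross[of z] by (simp add: vec_eq_iff field_simps)
  qed
  have ev: "\<forall>\<^sub>F z in nhds 0. \<beta> z = ?q z *s \<gamma> z" by (rule eventually_ball_nhds_0[of s, OF _ eq]) (use s in simp)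
  have "\<not> zero_germ ?q"
  proof
    assume "zero_germ ?q"
    then have "\<forall>\<^sub>F z in nhds 0. ?q z = 0" by (simp add: zero_germ_def)
    then have "\<forall>\<^sub>F z in nhds 0. \<beta> z $ k = 0"
      using ev by eventually_elim (metis mult_zero_left vector_smult_component)
    with \<beta>(2) show False by (simp add: zero_germ_def)
  qed
  moreover have "holo_fun_germ ?q" by (rule holo_fun_germI[OF _ q]) (use s in simp)
  ultimately show ?thesis
    unfolding saturation_def using \<gamma>(1,3) ev by (intro conjI exI[of _ ?q])
qed

text \<open>
  After the common factors of the three coefficients are cancelled, a common zero of the first two
  terms is a zero of the third as well, hence a zero of one of the forms or of all coefficients.
  These sets have codimension two.
\<close>
lemma coprime_relation:
  fixes \<alpha> \<beta> \<kappa> :: "complex^'n \<Rightarrow> complex^'i"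
  assumes r0: "r0 > 0" and hol: "\<And>i. holo_fun_on (\<lambda>z. \<alpha> z $ i) (ball 0 r0)"
      "\<And>i. holo_fun_on (\<lambda>z. \<beta> z $ i) (ball 0 r0)" "\<And>i. holo_fun_on (\<lambda>z. \<kappa> z $ i) (ball 0 r0)"
    and cod: "codim_ge 2 (zero_set \<alpha>)" "codim_ge 2 (zero_set \<beta>)" "codim_ge 2 (zero_set \<kappa>)"
    and f: "\<And>i :: 3. holo_fun_on (\<lambda>z. f z $ i) (ball 0 r0)" "\<And>i. \<not> zero_germ (\<lambda>z. f z $ i)"
    and rel: "\<forall>z\<in>ball 0 r0. f z $ 1 *s \<alpha> z + f z $ 2 *s \<beta> z + f z $ 3 *s \<kappa> z = 0"
  shows "\<exists>r (p :: complex^'n \<Rightarrow> complex^3). 0 < r \<and> r \<le> r0 \<and> (\<forall>i. holo_fun_on (\<lambda>z. p z $ i) (ball 0 r)) \<and>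
    (\<forall>i. \<not> zero_germ (\<lambda>z. p z $ i)) \<and>
    (\<forall>z\<in>ball 0 r. p z $ 1 *s \<alpha> z + p z $ 2 *s \<beta> z + p z $ 3 *s \<kappa> z = 0) \<and>
    codim_ge 2 (zero_set (\<lambda>z. p z $ 1 *s \<alpha> z) \<inter> zero_set (\<lambda>z. p z $ 2 *s \<beta> z))"
proof -
  have "\<not> zero_germ f"
  proof
    assume "zero_germ f"
    then have "zero_germ (\<lambda>z. f z $ 1)" unfolding zero_germ_def by (rule eventually_mono) simp
    with f(2) show False by blast
  qed
  then obtain p where "saturation f p" using saturation_exists holo_germI[OF r0 f(1)] by blast
  then obtain h where p: "holo_germ p" "codim_ge 2 (zero_set p)" "holo_fun_germ h" "\<not> zero_germ h"
    "\<forall>\<^sub>F z in nhds 0. f z = h z *s p z" unfolding saturation_def by blast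
  obtain r where r: "0 < r" "r \<le> r0" "\<forall>i. holo_fun_on (\<lambda>z. p z $ i) (ball 0 r)"
      "holo_fun_on h (ball 0 r)" "\<forall>z\<in>ball 0 r. f z = h z *s p z"
    by (rule eventually_radius[OF eventually_conj[OF holo_germ_ball[OF p(1)] eventually_conj[OF
        holo_fun_germ_ball[OF p(3)] eventually_nhds_0_ball[OF p(5)]]] r0])
       (elim conjE, rule that)
  let ?D = "ball (0 :: complex^'n) r"
  have holp: "holo_fun_on (\<lambda>z. p z $ i) ?D" for i using r by simp
  have holh: "holo_fun_on h ?D" using r by simp
  have hol': "holo_fun_on (\<lambda>z. \<alpha> z $ j) ?D" "holo_fun_on (\<lambda>z. \<beta> z $ j) ?D" "holo_fun_on (\<lambda>z. \<kappa> z $ j) ?D" for j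
    using hol r by (simp_all add: holo_fun_on_subset[OF _ open_ball subset_ball, of _ 0 r0 r])
  have hne: "\<exists>z\<in>?D. h z \<noteq> 0" using nonzero_in_ball[OF p(4)] r by blast
  have pnz: "\<not> zero_germ (\<lambda>z. p z $ i)" for i
  proof
    assume "zero_germ (\<lambda>z. p z $ i)"
    then have "zero_germ (\<lambda>z. f z $ i)"
      using p(5) unfolding zero_germ_def by eventually_elim simp
    with f(2) show False by blast
  qed
  have rel': "p z $ 1 *s \<alpha> z + p z $ 2 *s \<beta> z + p z $ 3 *s \<kappa> z = 0" if z: "z \<in> ?D" for z
  proof -
    have "p z $ 1 * \<alpha> z $ j + p z $ 2 * \<beta> z $ j + p z $ 3 * \<kappa> z $ j = 0" for j
    proof (rule continuous_zero_of_dense[OF holh convex_ball hne _ _ z])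
      show "continuous_on ?D (\<lambda>z. p z $ 1 * \<alpha> z $ j + p z $ 2 * \<beta> z $ j + p z $ 3 * \<kappa> z $ j)"
        by (intro holo_fun_on_continuous_on holo_fun_on_add holo_fun_on_mult holp hol')
      fix z assume z: "z \<in> ?D" "h z \<noteq> 0"
      have "f z = h z *s p z" using r z(1) by blast
      moreover have "z \<in> ball 0 r0" using r z(1) by auto
      from bspec[OF rel this] have "(f z $ 1 *s \<alpha> z + f z $ 2 *s \<beta> z + f z $ 3 *s \<kappa> z) $ j = 0" by simp
      ultimately have "h z * (p z $ 1 * \<alpha> z $ j + p z $ 2 * \<beta> z $ j + p z $ 3 * \<kappa> z $ j) = 0"
        by (simp add: algebra_simps)
      then show "p z $ 1 * \<alpha> z $ j + p z $ 2 * \<beta> z $ j + p z $ 3 * \<kappa> z $ j = 0" using z(2) by simp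
    qed
    then show ?thesis by (simp add: vec_eq_iff)
  qed
  have "codim_ge 2 (zero_set \<alpha> \<union> (zero_set \<beta> \<union> (zero_set \<kappa> \<union> zero_set p)))"
    by (intro codim_ge_Un[OF _ _ open_ball[of 0 r] _ open_ball_minus_zero_set] cod p(2)) (use r hol' in simp_all)
  moreover have "subgerm (zero_set (\<lambda>z. p z $ 1 *s \<alpha> z) \<inter> zero_set (\<lambda>z. p z $ 2 *s \<beta> z))
      (zero_set \<alpha> \<union> (zero_set \<beta> \<union> (zero_set \<kappa> \<union> zero_set p)))"
    unfolding subgerm_def
  proof (rule eventually_ball_nhds_0[of r])
    fix z assume z: "z \<in> ?D"
    show "z \<in> zero_set (\<lambda>z. p z $ 1 *s \<alpha> z) \<inter> zero_set (\<lambda>z. p z $ 2 *s \<beta> z) \<longrightarrow>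
       z \<in> zero_set \<alpha> \<union> (zero_set \<beta> \<union> (zero_set \<kappa> \<union> zero_set p))"
    proof
      assume "z \<in> zero_set (\<lambda>z. p z $ 1 *s \<alpha> z) \<inter> zero_set (\<lambda>z. p z $ 2 *s \<beta> z)"
      then have 1: "p z $ 1 *s \<alpha> z = 0" "p z $ 2 *s \<beta> z = 0" by (auto simp: zero_set_def)
      with rel'[OF z] have "p z $ 3 *s \<kappa> z = 0" by simp
      with 1 show "z \<in> zero_set \<alpha> \<union> (zero_set \<beta> \<union> (zero_set \<kappa> \<union> zero_set p))"
        by (auto simp: zero_set_def vec_eq_iff forall_3)
    qed
  qed (use r in simp)
  ultimately have "codim_ge 2 (zero_set (\<lambda>z. p z $ 1 *s \<alpha> z) \<inter> zero_set (\<lambda>z. p z $ 2 *s \<beta> z))"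
    by (rule codim_ge_subgerm)
  then show ?thesis using r holp pnz rel' by (intro exI[of _ r] exI[of _ p]) blast
qed

section \<open>Pencils\<close>

lemma no_common_codim1_component:
  assumes "codim_ge 2 (A \<inter> B)"
  shows "\<not> common_codim1_component A B"
proof
  assume "common_codim1_component A B"
  then obtain C where C: "subgerm C A" "subgerm C B" "\<not> codim_ge 2 C"
    unfolding common_codim1_component_def component_germ_def by blast
  have "subgerm C (A \<inter> B)" using C(1,2) unfolding subgerm_def by eventually_elim blast
  from codim_ge_subgerm[OF assms this] C(3) show False by simp
qed

lemma foliation_in_pencilI:
  fixes \<omega> :: "complex^'n \<Rightarrow> complex^'n"
  assumes r: "r > 0" and \<omega>: "\<And>i. holo_fun_on (\<lambda>z. \<omega> z $ i) (ball 0 r)" "codim_ge 2 (zero_set \<omega>)" "\<not> zero_germ \<omega>"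
    and p: "holo_fun_on p (ball 0 r)" "\<not> zero_germ p"
    and \<alpha>: "\<alpha> \<in> pencil \<eta>\<^sub>1 \<eta>\<^sub>2" "\<And>z. z \<in> ball 0 r \<Longrightarrow> \<alpha> z = p z *s \<omega> z"
  shows "foliation_in_pencil \<omega> \<eta>\<^sub>1 \<eta>\<^sub>2"
proof -
  have sat1: "saturation \<omega> \<omega>" unfolding saturation_def
  proof (intro conjI exI[of _ "\<lambda>_. 1"])
    show "holo_fun_germ (\<lambda>_ :: complex^'n. 1)" by (rule holo_fun_germI[OF r]) (auto intro: holo_fun_on_const)
    show "\<not> zero_germ (\<lambda>_ :: complex^'n. 1 :: complex)" by (simp add: zero_germ_def)
  qed (use holo_germI[OF r \<omega>(1)] \<omega>(2) in auto)
  have ev: "\<forall>\<^sub>F z in nhds 0. \<alpha> z = p z *s \<omega> z" by (rule eventually_ball_nhds_0[OF r \<alpha>(2)])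
  have sat2: "saturation \<alpha> \<omega>" unfolding saturation_def
    using holo_germI[OF r \<omega>(1)] \<omega>(2) holo_fun_germI[OF r p(1)] p(2) ev
    by (intro conjI exI[of _ p])
  obtain i where i: "\<not> zero_germ (\<lambda>z. \<omega> z $ i)" using zero_germ_component[OF \<omega>(3)] by blast
  obtain z where z: "z \<in> ball 0 r" "p z * \<omega> z $ i \<noteq> 0"
    using product_nonzero[OF p(1) \<omega>(1) convex_ball nonzero_in_ball[OF p(2) r] nonzero_in_ball[OF i r]] by blast
  have "\<not> zero_germ \<alpha>"
  proof
    assume "zero_germ \<alpha>"
    then have "\<forall>\<^sub>F z in nhds 0. \<alpha> z = 0" by (simp add: zero_germ_def)
    then have "zero_germ (\<lambda>z. p z * \<omega> z $ i)"
      using ev unfolding zero_germ_def by eventually_elim (metis vector_smult_component zero_index)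
    with not_zero_germ_scalar[OF holo_fun_on_mult[OF p(1) \<omega>(1)] z] show False by simp
  qed
  with sat1 sat2 \<alpha>(1) show ?thesis unfolding foliation_in_pencil_def same_foliation_def by blast
qed

text \<open>
  Where \<open>\<alpha> \<and> \<beta> \<noteq> 0\<close>, the kernel of \<open>\<eta>\<close> is the common kernel of \<open>\<alpha>\<close> and \<open>\<beta>\<close>, which is closed under
  brackets because \<open>\<alpha>\<close> and \<open>\<beta>\<close> are integrable.  The other points are limits of such points.
\<close>
lemma integrable_2form_of_tangent_integrable:
  fixes \<alpha> \<beta> :: "complex^'n \<Rightarrow> complex^'n"
  assumes r: "r > 0" and hol: "\<And>i. holo_fun_on (\<lambda>z. \<alpha> z $ i) (ball 0 r)" "\<And>i. holo_fun_on (\<lambda>z. \<beta> z $ i) (ball 0 r)"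
      "\<And>ij. holo_fun_on (\<lambda>z. \<eta> z $ ij) (ball 0 r)"
    and int: "\<And>z. z \<in> ball 0 r \<Longrightarrow> wedge12 \<alpha> (ext_deriv \<alpha>) z = 0" "\<And>z. z \<in> ball 0 r \<Longrightarrow> wedge12 \<beta> (ext_deriv \<beta>) z = 0"
    and tan: "\<And>z. z \<in> ball 0 r \<Longrightarrow> wedge21 \<eta> \<alpha> z = 0" "\<And>z. z \<in> ball 0 r \<Longrightarrow> wedge21 \<eta> \<beta> z = 0"
    and alt: "\<And>z i j. z \<in> ball 0 r \<Longrightarrow> \<eta> z $ (i, j) = - \<eta> z $ (j, i)"
    and proportional: "\<And>z i j k l. z \<in> ball 0 r \<Longrightarrow>
      wedge11 \<alpha> \<beta> z $ (i, j) * \<eta> z $ (k, l) = wedge11 \<alpha> \<beta> z $ (k, l) * \<eta> z $ (i, j)"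
    and nz: "z0 \<in> ball 0 r" "wedge11 \<alpha> \<beta> z0 $ (k, l) \<noteq> 0"
    and ld: "locally_decomposable \<eta>"
  shows "integrable_2form \<eta>"
  unfolding integrable_2form_def
proof (intro conjI ld exI[of _ "ball 0 r"] allI impI)
  fix V and X Y :: "complex^'n \<Rightarrow> complex^'n"
  assume *: "open V \<and> V \<subseteq> ball 0 r \<and> (\<forall>z\<in>V. \<eta> z \<noteq> 0) \<and> holo_on X V \<and> holo_on Y V \<and>
    (\<forall>z\<in>V. X z \<in> form_kernel \<eta> z \<and> Y z \<in> form_kernel \<eta> z)"
  then have V: "open V" "V \<subseteq> ball 0 r" and holXY: "holo_fun_on (\<lambda>z. X z $ i) V" "holo_fun_on (\<lambda>z. Y z $ i) V" for i
    by (auto simp: holo_on_def)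
  have holV: "holo_fun_on (\<lambda>z. \<alpha> z $ i) V" "holo_fun_on (\<lambda>z. \<beta> z $ i) V" "holo_fun_on (\<lambda>z. \<eta> z $ ij) V" for i ij
    using hol V by (simp_all add: holo_fun_on_subset[of _ "ball 0 r" V])
  have ann: "(\<Sum>i\<in>UNIV. Z z $ i * \<omega> z $ i) = 0"
    if "z \<in> V" "Z z \<in> form_kernel \<eta> z" "wedge21 \<eta> \<omega> z = 0" for z and Z \<omega> :: "complex^'n \<Rightarrow> complex^'n"
  proof (rule kernel_annihilates_tangent[of "\<eta> z"])
    show "\<eta> z \<noteq> 0" using * that(1) by blast
    show "\<eta> z $ (i, j) = - \<eta> z $ (j, i)" for i j using alt V that(1) by blast
    show "\<eta> z $ (i, j) * \<omega> z $ k + \<eta> z $ (j, k) * \<omega> z $ i + \<eta> z $ (k, i) * \<omega> z $ j = 0" for i j k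
      using that(3) wedge21_component[of \<eta> \<omega> z i j k] by simp
    show "(\<Sum>i\<in>UNIV. Z z $ i * \<eta> z $ (i, j)) = 0" for j
      using that(2) by (simp add: form_kernel_def)
  qed
  have ann': "(\<Sum>i\<in>UNIV. X z $ i * \<alpha> z $ i) = 0" "(\<Sum>i\<in>UNIV. Y z $ i * \<alpha> z $ i) = 0"
      "(\<Sum>i\<in>UNIV. X z $ i * \<beta> z $ i) = 0" "(\<Sum>i\<in>UNIV. Y z $ i * \<beta> z $ i) = 0" if z: "z \<in> V" for z
    using ann[OF z] tan V z * by blast+
  let ?B = "lie_bracket X Y"
  have generic: "(\<Sum>i\<in>UNIV. ?B z $ i * \<eta> z $ (i, j)) = 0" if z: "z \<in> V" and kl: "wedge11 \<alpha> \<beta> z $ (k, l) \<noteq> 0" for z j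
  proof -
    have zr: "z \<in> ball 0 r" using z V by blast
    have "\<alpha> z \<noteq> 0" "\<beta> z \<noteq> 0" using kl by (auto simp: wedge11_component)
    then have B: "(\<Sum>i\<in>UNIV. ?B z $ i * \<alpha> z $ i) = 0" "(\<Sum>i\<in>UNIV. ?B z $ i * \<beta> z $ i) = 0"
      using integrable_lie_bracket[OF holV(1) holXY z ann'(1,2) int(1)[OF zr]]
        integrable_lie_bracket[OF holV(2) holXY z ann'(3,4) int(2)[OF zr]] by blast+
    have "wedge11 \<alpha> \<beta> z $ (k, l) * (\<Sum>i\<in>UNIV. ?B z $ i * \<eta> z $ (i, j)) =
        (\<Sum>i\<in>UNIV. ?B z $ i * (wedge11 \<alpha> \<beta> z $ (k, l) * \<eta> z $ (i, j)))"
      by (simp add: sum_distrib_left mult_ac)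
    also have "\<dots> = (\<Sum>i\<in>UNIV. ?B z $ i * (wedge11 \<alpha> \<beta> z $ (i, j) * \<eta> z $ (k, l)))"
      using proportional[OF zr, of _ j k l] by simp
    also have "\<dots> = (\<Sum>i\<in>UNIV. (?B z $ i * \<alpha> z $ i) * (\<beta> z $ j * \<eta> z $ (k, l)) -
        (?B z $ i * \<beta> z $ i) * (\<alpha> z $ j * \<eta> z $ (k, l)))"
      by (intro sum.cong refl) (simp add: wedge11_component algebra_simps)
    also have "\<dots> = (\<Sum>i\<in>UNIV. ?B z $ i * \<alpha> z $ i) * (\<beta> z $ j * \<eta> z $ (k, l)) -
        (\<Sum>i\<in>UNIV. ?B z $ i * \<beta> z $ i) * (\<alpha> z $ j * \<eta> z $ (k, l))"
      by (simp add: sum_subtractf sum_distrib_right)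
    finally show ?thesis using B kl by simp
  qed
  show "\<forall>z\<in>V. ?B z \<in> form_kernel \<eta> z"
  proof
    fix z assume z: "z \<in> V"
    obtain e where e: "e > 0" "ball z e \<subseteq> V" using V(1) z by (meson openE)
    define g where "g z = wedge11 \<alpha> \<beta> z $ (k, l)" for z
    have g: "holo_fun_on g (ball 0 r)"
      unfolding g_def wedge11_component by (intro holo_fun_on_diff holo_fun_on_mult hol)
    have "ball z e \<inter> ball 0 r \<noteq> {}" using e z V(2) by (metis Int_iff centre_in_ball empty_iff subsetD)
    moreover have "\<exists>z\<in>ball 0 r. g z \<noteq> 0" using nz by (auto simp: g_def)
    ultimately have ne: "\<exists>y\<in>ball z e. g y \<noteq> 0"
      using nonzero_dense[OF g convex_ball _ open_ball, of z e] by blast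
    have gz: "holo_fun_on g (ball z e)" by (rule holo_fun_on_subset[OF g open_ball]) (use e V in blast)
    have "(\<Sum>i\<in>UNIV. ?B z $ i * \<eta> z $ (i, j)) = 0" for j
    proof (rule continuous_zero_of_dense[OF gz convex_ball ne])
      have Bi: "?B w $ i = (\<Sum>m\<in>UNIV. X w $ m * cpartial m (\<lambda>w. Y w $ i) w - Y w $ m * cpartial m (\<lambda>w. X w $ i) w)" for w i
        by (simp add: lie_bracket_def)
      have "holo_fun_on (\<lambda>w. ?B w $ i) V" for i
        unfolding Bi by (intro holo_fun_on_sum holo_fun_on_diff holo_fun_on_mult holo_fun_on_cpartial holXY V)
      then have "holo_fun_on (\<lambda>w. \<Sum>i\<in>UNIV. ?B w $ i * \<eta> w $ (i, j)) V"
        by (intro holo_fun_on_sum holo_fun_on_mult holV V)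
      then show "continuous_on (ball z e) (\<lambda>w. \<Sum>i\<in>UNIV. ?B w $ i * \<eta> w $ (i, j))"
        using holo_fun_on_continuous_on continuous_on_subset e(2) by blast
      fix w assume "w \<in> ball z e" "g w \<noteq> 0"
      then show "(\<Sum>i\<in>UNIV. ?B w $ i * \<eta> w $ (i, j)) = 0" using generic e(2) by (auto simp: g_def)
    qed (use e in simp)
    then show "?B z \<in> form_kernel \<eta> z" by (simp add: form_kernel_def)
  qed
qed (use r in auto)

section \<open>Three integrable forms tangent to a 2-form\<close>
lemma wedge12_ext_deriv_cong:
  assumes "open U" "z \<in> U" "\<And>w. w \<in> U \<Longrightarrow> \<alpha> w = \<beta> w"
  shows "wedge12 \<alpha> (ext_deriv \<alpha>) z = wedge12 \<beta> (ext_deriv \<beta>) z"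
proof -
  have "cpartial i (\<lambda>w. \<alpha> w $ j) z = cpartial i (\<lambda>w. \<beta> w $ j) z" for i j
    by (rule cpartial_cong[OF assms(1,2)]) (simp add: assms(3))
  then show ?thesis
    using assms(3)[OF assms(2)] by (auto simp: vec_eq_iff wedge12_component ext_deriv_component)
qed

lemma locally_decomposable_pointwise:
  assumes "locally_decomposable \<eta>"
  shows "\<forall>\<^sub>F z in nhds 0. \<eta> z \<noteq> 0 \<longrightarrow> (\<exists>a b. \<forall>i j. \<eta> z $ (i, j) = a $ i * b $ j - a $ j * b $ i)"
proof -
  obtain U where U: "open U" "0 \<in> U"
    "\<forall>p\<in>U. \<eta> p \<noteq> 0 \<longrightarrow> (\<exists>V \<alpha> \<beta>. open V \<and> p \<in> V \<and> holo_on \<alpha> V \<and> holo_on \<beta> V \<and> (\<forall>z\<in>V. \<eta> z = wedge11 \<alpha> \<beta> z))"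
    using assms unfolding locally_decomposable_def by blast
  have "\<forall>\<^sub>F z in nhds 0. z \<in> U" using U by (intro eventually_nhds_in_open)
  then show ?thesis
  proof eventually_elim
    case (elim z)
    show ?case
    proof
      assume "\<eta> z \<noteq> 0"
      then obtain \<alpha> \<beta> where "\<eta> z = wedge11 \<alpha> \<beta> z" using U(3) elim by blast
      then show "\<exists>a b. \<forall>i j. \<eta> z $ (i, j) = a $ i * b $ j - a $ j * b $ i"
        by (intro exI[of _ "\<alpha> z"] exI[of _ "\<beta> z"]) (simp add: wedge11_component)
    qed
  qed
qed

theorem proposition4p4:
  fixes \<omega> :: "nat \<Rightarrow> complex^'n \<Rightarrow> complex^'n"
    and \<eta> :: "complex^'n \<Rightarrow> complex^('n \<times> 'n)"
  assumes "CARD('n) \<ge> 3"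
    and "\<And>i. i \<in> {1, 2, 3} \<Longrightarrow> holo_1form_germ (\<omega> i)"
    and "\<And>i. i \<in> {1, 2, 3} \<Longrightarrow> integrable_1form (\<omega> i)"
    and "\<And>i. i \<in> {1, 2, 3} \<Longrightarrow> codim_ge 2 (zero_set (\<omega> i))"
    and "\<And>i j. i \<in> {1, 2, 3} \<Longrightarrow> j \<in> {1, 2, 3} \<Longrightarrow> i \<noteq> j \<Longrightarrow> independent_1forms (\<omega> i) (\<omega> j)"
    and "holo_2form_germ \<eta>" and "\<not> zero_germ \<eta>"
    and "locally_decomposable \<eta>"
    and "\<And>i. i \<in> {1, 2, 3} \<Longrightarrow> zero_germ (wedge21 \<eta> (\<omega> i))"
  shows "\<exists>\<eta>\<^sub>1 \<eta>\<^sub>2. integrable_pencil \<eta>\<^sub>1 \<eta>\<^sub>2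
           \<and> (\<forall>i\<in>{1, 2, 3}. foliation_in_pencil (\<omega> i) \<eta>\<^sub>1 \<eta>\<^sub>2)
           \<and> integrable_2form \<eta> \<and> defines_axis_foliation \<eta> \<eta>\<^sub>1 \<eta>\<^sub>2"
proof -
  define \<alpha> where "\<alpha> = \<omega> 1"
  define \<beta> where "\<beta> = \<omega> 2"
  define \<kappa> where "\<kappa> = \<omega> 3"
  have germs: "holo_germ \<alpha>" "holo_germ \<beta>" "holo_germ \<kappa>"
    using assms(2) by (simp_all add: holo_1form_germ_def \<alpha>_def \<beta>_def \<kappa>_def)
  have cod: "codim_ge 2 (zero_set \<alpha>)" "codim_ge 2 (zero_set \<beta>)" "codim_ge 2 (zero_set \<kappa>)"
    using assms(4) by (simp_all add: \<alpha>_def \<beta>_def \<kappa>_def)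
  have indep: "\<not> zero_germ (wedge11 \<alpha> \<beta>)" "\<not> zero_germ (wedge11 \<beta> \<kappa>)" "\<not> zero_germ (wedge11 \<kappa> \<alpha>)"
    using assms(5)[of 1 2] assms(5)[of 2 3] assms(5)[of 3 1]
    by (simp_all add: independent_1forms_def \<alpha>_def \<beta>_def \<kappa>_def)
  have int: "\<forall>\<^sub>F z in nhds 0. wedge12 \<alpha> (ext_deriv \<alpha>) z = 0" "\<forall>\<^sub>F z in nhds 0. wedge12 \<beta> (ext_deriv \<beta>) z = 0"
    "\<forall>\<^sub>F z in nhds 0. wedge12 \<kappa> (ext_deriv \<kappa>) z = 0"
    using assms(3) by (simp_all add: integrable_1form_def zero_germ_def \<alpha>_def \<beta>_def \<kappa>_def)
  have tan: "\<forall>\<^sub>F z in nhds 0. wedge21 \<eta> \<alpha> z = 0" "\<forall>\<^sub>F z in nhds 0. wedge21 \<eta> \<beta> z = 0"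
    "\<forall>\<^sub>F z in nhds 0. wedge21 \<eta> \<kappa> z = 0"
    using assms(9) by (simp_all add: zero_germ_def \<alpha>_def \<beta>_def \<kappa>_def)
  have \<eta>germ: "holo_germ \<eta>" and alt: "\<forall>\<^sub>F z in nhds 0. \<forall>i j. \<eta> z $ (i, j) = - \<eta> z $ (j, i)"
    using assms(6) by (simp_all add: holo_2form_germ_def alternating_germ_def)
  obtain r0 where r0pos: "0 < r0" and
      r0: "(\<forall>i. holo_fun_on (\<lambda>z. \<alpha> z $ i) (ball 0 r0)) \<and> (\<forall>i. holo_fun_on (\<lambda>z. \<beta> z $ i) (ball 0 r0)) \<and>
       (\<forall>i. holo_fun_on (\<lambda>z. \<kappa> z $ i) (ball 0 r0)) \<and> (\<forall>ij. holo_fun_on (\<lambda>z. \<eta> z $ ij) (ball 0 r0))"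
      "(\<forall>z\<in>ball 0 r0. wedge12 \<alpha> (ext_deriv \<alpha>) z = 0) \<and> (\<forall>z\<in>ball 0 r0. wedge12 \<beta> (ext_deriv \<beta>) z = 0) \<and>
       (\<forall>z\<in>ball 0 r0. wedge12 \<kappa> (ext_deriv \<kappa>) z = 0)"
      "(\<forall>z\<in>ball 0 r0. wedge21 \<eta> \<alpha> z = 0) \<and> (\<forall>z\<in>ball 0 r0. wedge21 \<eta> \<beta> z = 0) \<and> (\<forall>z\<in>ball 0 r0. wedge21 \<eta> \<kappa> z = 0)"
      "\<forall>z\<in>ball 0 r0. \<forall>i j. \<eta> z $ (i, j) = - \<eta> z $ (j, i)"
      "\<forall>z\<in>ball 0 r0. \<eta> z \<noteq> 0 \<longrightarrow> (\<exists>a b. \<forall>i j. \<eta> z $ (i, j) = a $ i * b $ j - a $ j * b $ i)"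
    by (rule eventually_radius[OF eventually_conj[OF
          eventually_conj[OF holo_germ_ball[OF germs(1)] eventually_conj[OF holo_germ_ball[OF germs(2)]
            eventually_conj[OF holo_germ_ball[OF germs(3)] holo_germ_ball[OF \<eta>germ]]]]
          eventually_conj[OF eventually_conj[OF eventually_nhds_0_ball[OF int(1)]
            eventually_conj[OF eventually_nhds_0_ball[OF int(2)] eventually_nhds_0_ball[OF int(3)]]]
          eventually_conj[OF eventually_conj[OF eventually_nhds_0_ball[OF tan(1)]
            eventually_conj[OF eventually_nhds_0_ball[OF tan(2)] eventually_nhds_0_ball[OF tan(3)]]]
          eventually_conj[OF eventually_nhds_0_ball[OF alt]
            eventually_nhds_0_ball[OF locally_decomposable_pointwise[OF assms(8)]]]]]] zero_less_one])
       (elim conjE, (rule that; (intro conjI)?; assumption))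
  let ?E = "ball (0 :: complex^'n) r0"
  have hol\<alpha>: "holo_fun_on (\<lambda>z. \<alpha> z $ i) ?E" and hol\<beta>: "holo_fun_on (\<lambda>z. \<beta> z $ i) ?E"
    and hol\<kappa>: "holo_fun_on (\<lambda>z. \<kappa> z $ i) ?E" and hol\<eta>: "holo_fun_on (\<lambda>z. \<eta> z $ ij) ?E" for i ij
    using r0(1) by blast+
  have int0: "wedge12 \<alpha> (ext_deriv \<alpha>) z = 0" "wedge12 \<beta> (ext_deriv \<beta>) z = 0" "wedge12 \<kappa> (ext_deriv \<kappa>) z = 0"
    if "z \<in> ?E" for z using r0(2) that by blast+
  have tan0: "wedge21 \<eta> \<alpha> z = 0" "wedge21 \<eta> \<beta> z = 0" "wedge21 \<eta> \<kappa> z = 0"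
    if "z \<in> ?E" for z using r0(3) that by blast+
  have alt0: "\<eta> z $ (i, j) = - \<eta> z $ (j, i)" if "z \<in> ?E" for z i j using r0(4) that by blast
  have dec: "\<exists>a b. \<forall>i j. \<eta> z $ (i, j) = a $ i * b $ j - a $ j * (b :: complex^'n) $ i"
    if "z \<in> ?E" "\<eta> z \<noteq> 0" for z using bspec[OF r0(5) that(1)] that(2) by (rule mp)
  have comp: "\<eta> z $ (i, j) * x z $ k + \<eta> z $ (j, k) * x z $ i + \<eta> z $ (k, i) * x z $ j = 0"
    if "wedge21 \<eta> x z = 0" for x z i j k
    using that wedge21_component[of \<eta> x z i j k] by simp
  \<comment> \<open>proportionality of 2-forms is tested on one component \<open>(k, l)\<close> of \<open>\<eta>\<close> that is not identically zero\<close>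
  obtain k l where kl: "\<not> zero_germ (\<lambda>z. \<eta> z $ (k, l))"
    using zero_germ_component[OF assms(7)] by auto
  have \<eta>ne: "\<exists>z\<in>?E. \<eta> z $ (k, l) \<noteq> 0" by (rule nonzero_in_ball[OF kl r0pos])

  have wedge_prop: "wedge11 x y z $ (i, j) * \<eta> z $ (m, n) = wedge11 x y z $ (m, n) * \<eta> z $ (i, j)"
    if z: "z \<in> ?E" and xy: "wedge21 \<eta> x z = 0" "wedge21 \<eta> y z = 0" for x y z i j m n
    unfolding wedge11_component
    by (rule tangent_wedge_proportional[OF dec[OF z] comp[OF xy(1)] comp[OF xy(2)]])
  have wedge_nz: "\<not> zero_germ (\<lambda>z. wedge11 x y z $ (k, l))"
    if x: "\<And>i. holo_fun_on (\<lambda>z. x z $ i) ?E" "\<And>z. z \<in> ?E \<Longrightarrow> wedge21 \<eta> x z = 0"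
      and y: "\<And>i. holo_fun_on (\<lambda>z. y z $ i) ?E" "\<And>z. z \<in> ?E \<Longrightarrow> wedge21 \<eta> y z = 0"
      and xy: "\<not> zero_germ (wedge11 x y)" for x y
  proof
    assume zero: "zero_germ (\<lambda>z. wedge11 x y z $ (k, l))"
    have hol: "holo_fun_on (\<lambda>z. wedge11 x y z $ (i, j)) ?E" for i j
      unfolding wedge11_component by (intro holo_fun_on_diff holo_fun_on_mult x(1) y(1))
    obtain i j where ij: "\<not> zero_germ (\<lambda>z. wedge11 x y z $ (i, j))"
      using zero_germ_component[OF xy] by auto
    obtain z where z: "z \<in> ?E" "wedge11 x y z $ (i, j) * \<eta> z $ (k, l) \<noteq> 0"
      using product_nonzero[OF hol hol\<eta> convex_ball nonzero_in_ball[OF ij r0pos] \<eta>ne] by blast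
    then have "wedge11 x y z $ (k, l) \<noteq> 0" using wedge_prop[OF z(1) x(2)[OF z(1)] y(2)[OF z(1)], of i j k l] by auto
    with not_zero_germ_scalar[OF hol z(1)] zero show False by blast
  qed

  define f :: "complex^'n \<Rightarrow> complex^3" where
    "f z = vector [wedge11 \<beta> \<kappa> z $ (k, l), wedge11 \<kappa> \<alpha> z $ (k, l), wedge11 \<alpha> \<beta> z $ (k, l)]" for z
  have f: "f z $ 1 = wedge11 \<beta> \<kappa> z $ (k, l)" "f z $ 2 = wedge11 \<kappa> \<alpha> z $ (k, l)" "f z $ 3 = wedge11 \<alpha> \<beta> z $ (k, l)" for z
    by (simp_all add: f_def)
  have holf: "holo_fun_on (\<lambda>z. f z $ i) ?E" for i
    using exhaust_3[of i]
    by (auto simp: f wedge11_component intro!: holo_fun_on_diff holo_fun_on_mult hol\<alpha> hol\<beta> hol\<kappa>)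
  have fnz: "\<not> zero_germ (\<lambda>z. f z $ i)" for i
    using exhaust_3[of i] wedge_nz[OF hol\<beta> tan0(2) hol\<kappa> tan0(3) indep(2)]
      wedge_nz[OF hol\<kappa> tan0(3) hol\<alpha> tan0(1) indep(3)] wedge_nz[OF hol\<alpha> tan0(1) hol\<beta> tan0(2) indep(1)]
    by (auto simp: f)
  have rel: "\<forall>z\<in>?E. f z $ 1 *s \<alpha> z + f z $ 2 *s \<beta> z + f z $ 3 *s \<kappa> z = 0"
  proof
    fix z assume z: "z \<in> ?E"
    have "f z $ 1 * \<alpha> z $ m + f z $ 2 * \<beta> z $ m + f z $ 3 * \<kappa> z $ m = 0" for m
    proof (rule continuous_zero_of_dense[OF hol\<eta> convex_ball \<eta>ne _ _ z])
      show "continuous_on ?E (\<lambda>z. f z $ 1 * \<alpha> z $ m + f z $ 2 * \<beta> z $ m + f z $ 3 * \<kappa> z $ m)"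
        by (intro holo_fun_on_continuous_on holo_fun_on_add holo_fun_on_mult holf hol\<alpha> hol\<beta> hol\<kappa>)
      fix z assume z: "z \<in> ?E" "\<eta> z $ (k, l) \<noteq> 0"
      then have "\<eta> z \<noteq> 0" by auto
      from tangent_relation[OF this dec[OF z(1) this] comp[OF tan0(1)] comp[OF tan0(2)] comp[OF tan0(3)], OF z(1) z(1) z(1)]
      show "f z $ 1 * \<alpha> z $ m + f z $ 2 * \<beta> z $ m + f z $ 3 * \<kappa> z $ m = 0"
        by (simp add: f wedge11_component)
    qed
    then show "f z $ 1 *s \<alpha> z + f z $ 2 *s \<beta> z + f z $ 3 *s \<kappa> z = 0" by (simp add: vec_eq_iff)
  qed
  obtain r and p :: "complex^'n \<Rightarrow> complex^3" where rp: "0 < r \<and> r \<le> r0 \<and> (\<forall>i. holo_fun_on (\<lambda>z. p z $ i) (ball 0 r)) \<and>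
    (\<forall>i. \<not> zero_germ (\<lambda>z. p z $ i)) \<and>
    (\<forall>z\<in>ball 0 r. p z $ 1 *s \<alpha> z + p z $ 2 *s \<beta> z + p z $ 3 *s \<kappa> z = 0) \<and>
    codim_ge 2 (zero_set (\<lambda>z. p z $ 1 *s \<alpha> z) \<inter> zero_set (\<lambda>z. p z $ 2 *s \<beta> z))"
    using coprime_relation[OF r0pos hol\<alpha> hol\<beta> hol\<kappa> cod holf fnz rel] by (elim exE) (rule that)
  let ?D = "ball (0 :: complex^'n) r"
  from rp have rpos: "0 < r" and sub: "?D \<subseteq> ?E" by (simp_all add: subset_ball)
  from rp have holp: "holo_fun_on (\<lambda>z. p z $ i) ?D" for i by simp
  from rp have pnz: "\<not> zero_germ (\<lambda>z. p z $ i)" for i by simp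
  from rp have prel: "p z $ 1 *s \<alpha> z + p z $ 2 *s \<beta> z + p z $ 3 *s \<kappa> z = 0" if "z \<in> ?D" for z using that by simp
  have h\<alpha>: "holo_fun_on (\<lambda>z. \<alpha> z $ i) ?D" and h\<beta>: "holo_fun_on (\<lambda>z. \<beta> z $ i) ?D" and h\<kappa>: "holo_fun_on (\<lambda>z. \<kappa> z $ i) ?D" for i
    by (rule holo_fun_on_subset[OF hol\<alpha> open_ball sub] holo_fun_on_subset[OF hol\<beta> open_ball sub]
        holo_fun_on_subset[OF hol\<kappa> open_ball sub])+
  \<comment> \<open>the generators of the pencil; the third foliation is given by their sum\<close>
  define \<eta>\<^sub>1 where "\<eta>\<^sub>1 z = p z $ 1 *s \<alpha> z" for z
  define \<eta>\<^sub>2 where "\<eta>\<^sub>2 z = p z $ 2 *s \<beta> z" for z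
  have hol1: "holo_fun_on (\<lambda>z. \<eta>\<^sub>1 z $ i) ?D" and hol2: "holo_fun_on (\<lambda>z. \<eta>\<^sub>2 z $ i) ?D" for i
    unfolding \<eta>\<^sub>1_def \<eta>\<^sub>2_def vector_smult_component by (intro holo_fun_on_mult holp h\<alpha> h\<beta>)+
  have sum: "\<eta>\<^sub>1 z + \<eta>\<^sub>2 z = (- p z $ 3) *s \<kappa> z" if "z \<in> ?D" for z
    using prel[OF that] by (simp add: \<eta>\<^sub>1_def \<eta>\<^sub>2_def vec_eq_iff eq_neg_iff_add_eq_0)
  have w12: "wedge11 \<eta>\<^sub>1 \<eta>\<^sub>2 z $ ij = (p z $ 1 * p z $ 2) * wedge11 \<alpha> \<beta> z $ ij" for z ij
    by (cases ij) (simp add: wedge11_component \<eta>\<^sub>1_def \<eta>\<^sub>2_def algebra_simps)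
  have holw: "holo_fun_on (\<lambda>z. wedge11 \<alpha> \<beta> z $ ij) ?D" for ij
    by (cases ij) (auto simp: wedge11_component intro!: holo_fun_on_diff holo_fun_on_mult h\<alpha> h\<beta>)
  have hol12: "holo_fun_on (\<lambda>z. wedge11 \<eta>\<^sub>1 \<eta>\<^sub>2 z $ ij) ?D" for ij
    unfolding w12 by (intro holo_fun_on_mult holp holw)
  have wnz: "\<not> zero_germ (\<lambda>z. wedge11 \<alpha> \<beta> z $ (k, l))" using fnz[of 3] by (simp add: f)
  have w12nz: "\<not> zero_germ (\<lambda>z. wedge11 \<eta>\<^sub>1 \<eta>\<^sub>2 z $ (k, l))"
  proof -
    obtain z where "z \<in> ?D" "(p z $ 1 * p z $ 2) * wedge11 \<alpha> \<beta> z $ (k, l) \<noteq> 0"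
      using product_nonzero[OF holo_fun_on_mult[OF holp holp] holw convex_ball
          product_nonzero[OF holp holp convex_ball nonzero_in_ball[OF pnz rpos] nonzero_in_ball[OF pnz rpos]]
          nonzero_in_ball[OF wnz rpos]] by blast
    then show ?thesis using not_zero_germ_scalar[OF hol12] unfolding w12 by blast
  qed
  have nzforms: "\<not> zero_germ \<alpha>" "\<not> zero_germ \<beta>" "\<not> zero_germ \<kappa>"
  proof -
    have "zero_germ (wedge11 x y)" if "zero_germ x" for x y :: "complex^'n \<Rightarrow> complex^'n"
      using that unfolding zero_germ_def
      by (rule eventually_mono) (auto simp: vec_eq_iff wedge11_component)
    then show "\<not> zero_germ \<alpha>" "\<not> zero_germ \<beta>" "\<not> zero_germ \<kappa>" using indep by blast+
  qed

  have "integrable_pencil \<eta>\<^sub>1 \<eta>\<^sub>2"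
    unfolding integrable_pencil_def
  proof (intro conjI ballI)
    show "holo_1form_germ \<eta>\<^sub>1" "holo_1form_germ \<eta>\<^sub>2"
      unfolding holo_1form_germ_def by (rule holo_germI[OF rpos hol1], rule holo_germI[OF rpos hol2])
    show "independent_1forms \<eta>\<^sub>1 \<eta>\<^sub>2"
      unfolding independent_1forms_def
    proof
      assume "zero_germ (wedge11 \<eta>\<^sub>1 \<eta>\<^sub>2)"
      then have "zero_germ (\<lambda>z. wedge11 \<eta>\<^sub>1 \<eta>\<^sub>2 z $ (k, l))" unfolding zero_germ_def by (rule eventually_mono) simp
      with w12nz show False by blast
    qed
    show "\<not> common_codim1_component (zero_set \<eta>\<^sub>1) (zero_set \<eta>\<^sub>2)"
      using rp unfolding \<eta>\<^sub>1_def \<eta>\<^sub>2_def by (intro no_common_codim1_component) simp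
    fix \<theta> assume "\<theta> \<in> pencil \<eta>\<^sub>1 \<eta>\<^sub>2"
    then obtain a b where \<theta>: "\<theta> = (\<lambda>z. a *s \<eta>\<^sub>1 z + b *s \<eta>\<^sub>2 z)" by (auto simp: pencil_def)
    show "integrable_1form \<theta>"
      unfolding integrable_1form_def zero_germ_def \<theta>
    proof (rule eventually_ball_nhds_0[OF rpos])
      fix z assume z: "z \<in> ?D"
      then have z0: "z \<in> ?E" using sub by blast
      show "wedge12 (\<lambda>z. a *s \<eta>\<^sub>1 z + b *s \<eta>\<^sub>2 z) (ext_deriv (\<lambda>z. a *s \<eta>\<^sub>1 z + b *s \<eta>\<^sub>2 z)) z = 0"
      proof (rule integrable_pencil_members[OF hol1 hol2 z])
        show "wedge12 \<eta>\<^sub>1 (ext_deriv \<eta>\<^sub>1) z = 0"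
          using integrable_scale[OF holp h\<alpha> z int0(1)[OF z0], of 1] unfolding \<eta>\<^sub>1_def[abs_def] .
        show "wedge12 \<eta>\<^sub>2 (ext_deriv \<eta>\<^sub>2) z = 0"
          using integrable_scale[OF holp h\<beta> z int0(2)[OF z0], of 2] unfolding \<eta>\<^sub>2_def[abs_def] .
        have "wedge12 (\<lambda>z. \<eta>\<^sub>1 z + \<eta>\<^sub>2 z) (ext_deriv (\<lambda>z. \<eta>\<^sub>1 z + \<eta>\<^sub>2 z)) z =
            wedge12 (\<lambda>z. (- p z $ 3) *s \<kappa> z) (ext_deriv (\<lambda>z. (- p z $ 3) *s \<kappa> z)) z"
          by (rule wedge12_ext_deriv_cong[OF open_ball z sum])
        also have "\<dots> = 0" by (rule integrable_scale[OF holo_fun_on_uminus[OF holp] h\<kappa> z int0(3)[OF z0]])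
        finally show "wedge12 (\<lambda>z. \<eta>\<^sub>1 z + \<eta>\<^sub>2 z) (ext_deriv (\<lambda>z. \<eta>\<^sub>1 z + \<eta>\<^sub>2 z)) z = 0" .
      qed
    qed
  qed
  moreover have "foliation_in_pencil (\<omega> i) \<eta>\<^sub>1 \<eta>\<^sub>2" if "i \<in> {1, 2, 3}" for i
  proof -
    have mem: "(\<lambda>z. a *s \<eta>\<^sub>1 z + b *s \<eta>\<^sub>2 z) \<in> pencil \<eta>\<^sub>1 \<eta>\<^sub>2" for a b by (auto simp: pencil_def)
    have "foliation_in_pencil \<alpha> \<eta>\<^sub>1 \<eta>\<^sub>2"
      by (rule foliation_in_pencilI[OF rpos h\<alpha> cod(1) nzforms(1) holp[of 1] pnz mem[of 1 0]]) (simp add: \<eta>\<^sub>1_def)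
    moreover have "foliation_in_pencil \<beta> \<eta>\<^sub>1 \<eta>\<^sub>2"
      by (rule foliation_in_pencilI[OF rpos h\<beta> cod(2) nzforms(2) holp[of 2] pnz mem[of 0 1]]) (simp add: \<eta>\<^sub>2_def)
    moreover have "foliation_in_pencil \<kappa> \<eta>\<^sub>1 \<eta>\<^sub>2"
    proof (rule foliation_in_pencilI[OF rpos h\<kappa> cod(3) nzforms(3) holo_fun_on_uminus[OF holp[of 3]] _ mem[of 1 1]])
      show "\<not> zero_germ (\<lambda>z. - p z $ 3)" using pnz[of 3] by (simp add: zero_germ_def)
    qed (use sum in simp)
    ultimately show ?thesis using that by (auto simp: \<alpha>_def \<beta>_def \<kappa>_def)
  qed
  moreover have "integrable_2form \<eta>"
  proof -
    obtain z0 where z0: "z0 \<in> ?E" "wedge11 \<alpha> \<beta> z0 $ (k, l) \<noteq> 0" using nonzero_in_ball[OF wnz r0pos] by blast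
    show ?thesis
      by (rule integrable_2form_of_tangent_integrable[OF r0pos hol\<alpha> hol\<beta> hol\<eta> int0(1,2) tan0(1,2) alt0 wedge_prop z0 assms(8)])
         (use tan0 in auto)
  qed
  moreover have "defines_axis_foliation \<eta> \<eta>\<^sub>1 \<eta>\<^sub>2"
  proof -
    obtain \<gamma> where sat: "saturation \<eta> \<gamma>" using saturation_exists[OF \<eta>germ assms(7)] by blast
    then obtain h where \<gamma>: "holo_germ \<gamma>" "codim_ge 2 (zero_set \<gamma>)" "holo_fun_germ h" "\<not> zero_germ h"
      "\<forall>\<^sub>F z in nhds 0. \<eta> z = h z *s \<gamma> z" unfolding saturation_def by blast
    have \<gamma>nz: "\<not> zero_germ (\<lambda>z. \<gamma> z $ (k, l))"
    proof
      assume "zero_germ (\<lambda>z. \<gamma> z $ (k, l))"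
      then have "zero_germ (\<lambda>z. \<eta> z $ (k, l))" using \<gamma>(5) unfolding zero_germ_def by eventually_elim simp
      with kl show False by blast
    qed
    obtain s where s: "0 < s" "s \<le> r" "\<forall>i. holo_fun_on (\<lambda>z. \<gamma> z $ i) (ball 0 s)"
        "holo_fun_on h (ball 0 s)" "\<forall>z\<in>ball 0 s. \<eta> z = h z *s \<gamma> z"
      by (rule eventually_radius[OF eventually_conj[OF holo_germ_ball[OF \<gamma>(1)] eventually_conj[OF
          holo_fun_germ_ball[OF \<gamma>(3)] eventually_nhds_0_ball[OF \<gamma>(5)]]] rpos])
         (elim conjE, rule that)
    from s have spos: "0 < s" and ssub: "ball (0 :: complex^'n) s \<subseteq> ?D" by (simp_all add: subset_ball)
    from s have hol\<gamma>: "holo_fun_on (\<lambda>z. \<gamma> z $ i) (ball 0 s)" and holh: "holo_fun_on h (ball 0 s)" for i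
      by (cases i, simp_all)
    have h12: "holo_fun_on (\<lambda>z. wedge11 \<eta>\<^sub>1 \<eta>\<^sub>2 z $ ij) (ball 0 s)" for ij
      by (rule holo_fun_on_subset[OF hol12 open_ball ssub])
    have prp: "wedge11 \<eta>\<^sub>1 \<eta>\<^sub>2 z $ ij * \<gamma> z $ (k, l) = wedge11 \<eta>\<^sub>1 \<eta>\<^sub>2 z $ (k, l) * \<gamma> z $ ij"
      if z: "z \<in> ball 0 s" for z ij
    proof -
      have "wedge11 \<eta>\<^sub>1 \<eta>\<^sub>2 z $ ij * \<gamma> z $ (k, l) - wedge11 \<eta>\<^sub>1 \<eta>\<^sub>2 z $ (k, l) * \<gamma> z $ ij = 0"
      proof (rule continuous_zero_of_dense[OF holh convex_ball nonzero_in_ball[OF \<gamma>(4) spos] _ _ z])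
        show "continuous_on (ball 0 s) (\<lambda>z. wedge11 \<eta>\<^sub>1 \<eta>\<^sub>2 z $ ij * \<gamma> z $ (k, l) - wedge11 \<eta>\<^sub>1 \<eta>\<^sub>2 z $ (k, l) * \<gamma> z $ ij)"
          by (intro holo_fun_on_continuous_on holo_fun_on_diff holo_fun_on_mult h12 hol\<gamma>)
        fix z assume z: "z \<in> ball 0 s" "h z \<noteq> 0"
        obtain i j where ij: "ij = (i, j)" by (cases ij)
        have z0: "z \<in> ?E" using z(1) ssub sub by blast
        have \<eta>h: "\<eta> z = h z *s \<gamma> z" using s z(1) by blast
        have "wedge11 \<alpha> \<beta> z $ ij * (h z * \<gamma> z $ (k, l)) = wedge11 \<alpha> \<beta> z $ (k, l) * (h z * \<gamma> z $ ij)"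
          using wedge_prop[OF z0 tan0(1)[OF z0] tan0(2)[OF z0], of i j k l] unfolding ij \<eta>h by simp
        then have "h z * (wedge11 \<alpha> \<beta> z $ ij * \<gamma> z $ (k, l)) = h z * (wedge11 \<alpha> \<beta> z $ (k, l) * \<gamma> z $ ij)"
          by (simp only: mult.left_commute)
        then have "wedge11 \<alpha> \<beta> z $ ij * \<gamma> z $ (k, l) = wedge11 \<alpha> \<beta> z $ (k, l) * \<gamma> z $ ij" using z(2) by simp
        then show "wedge11 \<eta>\<^sub>1 \<eta>\<^sub>2 z $ ij * \<gamma> z $ (k, l) - wedge11 \<eta>\<^sub>1 \<eta>\<^sub>2 z $ (k, l) * \<gamma> z $ ij = 0"
          unfolding w12 by (simp add: mult.assoc)
      qed
      then show ?thesis by simp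
    qed
    have "saturation (wedge11 \<eta>\<^sub>1 \<eta>\<^sub>2) \<gamma>"
    proof (rule saturationI_proportional[OF holo_germI[OF rpos hol12] w12nz \<gamma>(1) \<gamma>nz \<gamma>(2)])
      show "\<forall>\<^sub>F z in nhds 0. \<forall>j. wedge11 \<eta>\<^sub>1 \<eta>\<^sub>2 z $ j * \<gamma> z $ (k, l) = wedge11 \<eta>\<^sub>1 \<eta>\<^sub>2 z $ (k, l) * \<gamma> z $ j"
        by (rule eventually_ball_nhds_0[OF spos]) (use prp in blast)
    qed
    with sat show ?thesis unfolding defines_axis_foliation_def same_foliation_def by blast
  qed
  ultimately show ?thesis by blast
qed

end
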